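(* Let $\Bbbk$ be a field, $Q$ a commutative Noetherian monoid, and $I\subset\Bbbk[Q]$ a binomial ideal. Then the intersection of the binoccular components $\overline W_w^P(I)$, over all monoid primes $P\subset Q$ and all essential $I$-witnesses $w\in Q$ for $P$, is a mesoprimary decomposition of $I$. That is, this intersection equals $I$, each $\overline W_w^P(I)$ is $P$-mesoprimary, and the $P$-mesoprimes of $I$ and of $\overline W_w^P(I)$ at each cogenerator of $\overline W_w^P(I)$ coincide.
   Context: Monoids. $Q$ is commutative, Noetherian (equivalently finitely generated), written additively. An ideal of a monoid is a subset closed under adding arbitrary elements; $\langle q\rangle$ is the ideal generated by $q$. A nil is an absorbing element $\infty$; nilpotent means some positive multiple is nil; $c$ is cancellative if $a+c=b+c\Rightarrow a=b$. A prime $P\subset Q$ is a proper, possibly empty, ideal whose complement is a submonoid. $Q_P$ is the localization inverting $Q\smallsetminus P$, with unit group $G_P$. For a congruence $\sim$ on $Q$ (also denoting the congruence it generates on $Q_P$), $\overline Q=Q/{\sim}$, $\overline Q_P=Q_P/{\sim}$, and $\bar q$ is the image of $q$ in $\overline Q_P$. Green's preorder: $a\le b$ iff $\langle b\rangle\subseteq\langle a\rangle$. $q$ is a key aide for $w$ (with respect to $\sim$, $P$) if $\bar w\ne\bar q$, $\bar w+\bar p=\bar q+\bar p$ for all $p\in P$, and not $\bar q<\bar w$ strictly in Green's preorder; $w$ is a key $\sim$-witness for $P$ if it has a key aide; a key witness $w$ is a cogenerator of $\sim$ if $w+p$ is nil modulo $\sim$ for all $p\in P$. $\sim$ is $P$-primary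 if each $p\in P$ is nilpotent and each $f\in Q\smallsetminus P$ cancellative in $\overline Q$; $P$-mesoprimary if moreover $q+a=q+b\ne\infty\Rightarrow a=b$ for all $q\in\overline Q$ and cancellative $a,b\in\overline Q$; $P$-coprincipal if moreover all cogenerators of $\sim$ generate the same ideal of $\overline Q_P$. Binomial ideals. $\Bbbk[Q]$ has basis $\mathbf t^a$, $a\in Q$. A binomial is $\mathbf t^a-\lambda\mathbf t^b$ with $\lambda\in\Bbbk$ (possibly $0$); an ideal is binomial if generated by binomials. $I$ induces the congruence $a\sim_I b$ iff $\mathbf t^a-\lambda\mathbf t^b\in I$ for some $\lambda\ne0$. $\mathfrak m_P=\langle\mathbf t^p:p\in P\rangle$. Subscript $P$ denotes inverting all monomials outside $\mathfrak m_P$, so $\Bbbk[Q]_P=\Bbbk[Q_P]$; $\Bbbk[Q_P]/I_P$ is graded by $Q_P/{\sim_I}$. $I$ is $P$-mesoprimary (resp. $P$-coprincipal) if $\sim_I$ is and $I$ is maximal among proper binomial ideals inducing $\sim_I$. A cogenerator of such an $I$ is a $w\in Q$ with $\mathbf t^w\notin I_P$ and $\mathbf t^{w+p}\in I_P$ for all $p\in P$; we then say $I$ is cogenerated by $w$. Mesoprimes. For $q\in Q$ with $\mathbf t^q\notin I_P$, let $K_q^P\subset G_P$ be the stabilizer of the class of $q$ modulo $\sim_I$, $\rho:K_q^P\to\Bbbk^*$ the homomorphism with $(\mathbf t^u-\rho(u))\mathbf t^q=0$ in $\Bbbk[Q_P]/I_P$, and $I_\rho=\langle\mathbf t^u-\rho(u-v)\mathbf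 t^v : u,v\in G_P,\ u-v\in K_q^P\rangle\subset\Bbbk[Q]_P$. The $P$-mesoprime of $I$ at $q$ is the preimage in $\Bbbk[Q]$ of $I_\rho+(\mathfrak m_P)_P$. Essential witnesses. $w\in Q$ is an essential $I$-witness for $P$ if $w$ is a key $\sim_I$-witness for $P$, or some element of $\Bbbk[Q_P]/I_P$ annihilated by $\mathfrak m_P$ has $\mathbf t^w$ minimal (Green's preorder) among its nonzero monomials. Components. The $P$-coprincipal component $W_w^P(I)$ is the preimage in $\Bbbk[Q]$ of $I_P+I_\rho+M_w^P(I)$, with $\rho$ taken at $q=w$ and $M_w^P(I)$ generated by the monomials $\mathbf t^u$, $u\in Q$, with $\bar w\notin\langle\bar u\rangle\subseteq Q_P/{\sim_I}$; it is $P$-coprincipal cogenerated by $w$. For a $P$-coprincipal binomial ideal $J$ cogenerated by $w$, the binoccular collapse is $J_1=J+\langle\mathbf t^a-\lambda\mathbf t^b : \bar a,\bar b\notin\langle\bar w\rangle\subseteq Q_P/{\sim_J},\ \mathbf t^p(\mathbf t^a-\lambda\mathbf t^b)\in J\ \text{for all } p\in P\rangle$; the $i$-th collapse $J_i$ is the collapse of $J_{i-1}$ (each is $P$-coprincipal cogenerated by $w$), and the binoccular closure of $J$ is $\bigcup_i J_i$. The binoccular component $\overline W_w^P(I)$ is the binoccular closure of $W_w^P(I)$. An empty intersection of ideals is $\Bbbk[Q]$. *)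

theory Defs
  imports "HOL-Algebra.Ideal"
begin

text \<open>
  Monoids are commutative \<open>HOL-Algebra\<close> monoids. The sources write them additively; here
  \<open>\<otimes>\<close> is the monoid operation, \<open>\<one>\<close> its neutral element and \<open>[^]\<close> the multiple of an element.
\<close>

section \<open>Commutative monoids\<close>

text \<open>For commutative monoids, being Noetherian is the same as being finitely generated.\<close>

definition fin_gen_monoid :: "('q, 'x) monoid_scheme \<Rightarrow> bool" where
  "fin_gen_monoid M \<longleftrightarrow>
     (\<exists>S. finite S \<and> S \<subseteq> carrier M \<and> \<Inter>{H. submonoid H M \<and> S \<subseteq> H} = carrier M)"

definition monoid_ideal :: "('q, 'x) monoid_scheme \<Rightarrow> 'q set \<Rightarrow> bool" where
  "monoid_ideal M A \<longleftrightarrow> A \<subseteq> carrier M \<and> (\<forall>a\<in>A. \<forall>q\<in>carrier M. a \<otimes>\<^bsub>M\<^esub> q \<in> A)"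

definition ideal_of :: "('q, 'x) monoid_scheme \<Rightarrow> 'q \<Rightarrow> 'q set" where
  "ideal_of M q = \<Inter>{A. monoid_ideal M A \<and> q \<in> A}"

definition green_le :: "('q, 'x) monoid_scheme \<Rightarrow> 'q \<Rightarrow> 'q \<Rightarrow> bool" where
  "green_le M a b \<longleftrightarrow> ideal_of M b \<subseteq> ideal_of M a"

definition green_less :: "('q, 'x) monoid_scheme \<Rightarrow> 'q \<Rightarrow> 'q \<Rightarrow> bool" where
  "green_less M a b \<longleftrightarrow> green_le M a b \<and> \<not> green_le M b a"

definition is_nil :: "('q, 'x) monoid_scheme \<Rightarrow> 'q \<Rightarrow> bool" where
  "is_nil M z \<longleftrightarrow> z \<in> carrier M \<and> (\<forall>a\<in>carrier M. z \<otimes>\<^bsub>M\<^esub> a = z)"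

definition nilpotent_elem :: "('q, 'x) monoid_scheme \<Rightarrow> 'q \<Rightarrow> bool" where
  "nilpotent_elem M a \<longleftrightarrow> a \<in> carrier M \<and> (\<exists>n::nat. n > 0 \<and> is_nil M (a [^]\<^bsub>M\<^esub> n))"

definition cancellative :: "('q, 'x) monoid_scheme \<Rightarrow> 'q \<Rightarrow> bool" where
  "cancellative M c \<longleftrightarrow> c \<in> carrier M \<and>
     (\<forall>a\<in>carrier M. \<forall>b\<in>carrier M. a \<otimes>\<^bsub>M\<^esub> c = b \<otimes>\<^bsub>M\<^esub> c \<longrightarrow> a = b)"

text \<open>The empty set may be a prime.\<close>

definition monoid_prime :: "('q, 'x) monoid_scheme \<Rightarrow> 'q set \<Rightarrow> bool" where
  "monoid_prime M P \<longleftrightarrow>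
     monoid_ideal M P \<and> P \<noteq> carrier M \<and> submonoid (carrier M - P) M"


section \<open>Congruences, quotients, localizations\<close>

definition monoid_cong :: "('q, 'x) monoid_scheme \<Rightarrow> ('q \<times> 'q) set \<Rightarrow> bool" where
  "monoid_cong M r \<longleftrightarrow> equiv (carrier M) r \<and>
     (\<forall>(a, b)\<in>r. \<forall>c\<in>carrier M. (a \<otimes>\<^bsub>M\<^esub> c, b \<otimes>\<^bsub>M\<^esub> c) \<in> r)"

definition gen_cong :: "('q, 'x) monoid_scheme \<Rightarrow> ('q \<times> 'q) set \<Rightarrow> ('q \<times> 'q) set" where
  "gen_cong M S = \<Inter>{r. monoid_cong M r \<and> S \<subseteq> r}"

definition quot_monoid :: "('q, 'x) monoid_scheme \<Rightarrow> ('q \<times> 'q) set \<Rightarrow> 'q set monoid" where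
  "quot_monoid M r =
     \<lparr>carrier = carrier M // r,
      mult = (\<lambda>A B. \<Union>a\<in>A. \<Union>b\<in>B. r `` {a \<otimes>\<^bsub>M\<^esub> b}),
      one = r `` {\<one>\<^bsub>M\<^esub>}\<rparr>"

text \<open>The pair \<open>(a, f)\<close>, with \<open>f\<close> outside \<open>P\<close>, stands for the formal difference \<open>a - f\<close>.\<close>

definition loc_rel ::
    "('q, 'x) monoid_scheme \<Rightarrow> 'q set \<Rightarrow> (('q \<times> 'q) \<times> ('q \<times> 'q)) set" where
  "loc_rel M P =
     {((a, f), (b, g)). a \<in> carrier M \<and> b \<in> carrier M \<and>
        f \<in> carrier M - P \<and> g \<in> carrier M - P \<and>
        (\<exists>h\<in>carrier M - P. a \<otimes>\<^bsub>M\<^esub> g \<otimes>\<^bsub>M\<^esub> h = b \<otimes>\<^bsub>M\<^esub> f \<otimes>\<^bsub>M\<^esub> h)}"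

definition loc_monoid :: "('q, 'x) monoid_scheme \<Rightarrow> 'q set \<Rightarrow> ('q \<times> 'q) set monoid" where
  "loc_monoid M P =
     \<lparr>carrier = (carrier M \<times> (carrier M - P)) // loc_rel M P,
      mult = (\<lambda>X Y. \<Union>(a, f)\<in>X. \<Union>(b, g)\<in>Y. loc_rel M P `` {(a \<otimes>\<^bsub>M\<^esub> b, f \<otimes>\<^bsub>M\<^esub> g)}),
      one = loc_rel M P `` {(\<one>\<^bsub>M\<^esub>, \<one>\<^bsub>M\<^esub>)}\<rparr>"

definition to_loc :: "('q, 'x) monoid_scheme \<Rightarrow> 'q set \<Rightarrow> 'q \<Rightarrow> ('q \<times> 'q) set" where
  "to_loc M P q = loc_rel M P `` {(q, \<one>\<^bsub>M\<^esub>)}"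

definition loc_cong ::
    "('q, 'x) monoid_scheme \<Rightarrow> 'q set \<Rightarrow> ('q \<times> 'q) set \<Rightarrow> (('q \<times> 'q) set \<times> ('q \<times> 'q) set) set"
  where
  "loc_cong M P r =
     gen_cong (loc_monoid M P) {(to_loc M P a, to_loc M P b) |a b. (a, b) \<in> r}"

text \<open>The monoid \<open>Q\<^sub>P/\<sim>\<close> and the image in it of an element of \<open>Q\<close>.\<close>

definition loc_quot ::
    "('q, 'x) monoid_scheme \<Rightarrow> 'q set \<Rightarrow> ('q \<times> 'q) set \<Rightarrow> ('q \<times> 'q) set set monoid" where
  "loc_quot M P r = quot_monoid (loc_monoid M P) (loc_cong M P r)"

definition loc_bar ::
    "('q, 'x) monoid_scheme \<Rightarrow> 'q set \<Rightarrow> ('q \<times> 'q) set \<Rightarrow> 'q \<Rightarrow> ('q \<times> 'q) set set" where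
  "loc_bar M P r q = loc_cong M P r `` {to_loc M P q}"

definition key_aide ::
    "('q, 'x) monoid_scheme \<Rightarrow> 'q set \<Rightarrow> ('q \<times> 'q) set \<Rightarrow> 'q \<Rightarrow> 'q \<Rightarrow> bool" where
  "key_aide M P r w q \<longleftrightarrow> q \<in> carrier M \<and>
     loc_bar M P r w \<noteq> loc_bar M P r q \<and>
     (\<forall>p\<in>P. loc_bar M P r w \<otimes>\<^bsub>loc_quot M P r\<^esub> loc_bar M P r p =
             loc_bar M P r q \<otimes>\<^bsub>loc_quot M P r\<^esub> loc_bar M P r p) \<and>
     \<not> green_less (loc_quot M P r) (loc_bar M P r q) (loc_bar M P r w)"

definition key_witness ::
    "('q, 'x) monoid_scheme \<Rightarrow> 'q set \<Rightarrow> ('q \<times> 'q) set \<Rightarrow> 'q \<Rightarrow> bool" where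
  "key_witness M P r w \<longleftrightarrow> w \<in> carrier M \<and> (\<exists>q. key_aide M P r w q)"

definition primary_cong ::
    "('q, 'x) monoid_scheme \<Rightarrow> 'q set \<Rightarrow> ('q \<times> 'q) set \<Rightarrow> bool" where
  "primary_cong M P r \<longleftrightarrow> monoid_cong M r \<and>
     (\<forall>p\<in>P. nilpotent_elem (quot_monoid M r) (r `` {p})) \<and>
     (\<forall>f\<in>carrier M - P. cancellative (quot_monoid M r) (r `` {f}))"

definition mesoprimary_cong ::
    "('q, 'x) monoid_scheme \<Rightarrow> 'q set \<Rightarrow> ('q \<times> 'q) set \<Rightarrow> bool" where
  "mesoprimary_cong M P r \<longleftrightarrow> primary_cong M P r \<and>
     (\<forall>q\<in>carrier (quot_monoid M r). \<forall>a b.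
        cancellative (quot_monoid M r) a \<and> cancellative (quot_monoid M r) b \<and>
        q \<otimes>\<^bsub>quot_monoid M r\<^esub> a = q \<otimes>\<^bsub>quot_monoid M r\<^esub> b \<and>
        \<not> is_nil (quot_monoid M r) (q \<otimes>\<^bsub>quot_monoid M r\<^esub> a) \<longrightarrow> a = b)"


section \<open>Monoid algebras and binomial ideals\<close>

text \<open>
  The algebra \<open>K[M]\<close> consists of the finitely supported functions on \<open>carrier M\<close>, extended by
  zero outside the carrier, with convolution as product.
\<close>

definition monoid_algebra ::
    "('k, 'y) ring_scheme \<Rightarrow> ('q, 'x) monoid_scheme \<Rightarrow> ('q \<Rightarrow> 'k) ring" where
  "monoid_algebra K M =
     \<lparr>carrier = {f. (\<forall>q. f q \<in> carrier K) \<and> (\<forall>q. q \<notin> carrier M \<longrightarrow> f q = \<zero>\<^bsub>K\<^esub>) \<and>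
                    finite {q. f q \<noteq> \<zero>\<^bsub>K\<^esub>}},
      mult = (\<lambda>f g q. finsum K (\<lambda>(a, b). f a \<otimes>\<^bsub>K\<^esub> g b)
                {(a, b). f a \<noteq> \<zero>\<^bsub>K\<^esub> \<and> g b \<noteq> \<zero>\<^bsub>K\<^esub> \<and> a \<otimes>\<^bsub>M\<^esub> b = q}),
      one = (\<lambda>q. if q = \<one>\<^bsub>M\<^esub> then \<one>\<^bsub>K\<^esub> else \<zero>\<^bsub>K\<^esub>),
      zero = (\<lambda>q. \<zero>\<^bsub>K\<^esub>),
      add = (\<lambda>f g q. f q \<oplus>\<^bsub>K\<^esub> g q)\<rparr>"

text \<open>\<open>mterm K c a\<close> is \<open>c t\<^sup>a\<close>.\<close>

definition mterm :: "('k, 'y) ring_scheme \<Rightarrow> 'k \<Rightarrow> 'q \<Rightarrow> 'q \<Rightarrow> 'k" where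
  "mterm K c a = (\<lambda>q. if q = a then c else \<zero>\<^bsub>K\<^esub>)"

abbreviation tmono :: "('k, 'y) ring_scheme \<Rightarrow> 'q \<Rightarrow> 'q \<Rightarrow> 'k" where
  "tmono K a \<equiv> mterm K \<one>\<^bsub>K\<^esub> a"

definition binomial ::
    "('k, 'y) ring_scheme \<Rightarrow> ('q, 'x) monoid_scheme \<Rightarrow> 'q \<Rightarrow> 'k \<Rightarrow> 'q \<Rightarrow> 'q \<Rightarrow> 'k" where
  "binomial K M a c b = tmono K a \<ominus>\<^bsub>monoid_algebra K M\<^esub> mterm K c b"

text \<open>The coefficient may vanish, so monomials are binomials.\<close>

definition binomials ::
    "('k, 'y) ring_scheme \<Rightarrow> ('q, 'x) monoid_scheme \<Rightarrow> ('q \<Rightarrow> 'k) set" where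
  "binomials K M =
     {binomial K M a c b |a c b. a \<in> carrier M \<and> b \<in> carrier M \<and> c \<in> carrier K}"

definition binomial_ideal ::
    "('k, 'y) ring_scheme \<Rightarrow> ('q, 'x) monoid_scheme \<Rightarrow> ('q \<Rightarrow> 'k) set \<Rightarrow> bool" where
  "binomial_ideal K M I \<longleftrightarrow> (\<exists>S \<subseteq> binomials K M. I = Idl\<^bsub>monoid_algebra K M\<^esub> S)"

definition ideal_cong ::
    "('k, 'y) ring_scheme \<Rightarrow> ('q, 'x) monoid_scheme \<Rightarrow> ('q \<Rightarrow> 'k) set \<Rightarrow> ('q \<times> 'q) set" where
  "ideal_cong K M I =
     {(a, b). a \<in> carrier M \<and> b \<in> carrier M \<and>
        (\<exists>c\<in>carrier K - {\<zero>\<^bsub>K\<^esub>}. binomial K M a c b \<in> I)}"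

definition mesoprimary_ideal ::
    "('k, 'y) ring_scheme \<Rightarrow> ('q, 'x) monoid_scheme \<Rightarrow> 'q set \<Rightarrow> ('q \<Rightarrow> 'k) set \<Rightarrow> bool" where
  "mesoprimary_ideal K M P I \<longleftrightarrow>
     mesoprimary_cong M P (ideal_cong K M I) \<and>
     binomial_ideal K M I \<and> I \<noteq> carrier (monoid_algebra K M) \<and>
     (\<forall>J. binomial_ideal K M J \<and> J \<noteq> carrier (monoid_algebra K M) \<and>
          ideal_cong K M J = ideal_cong K M I \<and> I \<subseteq> J \<longrightarrow> J = I)"


section \<open>Localized ideals\<close>

abbreviation loc_algebra ::
    "('k, 'y) ring_scheme \<Rightarrow> ('q, 'x) monoid_scheme \<Rightarrow> 'q set \<Rightarrow> (('q \<times> 'q) set \<Rightarrow> 'k) ring" where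
  "loc_algebra K M P \<equiv> monoid_algebra K (loc_monoid M P)"

text \<open>The ring homomorphism \<open>K[Q] \<rightarrow> K[Q\<^sub>P]\<close>; it need not be injective.\<close>

definition loc_hom ::
    "('k, 'y) ring_scheme \<Rightarrow> ('q, 'x) monoid_scheme \<Rightarrow> 'q set \<Rightarrow>
     ('q \<Rightarrow> 'k) \<Rightarrow> ('q \<times> 'q) set \<Rightarrow> 'k" where
  "loc_hom K M P f = (\<lambda>x. finsum K f {q. f q \<noteq> \<zero>\<^bsub>K\<^esub> \<and> to_loc M P q = x})"

definition loc_ideal ::
    "('k, 'y) ring_scheme \<Rightarrow> ('q, 'x) monoid_scheme \<Rightarrow> 'q set \<Rightarrow>
     ('q \<Rightarrow> 'k) set \<Rightarrow> (('q \<times> 'q) set \<Rightarrow> 'k) set" where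
  "loc_ideal K M P I = Idl\<^bsub>loc_algebra K M P\<^esub> (loc_hom K M P ` I)"

definition loc_preimage ::
    "('k, 'y) ring_scheme \<Rightarrow> ('q, 'x) monoid_scheme \<Rightarrow> 'q set \<Rightarrow>
     (('q \<times> 'q) set \<Rightarrow> 'k) set \<Rightarrow> ('q \<Rightarrow> 'k) set" where
  "loc_preimage K M P J = {f \<in> carrier (monoid_algebra K M). loc_hom K M P f \<in> J}"

definition max_monomial_ideal ::
    "('k, 'y) ring_scheme \<Rightarrow> ('q, 'x) monoid_scheme \<Rightarrow> 'q set \<Rightarrow> ('q \<Rightarrow> 'k) set" where
  "max_monomial_ideal K M P = Idl\<^bsub>monoid_algebra K M\<^esub> (tmono K ` P)"

definition cogenerator ::
    "('k, 'y) ring_scheme \<Rightarrow> ('q, 'x) monoid_scheme \<Rightarrow> 'q set \<Rightarrow> ('q \<Rightarrow> 'k) set \<Rightarrow> 'q \<Rightarrow> bool"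
  where
  "cogenerator K M P I w \<longleftrightarrow> w \<in> carrier M \<and>
     tmono K (to_loc M P w) \<notin> loc_ideal K M P I \<and>
     (\<forall>p\<in>P. tmono K (to_loc M P (w \<otimes>\<^bsub>M\<^esub> p)) \<in> loc_ideal K M P I)"


section \<open>Mesoprimes\<close>

definition stab ::
    "('k, 'y) ring_scheme \<Rightarrow> ('q, 'x) monoid_scheme \<Rightarrow> 'q set \<Rightarrow>
     ('q \<Rightarrow> 'k) set \<Rightarrow> 'q \<Rightarrow> ('q \<times> 'q) set set" where
  "stab K M P I q =
     {u \<in> Units (loc_monoid M P).
        (u \<otimes>\<^bsub>loc_monoid M P\<^esub> to_loc M P q, to_loc M P q) \<in> loc_cong M P (ideal_cong K M I)}"

text \<open>
  The character is only meaningful on \<open>stab K M P I q\<close> when \<open>t\<^sup>q\<close> is not in \<open>I\<^sub>P\<close>; its value is then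
  the unique scalar \<open>c\<close> such that \<open>(t\<^sup>u - c) t\<^sup>q\<close> lies in \<open>I\<^sub>P\<close>.
\<close>

definition stab_char ::
    "('k, 'y) ring_scheme \<Rightarrow> ('q, 'x) monoid_scheme \<Rightarrow> 'q set \<Rightarrow>
     ('q \<Rightarrow> 'k) set \<Rightarrow> 'q \<Rightarrow> ('q \<times> 'q) set \<Rightarrow> 'k" where
  "stab_char K M P I q u =
     (THE c. c \<in> carrier K - {\<zero>\<^bsub>K\<^esub>} \<and>
        binomial K (loc_monoid M P) u c \<one>\<^bsub>loc_monoid M P\<^esub>
          \<otimes>\<^bsub>loc_algebra K M P\<^esub> tmono K (to_loc M P q) \<in> loc_ideal K M P I)"

definition char_ideal ::
    "('k, 'y) ring_scheme \<Rightarrow> ('q, 'x) monoid_scheme \<Rightarrow> 'q set \<Rightarrow>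
     ('q \<Rightarrow> 'k) set \<Rightarrow> 'q \<Rightarrow> (('q \<times> 'q) set \<Rightarrow> 'k) set" where
  "char_ideal K M P I q =
     Idl\<^bsub>loc_algebra K M P\<^esub>
       {binomial K (loc_monoid M P) u
          (stab_char K M P I q (u \<otimes>\<^bsub>loc_monoid M P\<^esub> inv\<^bsub>loc_monoid M P\<^esub> v)) v |u v.
        u \<in> Units (loc_monoid M P) \<and> v \<in> Units (loc_monoid M P) \<and>
        u \<otimes>\<^bsub>loc_monoid M P\<^esub> inv\<^bsub>loc_monoid M P\<^esub> v \<in> stab K M P I q}"

definition mesoprime ::
    "('k, 'y) ring_scheme \<Rightarrow> ('q, 'x) monoid_scheme \<Rightarrow> 'q set \<Rightarrow>
     ('q \<Rightarrow> 'k) set \<Rightarrow> 'q \<Rightarrow> ('q \<Rightarrow> 'k) set" where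
  "mesoprime K M P I q =
     loc_preimage K M P
       (char_ideal K M P I q <+>\<^bsub>loc_algebra K M P\<^esub>
        loc_ideal K M P (max_monomial_ideal K M P))"


section \<open>Essential witnesses\<close>

text \<open>
  \<open>K[Q\<^sub>P]/I\<^sub>P\<close> is graded by \<open>Q\<^sub>P/\<sim>\<close>, whose elements are subsets \<open>d\<close> of \<open>Q\<^sub>P\<close>. The component in
  degree \<open>d\<close> of the residue class of \<open>f\<close> is the residue class of the restriction of \<open>f\<close> to \<open>d\<close>. The
  nonzero monomials of a residue class are its nonzero components, recorded by their degrees.
\<close>

definition nonzero_degrees ::
    "('k, 'y) ring_scheme \<Rightarrow> ('q, 'x) monoid_scheme \<Rightarrow> 'q set \<Rightarrow> ('q \<Rightarrow> 'k) set \<Rightarrow>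
     (('q \<times> 'q) set \<Rightarrow> 'k) \<Rightarrow> ('q \<times> 'q) set set set" where
  "nonzero_degrees K M P I f =
     {d \<in> carrier (loc_quot M P (ideal_cong K M I)).
        (\<lambda>x. if x \<in> d then f x else \<zero>\<^bsub>K\<^esub>) \<notin> loc_ideal K M P I}"

definition essential_witness ::
    "('k, 'y) ring_scheme \<Rightarrow> ('q, 'x) monoid_scheme \<Rightarrow> 'q set \<Rightarrow> ('q \<Rightarrow> 'k) set \<Rightarrow> 'q \<Rightarrow> bool"
  where
  "essential_witness K M P I w \<longleftrightarrow> w \<in> carrier M \<and>
     (key_witness M P (ideal_cong K M I) w \<or>
      (\<exists>f\<in>carrier (loc_algebra K M P).
         (\<forall>g\<in>max_monomial_ideal K M P.
            loc_hom K M P g \<otimes>\<^bsub>loc_algebra K M P\<^esub> f \<in> loc_ideal K M P I) \<and>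
         loc_bar M P (ideal_cong K M I) w \<in> nonzero_degrees K M P I f \<and>
         (\<forall>d\<in>nonzero_degrees K M P I f.
            \<not> green_less (loc_quot M P (ideal_cong K M I)) d
                (loc_bar M P (ideal_cong K M I) w))))"


section \<open>Coprincipal and binoccular components\<close>

definition cogen_monomial_ideal ::
    "('k, 'y) ring_scheme \<Rightarrow> ('q, 'x) monoid_scheme \<Rightarrow> 'q set \<Rightarrow>
     ('q \<Rightarrow> 'k) set \<Rightarrow> 'q \<Rightarrow> (('q \<times> 'q) set \<Rightarrow> 'k) set" where
  "cogen_monomial_ideal K M P I w =
     Idl\<^bsub>loc_algebra K M P\<^esub>
       {tmono K (to_loc M P u) |u. u \<in> carrier M \<and>
          loc_bar M P (ideal_cong K M I) w
            \<notin> ideal_of (loc_quot M P (ideal_cong K M I)) (loc_bar M P (ideal_cong K M I) u)}"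

definition coprincipal_component ::
    "('k, 'y) ring_scheme \<Rightarrow> ('q, 'x) monoid_scheme \<Rightarrow> 'q set \<Rightarrow>
     ('q \<Rightarrow> 'k) set \<Rightarrow> 'q \<Rightarrow> ('q \<Rightarrow> 'k) set" where
  "coprincipal_component K M P I w =
     loc_preimage K M P
       (loc_ideal K M P I <+>\<^bsub>loc_algebra K M P\<^esub> char_ideal K M P I w
          <+>\<^bsub>loc_algebra K M P\<^esub> cogen_monomial_ideal K M P I w)"

definition binoccular_collapse ::
    "('k, 'y) ring_scheme \<Rightarrow> ('q, 'x) monoid_scheme \<Rightarrow> 'q set \<Rightarrow> 'q \<Rightarrow>
     ('q \<Rightarrow> 'k) set \<Rightarrow> ('q \<Rightarrow> 'k) set" where
  "binoccular_collapse K M P w J =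
     J <+>\<^bsub>monoid_algebra K M\<^esub>
     Idl\<^bsub>monoid_algebra K M\<^esub>
       {binomial K M a c b |a c b.
          a \<in> carrier M \<and> b \<in> carrier M \<and> c \<in> carrier K \<and>
          loc_bar M P (ideal_cong K M J) a
            \<notin> ideal_of (loc_quot M P (ideal_cong K M J)) (loc_bar M P (ideal_cong K M J) w) \<and>
          loc_bar M P (ideal_cong K M J) b
            \<notin> ideal_of (loc_quot M P (ideal_cong K M J)) (loc_bar M P (ideal_cong K M J) w) \<and>
          (\<forall>p\<in>P. tmono K p \<otimes>\<^bsub>monoid_algebra K M\<^esub> binomial K M a c b \<in> J)}"

definition binoccular_component ::
    "('k, 'y) ring_scheme \<Rightarrow> ('q, 'x) monoid_scheme \<Rightarrow> 'q set \<Rightarrow>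
     ('q \<Rightarrow> 'k) set \<Rightarrow> 'q \<Rightarrow> ('q \<Rightarrow> 'k) set" where
  "binoccular_component K M P I w =
     (\<Union>i::nat. (binoccular_collapse K M P w ^^ i) (coprincipal_component K M P I w))"

end

(*
  Fix P and an essential witness w. Let Q_P be the localization, I_P the localized ideal, and C the
  class of w in Q_P modulo the congruence of I_P. The proof rests on the ideal

    W = {f in K[Q_P]. for every x in Q_P, the part of t^x f supported on C lies in I_P},

  a Macaulay dual of the degree of w. For both kinds of essential witnesses, t^w is not in I_P and
  w + p does not divide w for p in P. These two properties imply that the binoccular component is
  the binomial ideal whose binomials are exactly those of K[Q] that localization maps into W: the
  generators of a collapse are mapped into W because their translates by units miss C, and a
  binomial a - c b mapped into W is reached after finitely many collapses, by induction along the
  steps from a to a + p that still divide w (by Dickson's lemma no chain of such steps is infinite).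
  As W agrees with I_P in the degrees w + units, the component is mesoprimary and has the
  mesoprimes of I at its cogenerators.

  If f is not in I, let P be maximal among the colon ideals {q. t^(q+s) f in I} with t^s f not in I.
  It is a monoid prime, P annihilates the nonzero image of t^s f in K[Q_P]/I_P, and f lies outside
  the component of every minimal degree of t^s f.
*)
theory Submission
  imports Defs "HOL.Topological_Spaces"
begin

section \<open>Monoid algebras\<close>

text \<open>The ideal W need not be generated by binomials, so the component can be smaller than the
  preimage of W, and the two are compared on binomials only. That is enough: congruences,
  stabilizers, characters and nilpotency ask about binomials and monomials, while the intersection
  formula needs only that the component maps into W and that the part on C of an element of W lies
  in I_P. Parts on a class make sense because I_P is binomial: K[Q_P]/I_P is graded by the classes,
  and each degree has dimension at most one. Mesoprimariness asks for a binomial ideal, so preimages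
  under the localization map, which need not be injective, have to be shown binomial as well; the
  same argument for the zero ideal describes the kernel of that map. A collapse refers to the
  congruence of the ideal reached so far, not to that of I_P. W is the fixed upper bound through
  which divisibility modulo a later congruence is brought back to C.\<close>

locale monoid_alg = K: field K + M: comm_monoid M
  for K :: "('k, 'y) ring_scheme" and M :: "('q, 'x) monoid_scheme" (structure)
begin

abbreviation A where "A \<equiv> monoid_algebra K M"
abbreviation times_A (infixl "\<otimes>\<^sub>A" 70) where "f \<otimes>\<^sub>A g \<equiv> f \<otimes>\<^bsub>A\<^esub> g"
abbreviation plus_A (infixl "\<oplus>\<^sub>A" 65) where "f \<oplus>\<^sub>A g \<equiv> f \<oplus>\<^bsub>A\<^esub> g"
abbreviation zero_A ("\<zero>\<^sub>A") where "\<zero>\<^sub>A \<equiv> \<zero>\<^bsub>A\<^esub>"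
abbreviation times_K (infixl "\<otimes>\<^sub>K" 70) where "c \<otimes>\<^sub>K d \<equiv> c \<otimes>\<^bsub>K\<^esub> d"
abbreviation plus_K (infixl "\<oplus>\<^sub>K" 65) where "c \<oplus>\<^sub>K d \<equiv> c \<oplus>\<^bsub>K\<^esub> d"
abbreviation zero_K ("\<zero>\<^sub>K") where "\<zero>\<^sub>K \<equiv> \<zero>\<^bsub>K\<^esub>"
abbreviation one_K ("\<one>\<^sub>K") where "\<one>\<^sub>K \<equiv> \<one>\<^bsub>K\<^esub>"
abbreviation uminus_K ("\<ominus>\<^sub>K _" [81] 80) where "\<ominus>\<^sub>K c \<equiv> \<ominus>\<^bsub>K\<^esub> c"
abbreviation inv_K ("inv\<^sub>K _" [81] 80) where "inv\<^sub>K c \<equiv> inv\<^bsub>K\<^esub> c"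

definition supp :: "('q \<Rightarrow> 'k) \<Rightarrow> 'q set" where "supp f = {q. f q \<noteq> \<zero>\<^sub>K}"

lemma carrier_A:
  "f \<in> carrier A \<longleftrightarrow> (\<forall>q. f q \<in> carrier K) \<and> (\<forall>q. q \<notin> carrier M \<longrightarrow> f q = \<zero>\<^sub>K) \<and> finite (supp f)"
  by (simp add: monoid_algebra_def supp_def)

lemma A_coeff: "f \<in> carrier A \<Longrightarrow> f q \<in> carrier K"
  by (simp add: carrier_A)

lemma supp_finite: "f \<in> carrier A \<Longrightarrow> finite (supp f)"
  by (simp add: carrier_A)

lemma supp_carrier: "f \<in> carrier A \<Longrightarrow> supp f \<subseteq> carrier M"
  by (auto simp add: carrier_A supp_def)

lemma A_add: "f \<oplus>\<^sub>A g = (\<lambda>q. f q \<oplus>\<^sub>K g q)"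
  by (simp add: monoid_algebra_def)

lemma A_zero: "\<zero>\<^sub>A = (\<lambda>q. \<zero>\<^sub>K)"
  by (simp add: monoid_algebra_def)

lemma A_one: "\<one>\<^bsub>A\<^esub> = tmono K \<one>"
  by (simp add: monoid_algebra_def mterm_def)

lemma A_mult: "(f \<otimes>\<^sub>A g) q = finsum K (\<lambda>(a, b). f a \<otimes>\<^sub>K g b)
                {(a, b). a \<in> supp f \<and> b \<in> supp g \<and> a \<otimes> b = q}"
  by (simp add: monoid_algebra_def supp_def)

lemma A_abelian_group: "abelian_group A"
proof (rule abelian_groupI)
  fix f g assume f: "f \<in> carrier A" and g: "g \<in> carrier A"
  have "supp (f \<oplus>\<^sub>A g) \<subseteq> supp f \<union> supp g"
    by (auto simp: supp_def A_add)
  then have "finite (supp (f \<oplus>\<^sub>A g))"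
    using f g by (meson finite_UnI finite_subset supp_finite)
  then show "f \<oplus>\<^sub>A g \<in> carrier A"
    using f g by (auto simp: carrier_A A_add)
  show "f \<oplus>\<^sub>A g = g \<oplus>\<^sub>A f"
    using f g by (auto simp: A_add K.a_comm A_coeff)
next
  show "\<zero>\<^sub>A \<in> carrier A" by (simp add: carrier_A A_zero supp_def)
next
  fix f g h assume "f \<in> carrier A" "g \<in> carrier A" "h \<in> carrier A"
  then show "f \<oplus>\<^sub>A g \<oplus>\<^sub>A h = f \<oplus>\<^sub>A (g \<oplus>\<^sub>A h)"
    by (auto simp: A_add K.a_assoc A_coeff)
next
  fix f assume f: "f \<in> carrier A"
  show "\<zero>\<^sub>A \<oplus>\<^sub>A f = f" using f by (simp add: A_add A_zero A_coeff)
  have s: "supp (\<lambda>q. \<ominus>\<^bsub>K\<^esub> f q) \<subseteq> supp f"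
    using f by (auto simp: supp_def A_coeff)
  show "\<exists>g\<in>carrier A. g \<oplus>\<^sub>A f = \<zero>\<^sub>A"
  proof
    show "(\<lambda>q. \<ominus>\<^bsub>K\<^esub> f q) \<in> carrier A"
      using f s by (auto simp: carrier_A finite_subset)
    show "(\<lambda>q. \<ominus>\<^bsub>K\<^esub> f q) \<oplus>\<^sub>A f = \<zero>\<^sub>A"
      using f by (auto simp: A_add A_zero K.l_neg A_coeff)
  qed
qed

sublocale A: abelian_group A by (rule A_abelian_group)

lemma mterm_closed [simp, intro]: "c \<in> carrier K \<Longrightarrow> a \<in> carrier M \<Longrightarrow> mterm K c a \<in> carrier A"
  by (auto simp: carrier_A mterm_def supp_def)

lemma supp_mterm: "supp (mterm K c a) \<subseteq> {a}"
  by (auto simp: supp_def mterm_def)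

lemma A_neg: assumes f: "f \<in> carrier A" shows "\<ominus>\<^bsub>A\<^esub> f = (\<lambda>q. \<ominus>\<^bsub>K\<^esub> f q)"
proof
  fix q
  have "(\<ominus>\<^bsub>A\<^esub> f \<oplus>\<^sub>A f) q = \<zero>\<^sub>A q" using f by (simp add: A.l_neg)
  then have "(\<ominus>\<^bsub>A\<^esub> f) q \<oplus>\<^sub>K f q = \<zero>\<^sub>K" by (simp add: A_add A_zero)
  moreover have "(\<ominus>\<^bsub>A\<^esub> f) q \<in> carrier K" using f by (intro A_coeff A.a_inv_closed)
  ultimately show "(\<ominus>\<^bsub>A\<^esub> f) q = \<ominus>\<^bsub>K\<^esub> f q" using f by (metis A_coeff K.minus_equality)
qed

text \<open>Deleting one point of the support removes a single term, so induction on a finite set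
  containing the support applies. Bilinear identities are reduced to single terms by this
  rule.\<close>

lemma A_induct [consumes 1, case_names zero add]:
  assumes f: "f \<in> carrier A" and z: "Pr \<zero>\<^sub>A"
    and s: "\<And>c a f. c \<in> carrier K \<Longrightarrow> a \<in> carrier M \<Longrightarrow> f \<in> carrier A \<Longrightarrow> Pr f \<Longrightarrow> Pr (mterm K c a \<oplus>\<^sub>A f)"
  shows "Pr f"
proof -
  have "finite S \<Longrightarrow> (\<forall>f. f \<in> carrier A \<longrightarrow> supp f \<subseteq> S \<longrightarrow> Pr f)" for S
  proof (induction S rule: finite_induct)
    case empty
    have "f = \<zero>\<^sub>A" if "f \<in> carrier A" "supp f \<subseteq> {}" for f
      using that by (auto simp: A_zero supp_def)
    then show ?case using z by blast
  next
    case (insert a S)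
    show ?case
    proof (intro allI impI)
      fix f assume f: "f \<in> carrier A" and fs: "supp f \<subseteq> insert a S"
      show "Pr f"
      proof (cases "a \<in> supp f")
        case False
        then show ?thesis using f fs insert by blast
      next
        case True
        then have a: "a \<in> carrier M" using f supp_carrier by blast
        define g where "g = f(a := \<zero>\<^sub>K)"
        have gs: "supp g \<subseteq> S" using fs by (auto simp: g_def supp_def)
        then have g: "g \<in> carrier A"
          using f insert(1) by (auto simp: carrier_A g_def finite_subset)
        have "f = mterm K (f a) a \<oplus>\<^sub>A g"
          using f by (auto simp: A_add g_def mterm_def A_coeff)
        then show ?thesis using s[of "f a" a g] g gs insert f a by (auto simp: A_coeff)
      qed
    qed
  qed
  then show ?thesis using f supp_finite by blast
qed

text \<open>The index set of the convolution sum depends on \<open>f\<close>, \<open>g\<close> and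
  \<open>q\<close>. Over a common finite rectangle, with zero summands added, distributivity becomes
  additivity of a finite sum.\<close>

lemma A_mult_superset:
  assumes f: "f \<in> carrier A" and g: "g \<in> carrier A"
    and X: "finite X" "supp f \<subseteq> X" and Y: "finite Y" "supp g \<subseteq> Y"
  shows "(f \<otimes>\<^sub>A g) q =
    finsum K (\<lambda>p. if fst p \<otimes> snd p = q then f (fst p) \<otimes>\<^sub>K g (snd p) else \<zero>\<^sub>K) (X \<times> Y)"
proof -
  have z: "f a = \<zero>\<^sub>K" if "a \<notin> supp f" for a using that by (simp add: supp_def)
  have z': "g a = \<zero>\<^sub>K" if "a \<notin> supp g" for a using that by (simp add: supp_def)
  show ?thesis unfolding A_mult
  proof (rule K.add.finprod_mono_neutral_cong_left)
      fix i assume "i \<in> X \<times> Y - {(a, b). a \<in> supp f \<and> b \<in> supp g \<and> a \<otimes> b = q}"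
      then have "fst i \<notin> supp f \<or> snd i \<notin> supp g \<or> fst i \<otimes> snd i \<noteq> q" by auto
      then show "(if fst i \<otimes> snd i = q then f (fst i) \<otimes>\<^sub>K g (snd i) else \<zero>\<^sub>K) = \<zero>\<^sub>K"
        using z z' A_coeff[OF f] A_coeff[OF g] by auto
  qed (use A_coeff[OF f] A_coeff[OF g] X Y in auto)
qed

lemma A_mult_closed [simp, intro]:
  assumes f: "f \<in> carrier A" and g: "g \<in> carrier A"
  shows "f \<otimes>\<^sub>A g \<in> carrier A"
proof -
  have n: "q \<in> (\<lambda>(a, b). a \<otimes> b) ` (supp f \<times> supp g)" if "(f \<otimes>\<^sub>A g) q \<noteq> \<zero>\<^sub>K" for q
  proof (rule ccontr)
    assume "\<not> ?thesis"
    then have "{(a, b). a \<in> supp f \<and> b \<in> supp g \<and> a \<otimes> b = q} = {}" by force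
    then have "(f \<otimes>\<^sub>A g) q = \<zero>\<^sub>K" unfolding A_mult by (simp only: K.finsum_empty)
    then show False using that by simp
  qed
  have "supp (f \<otimes>\<^sub>A g) \<subseteq> (\<lambda>(a, b). a \<otimes> b) ` (supp f \<times> supp g)"
    using n by (auto simp: supp_def)
  then have 1: "finite (supp (f \<otimes>\<^sub>A g))"
    by (rule finite_subset) (simp add: f g supp_finite)
  have 2: "(f \<otimes>\<^sub>A g) q = \<zero>\<^sub>K" if "q \<notin> carrier M" for q
  proof (rule ccontr)
    assume "(f \<otimes>\<^sub>A g) q \<noteq> \<zero>\<^sub>K"
    then obtain a b where "a \<in> supp f" "b \<in> supp g" "q = a \<otimes> b" using n[of q] by auto
    then show False using that supp_carrier[OF f] supp_carrier[OF g] by (metis M.m_closed subsetD)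
  qed
  have 3: "(f \<otimes>\<^sub>A g) q \<in> carrier K" for q
    unfolding A_mult using A_coeff[OF f] A_coeff[OF g] by (auto intro!: K.finsum_closed)
  show ?thesis using 1 2 3 by (auto simp: carrier_A)
qed

lemma A_l_distr:
  assumes f: "f \<in> carrier A" and g: "g \<in> carrier A" and h: "h \<in> carrier A"
  shows "(f \<oplus>\<^sub>A g) \<otimes>\<^sub>A h = f \<otimes>\<^sub>A h \<oplus>\<^sub>A g \<otimes>\<^sub>A h"
proof
  fix q
  define X where "X = supp f \<union> supp g"
  define Y where "Y = supp h"
  have X: "finite X" "supp f \<subseteq> X" "supp g \<subseteq> X" "supp (f \<oplus>\<^sub>A g) \<subseteq> X"
    using f g by (auto simp: X_def supp_finite) (auto simp: A_add supp_def)
  have Y: "finite Y" "supp h \<subseteq> Y" using h by (auto simp: Y_def supp_finite)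
  have fg: "f \<oplus>\<^sub>A g \<in> carrier A" using f g by simp
  show "((f \<oplus>\<^sub>A g) \<otimes>\<^sub>A h) q = (f \<otimes>\<^sub>A h \<oplus>\<^sub>A g \<otimes>\<^sub>A h) q"
    unfolding A_add[of "f \<otimes>\<^sub>A h"]
      A_mult_superset[OF fg h X(1,4) Y] A_mult_superset[OF f h X(1,2) Y] A_mult_superset[OF g h X(1,3) Y]
    by (rule trans[OF K.finsum_cong' K.finsum_addf])
      (use A_coeff[OF f] A_coeff[OF g] A_coeff[OF h] in \<open>auto simp: A_add K.l_distr\<close>)
qed

lemma A_comm:
  assumes f: "f \<in> carrier A" and g: "g \<in> carrier A"
  shows "f \<otimes>\<^sub>A g = g \<otimes>\<^sub>A f"
proof
  fix q
  let ?S = "{(a, b). a \<in> supp f \<and> b \<in> supp g \<and> a \<otimes> b = q}"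
  have S: "{(a, b). a \<in> supp g \<and> b \<in> supp f \<and> a \<otimes> b = q} = prod.swap ` ?S"
  proof (rule Set.set_eqI, simp only: split_paired_all)
    fix a b
    have "a \<otimes> b = b \<otimes> a" if "a \<in> supp g" "b \<in> supp f"
      using that supp_carrier[OF f] supp_carrier[OF g] by (intro M.m_comm) auto
    then show "(a, b) \<in> {(a, b). a \<in> supp g \<and> b \<in> supp f \<and> a \<otimes> b = q} \<longleftrightarrow> (a, b) \<in> prod.swap ` ?S"
      by auto
  qed
  have "(g \<otimes>\<^sub>A f) q = finsum K (\<lambda>x. (\<lambda>(a, b). g a \<otimes>\<^sub>K f b) (prod.swap x)) ?S"
    unfolding A_mult S
    by (rule K.add.finprod_reindex) (use A_coeff[OF f] A_coeff[OF g] in \<open>auto simp: inj_on_def\<close>)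
  then show "(f \<otimes>\<^sub>A g) q = (g \<otimes>\<^sub>A f) q"
    unfolding A_mult using A_coeff[OF f] A_coeff[OF g]
    by (auto intro!: K.finsum_cong' simp: K.m_comm)
qed

lemma A_r_distr:
  assumes "f \<in> carrier A" "g \<in> carrier A" "h \<in> carrier A"
  shows "h \<otimes>\<^sub>A (f \<oplus>\<^sub>A g) = h \<otimes>\<^sub>A f \<oplus>\<^sub>A h \<otimes>\<^sub>A g"
  using assms A_l_distr[of f g h] by (simp add: A_comm[of h])

lemma mterm_mult:
  assumes c: "c \<in> carrier K" "d \<in> carrier K" and a: "a \<in> carrier M" "b \<in> carrier M"
  shows "mterm K c a \<otimes>\<^sub>A mterm K d b = mterm K (c \<otimes>\<^sub>K d) (a \<otimes> b)"
proof
  fix q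
  have "(mterm K c a \<otimes>\<^sub>A mterm K d b) q =
    finsum K (\<lambda>p. if fst p \<otimes> snd p = q then mterm K c a (fst p) \<otimes>\<^sub>K mterm K d b (snd p) else \<zero>\<^sub>K) ({a} \<times> {b})"
    by (rule A_mult_superset) (use assms supp_mterm in auto)
  also have "\<dots> = mterm K (c \<otimes>\<^sub>K d) (a \<otimes> b) q"
    using assms by (simp add: mterm_def)
  finally show "(mterm K c a \<otimes>\<^sub>A mterm K d b) q = mterm K (c \<otimes>\<^sub>K d) (a \<otimes> b) q" .
qed

lemma A_zero_mult: "f \<in> carrier A \<Longrightarrow> \<zero>\<^sub>A \<otimes>\<^sub>A f = \<zero>\<^sub>A"
  by (rule ext) (simp add: A_mult supp_def A_zero)

lemma A_mult_zero: "f \<in> carrier A \<Longrightarrow> f \<otimes>\<^sub>A \<zero>\<^sub>A = \<zero>\<^sub>A"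
  by (rule ext) (simp add: A_mult supp_def A_zero)

text \<open>Three nested inductions split the factors into terms, from the last factor to the first;
  for three terms the law is that of \<open>K\<close> and of the monoid.\<close>

lemma A_assoc:
  assumes f: "f \<in> carrier A" and g: "g \<in> carrier A" and h: "h \<in> carrier A"
  shows "f \<otimes>\<^sub>A g \<otimes>\<^sub>A h = f \<otimes>\<^sub>A (g \<otimes>\<^sub>A h)"
proof -
  have 1: "mterm K c a \<otimes>\<^sub>A mterm K d b \<otimes>\<^sub>A h = mterm K c a \<otimes>\<^sub>A (mterm K d b \<otimes>\<^sub>A h)"
    if "c \<in> carrier K" "a \<in> carrier M" "d \<in> carrier K" "b \<in> carrier M" for c a d b
    using h
    by (induction rule: A_induct)
      (use that in \<open>auto simp: A_mult_zero A_r_distr mterm_mult K.m_assoc M.m_assoc\<close>)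
  have 2: "mterm K c a \<otimes>\<^sub>A g \<otimes>\<^sub>A h = mterm K c a \<otimes>\<^sub>A (g \<otimes>\<^sub>A h)"
    if "c \<in> carrier K" "a \<in> carrier M" for c a
    using g
    by (induction rule: A_induct)
      (use that h 1 in \<open>auto simp: A_mult_zero A_zero_mult A_r_distr A_l_distr\<close>)
  show ?thesis
    using f
    by (induction rule: A_induct)
      (use g h 2 in \<open>auto simp: A_mult_zero A_zero_mult A_r_distr A_l_distr\<close>)
qed

lemma A_one_mult:
  assumes f: "f \<in> carrier A" shows "\<one>\<^bsub>A\<^esub> \<otimes>\<^sub>A f = f"
  using f
  by (induction rule: A_induct)
    (auto simp: A_mult_zero A_zero_mult A_r_distr A_one mterm_mult)

lemma A_cring: "cring A"
proof (rule cringI)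
  show "abelian_group A" by (rule A_abelian_group)
  show "comm_monoid A"
    by (rule comm_monoidI) (simp_all add: A_one_mult A_assoc, simp_all add: A_one, rule A_comm)
qed (simp add: A_l_distr)

end

sublocale monoid_alg \<subseteq> A: cring "monoid_algebra K M"
  by (rule A_cring)

section \<open>Binomial ideals\<close>

context monoid_alg
begin

text \<open>By linearity, absorption has to be checked for single terms only, and closure under
  negation is absorption of the constant -1.\<close>

lemma ideal_intro:
  assumes sub: "S \<subseteq> carrier A" and z: "\<zero>\<^sub>A \<in> S"
    and a: "\<And>f g. f \<in> S \<Longrightarrow> g \<in> S \<Longrightarrow> f \<oplus>\<^sub>A g \<in> S"
    and m: "\<And>c x f. c \<in> carrier K \<Longrightarrow> x \<in> carrier M \<Longrightarrow> f \<in> S \<Longrightarrow> mterm K c x \<otimes>\<^sub>A f \<in> S"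
  shows "ideal S A"
proof -
  have l: "g \<otimes>\<^sub>A f \<in> S" if "g \<in> carrier A" "f \<in> S" for f g
    using that(1)
  proof (induction rule: A_induct)
    case zero then show ?case using that z sub A.l_null by auto
  next
    case (add c x g)
    have "f \<in> carrier A" using sub that by auto
    then show ?case using add a m[OF _ _ that(2)] by (simp add: A_l_distr)
  qed
  have n: "\<ominus>\<^bsub>A\<^esub> f \<in> S" if "f \<in> S" for f
  proof -
    have "f \<in> carrier A" using that sub by auto
    then have "(\<ominus>\<^bsub>A\<^esub> \<one>\<^bsub>A\<^esub>) \<otimes>\<^sub>A f = \<ominus>\<^bsub>A\<^esub> f" by (simp add: A.l_minus)
    then show ?thesis using l[OF _ that, of "\<ominus>\<^bsub>A\<^esub> \<one>\<^bsub>A\<^esub>"] by simp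
  qed
  have "subgroup S (add_monoid A)"
    by (rule A.add.subgroupI) (use sub z a n in \<open>auto simp: a_inv_def\<close>)
  moreover have "f \<otimes>\<^sub>A g \<in> S" if "g \<in> carrier A" "f \<in> S" for f g
    using l[OF that] A_comm[of f g] that sub by auto
  ultimately show ?thesis
    using l by (intro idealI) (auto simp: A.ring_axioms)
qed

lemma ideal_facts:
  assumes "ideal J A"
  shows "J \<subseteq> carrier A" "\<zero>\<^sub>A \<in> J" "\<And>f g. f \<in> J \<Longrightarrow> g \<in> J \<Longrightarrow> f \<oplus>\<^sub>A g \<in> J"
    "\<And>f. f \<in> J \<Longrightarrow> \<ominus>\<^bsub>A\<^esub> f \<in> J"
    "\<And>f g. f \<in> J \<Longrightarrow> g \<in> J \<Longrightarrow> f \<ominus>\<^bsub>A\<^esub> g \<in> J"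
    "\<And>f g. f \<in> J \<Longrightarrow> g \<in> carrier A \<Longrightarrow> g \<otimes>\<^sub>A f \<in> J"
proof -
  interpret J: ideal J A by fact
  show "J \<subseteq> carrier A" by (rule J.a_subset)
  show "\<zero>\<^sub>A \<in> J" "\<And>f g. f \<in> J \<Longrightarrow> g \<in> J \<Longrightarrow> f \<oplus>\<^sub>A g \<in> J"
    "\<And>f. f \<in> J \<Longrightarrow> \<ominus>\<^bsub>A\<^esub> f \<in> J"
    "\<And>f g. f \<in> J \<Longrightarrow> g \<in> carrier A \<Longrightarrow> g \<otimes>\<^sub>A f \<in> J"
    by (auto simp: J.I_l_closed)
  then show "\<And>f g. f \<in> J \<Longrightarrow> g \<in> J \<Longrightarrow> f \<ominus>\<^bsub>A\<^esub> g \<in> J"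
    by (auto simp: a_minus_def)
qed

lemma ideal_cancel:
  assumes J: "ideal J A" and f: "f \<in> carrier A" "f \<oplus>\<^sub>A g \<in> J" and g: "g \<in> J"
  shows "f \<in> J"
proof -
  have gA: "g \<in> carrier A" using ideal_facts[OF J] g by auto
  have "(f \<oplus>\<^sub>A g) \<ominus>\<^bsub>A\<^esub> g = f" using f gA by (simp add: a_minus_def A.a_assoc A.r_neg)
  then show ?thesis using ideal_facts(5)[OF J f(2) g] by simp
qed

section \<open>Truncation to a set of exponents\<close>

definition res :: "'q set \<Rightarrow> ('q \<Rightarrow> 'k) \<Rightarrow> 'q \<Rightarrow> 'k" where
  "res E f = (\<lambda>x. if x \<in> E then f x else \<zero>\<^sub>K)"

lemma supp_res: "supp (res E f) \<subseteq> supp f \<inter> E"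
  by (auto simp: supp_def res_def)

lemma res_closed [simp, intro]: assumes f: "f \<in> carrier A" shows "res E f \<in> carrier A"
proof -
  have "finite (supp (res E f))" using supp_res[of E f] supp_finite[OF f] by (meson finite_subset le_infE)
  then show ?thesis using f by (simp add: carrier_A res_def)
qed

lemma res_add: "res E (f \<oplus>\<^sub>A g) = res E f \<oplus>\<^sub>A res E g"
  by (auto simp: res_def A_add)

lemma res_zero [simp]: "res E \<zero>\<^sub>A = \<zero>\<^sub>A"
  by (auto simp: res_def A_zero)

lemma res_mterm: "res E (mterm K c a) = (if a \<in> E then mterm K c a else \<zero>\<^sub>A)"
  by (auto simp: res_def mterm_def A_zero)

lemma res_eq_self: "supp f \<subseteq> E \<Longrightarrow> res E f = f"
  by (force simp: res_def supp_def)

text \<open>Truncating after a shift by \<open>x\<close> is truncating to the preimage of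
  \<open>E\<close> before it. The shift need not be injective, so the preimage of a class may
  consist of several classes.\<close>

lemma res_mult_mterm:
  assumes "c \<in> carrier K" "x \<in> carrier M" and f: "f \<in> carrier A"
  shows "res E (mterm K c x \<otimes>\<^sub>A f) = mterm K c x \<otimes>\<^sub>A res {y. x \<otimes> y \<in> E} f"
  using f
proof (induction rule: A_induct)
  case zero
  then show ?case using assms by (simp add: A_mult_zero)
next
  case (add d y f)
  then show ?case using assms
    by (auto simp: A_r_distr res_add mterm_mult res_mterm A_mult_zero)
qed

section \<open>Two-term elements and ideals generated by binomials\<close>

lemma mterm_add: "c \<in> carrier K \<Longrightarrow> d \<in> carrier K \<Longrightarrow> mterm K c a \<oplus>\<^sub>A mterm K d a = mterm K (c \<oplus>\<^sub>K d) a"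
  by (auto simp: A_add mterm_def)

lemma mterm_zero [simp]: "mterm K \<zero>\<^sub>K a = \<zero>\<^sub>A"
  by (auto simp: A_zero mterm_def)

lemma mterm_neg: "c \<in> carrier K \<Longrightarrow> a \<in> carrier M \<Longrightarrow> \<ominus>\<^bsub>A\<^esub> mterm K c a = mterm K (\<ominus>\<^sub>K c) a"
  by (subst A_neg[OF mterm_closed]) (auto simp: mterm_def)

lemma binomial_eq:
  assumes "c \<in> carrier K" "a \<in> carrier M" "b \<in> carrier M"
  shows "binomial K M a c b = mterm K \<one>\<^sub>K a \<oplus>\<^sub>A mterm K (\<ominus>\<^sub>K c) b"
  using assms by (simp add: binomial_def a_minus_def mterm_neg)

lemma binomial_closed [simp, intro]:
  assumes "c \<in> carrier K" "a \<in> carrier M" "b \<in> carrier M"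
  shows "binomial K M a c b \<in> carrier A"
  using assms by (simp add: binomial_eq)

lemma mterm_mult_two:
  assumes "c \<in> carrier K" "a \<in> carrier M" "d \<in> carrier K" "b \<in> carrier M" "e \<in> carrier K" "x \<in> carrier M"
  shows "mterm K e x \<otimes>\<^sub>A (mterm K c a \<oplus>\<^sub>A mterm K d b) =
    mterm K (e \<otimes>\<^sub>K c) (x \<otimes> a) \<oplus>\<^sub>A mterm K (e \<otimes>\<^sub>K d) (x \<otimes> b)"
  using assms by (simp add: A_r_distr mterm_mult)

lemma mterm_mult_binomial:
  assumes "c \<in> carrier K" "a \<in> carrier M" "b \<in> carrier M" "e \<in> carrier K" "x \<in> carrier M"
  shows "mterm K e x \<otimes>\<^sub>A binomial K M a c b =
    mterm K e (x \<otimes> a) \<oplus>\<^sub>A mterm K (\<ominus>\<^sub>K (e \<otimes>\<^sub>K c)) (x \<otimes> b)"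
  using assms by (simp add: binomial_eq A_r_distr mterm_mult K.r_minus)

lemma tmono_mult_binomial:
  assumes "c \<in> carrier K" "a \<in> carrier M" "b \<in> carrier M" "x \<in> carrier M"
  shows "tmono K x \<otimes>\<^sub>A binomial K M a c b = binomial K M (x \<otimes> a) c (x \<otimes> b)"
  using assms by (simp add: A_r_distr mterm_mult binomial_eq)

lemma K_inv: "c \<in> carrier K \<Longrightarrow> c \<noteq> \<zero>\<^sub>K \<Longrightarrow> inv\<^sub>K c \<in> carrier K \<and> inv\<^sub>K c \<noteq> \<zero>\<^sub>K \<and> inv\<^sub>K c \<otimes>\<^sub>K c = \<one>\<^sub>K \<and> c \<otimes>\<^sub>K inv\<^sub>K c = \<one>\<^sub>K"
  using K.field_Units by (metis DiffI K.Units_inv_Units K.Units_l_inv K.Units_r_inv DiffE insertI1 singletonD)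

text \<open>Describes an ideal generated by binomials without multipliers: multiplying a two-term
  element of the ideal \<open>J\<close> by a term gives another one, so plain sums suffice. Both
  coefficients are free, which covers scalar multiples and monomials by the same clause.\<close>

inductive_set bspan :: "('q \<Rightarrow> 'k) set \<Rightarrow> ('q \<Rightarrow> 'k) set" for J where
  zero: "\<zero>\<^sub>A \<in> bspan J"
| add: "\<lbrakk>a \<in> carrier M; b \<in> carrier M; c \<in> carrier K; d \<in> carrier K;
    mterm K c a \<oplus>\<^sub>A mterm K d b \<in> J; f \<in> bspan J\<rbrakk>
    \<Longrightarrow> (mterm K c a \<oplus>\<^sub>A mterm K d b) \<oplus>\<^sub>A f \<in> bspan J"

lemma bspan_closed: "f \<in> bspan J \<Longrightarrow> f \<in> carrier A"
  by (induction rule: bspan.induct) auto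

lemma bspan_add: assumes "f \<in> bspan J" and g: "g \<in> bspan J" shows "f \<oplus>\<^sub>A g \<in> bspan J"
  using assms(1)
proof induction
  case zero then show ?case using g bspan_closed[OF g] by simp
next
  case (add a b c d f)
  then show ?case using bspan_closed[OF add(6)] bspan_closed[OF g]
    by (simp add: A.a_assoc[of "mterm K c a \<oplus>\<^sub>A mterm K d b" f g] bspan.add)
qed

lemma bspan_two:
  assumes "a \<in> carrier M" "b \<in> carrier M" "c \<in> carrier K" "d \<in> carrier K"
    "mterm K c a \<oplus>\<^sub>A mterm K d b \<in> J"
  shows "mterm K c a \<oplus>\<^sub>A mterm K d b \<in> bspan J"
  using bspan.add[OF assms bspan.zero] assms by simp

lemma bspan_binomial:
  assumes "a \<in> carrier M" "b \<in> carrier M" "c \<in> carrier K" "binomial K M a c b \<in> J"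
  shows "binomial K M a c b \<in> bspan J"
  using assms bspan_two[of a b "\<one>\<^sub>K" "\<ominus>\<^bsub>K\<^esub> c" J] by (simp add: binomial_eq)

lemma bspan_ideal: assumes J: "ideal J A" shows "ideal (bspan J) A"
proof (rule ideal_intro)
  show "bspan J \<subseteq> carrier A" using bspan_closed by auto
  show "\<zero>\<^sub>A \<in> bspan J" by (rule bspan.zero)
  show "f \<oplus>\<^sub>A g \<in> bspan J" if "f \<in> bspan J" "g \<in> bspan J" for f g using bspan_add that .
  fix e x f assume e: "e \<in> carrier K" and x: "x \<in> carrier M" and f: "f \<in> bspan J"
  show "mterm K e x \<otimes>\<^sub>A f \<in> bspan J"
    using f
  proof induction
    case zero then show ?case using e x by (simp add: A_mult_zero bspan.zero)
  next
    case (add a b c d f)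
    have "mterm K e x \<otimes>\<^sub>A (mterm K c a \<oplus>\<^sub>A mterm K d b) \<in> J"
      using ideal_facts(6)[OF J add(5)] e x by simp
    then show ?case using add e x bspan_closed[OF add(6)]
      by (subst A_r_distr) (auto simp: mterm_mult_two intro: bspan.add)
  qed
qed

lemma bspan_mono: "J \<subseteq> J' \<Longrightarrow> bspan J \<subseteq> bspan J'"
proof
  fix f assume "f \<in> bspan J" and "J \<subseteq> J'"
  then show "f \<in> bspan J'" by induction (auto intro: bspan.intros)
qed

definition bin :: "('q \<Rightarrow> 'k) set \<Rightarrow> bool" where
  "bin J \<longleftrightarrow> ideal J A \<and> J \<subseteq> bspan J"

lemma binI: "ideal J A \<Longrightarrow> J \<subseteq> bspan J \<Longrightarrow> bin J" by (simp add: bin_def)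
lemma bin_ideal: "bin J \<Longrightarrow> ideal J A" by (simp add: bin_def)

lemma binomials_sub: "binomials K M \<subseteq> carrier A"
  by (auto simp: binomials_def)

text \<open>Division by \<open>c\<close> normalises a two-term element to a binomial, whose
  coefficient \<open>e\<close> is -d/c.\<close>

lemma two_term_cases:
  assumes J: "ideal J A" and c: "c \<in> carrier K" "d \<in> carrier K" and a: "a \<in> carrier M" "b \<in> carrier M"
    and t: "mterm K c a \<oplus>\<^sub>A mterm K d b \<in> J" and nz: "c \<noteq> \<zero>\<^sub>K"
  defines "e \<equiv> \<ominus>\<^bsub>K\<^esub> (inv\<^sub>K c \<otimes>\<^sub>K d)"
  shows "e \<in> carrier K" "binomial K M a e b \<in> J" "d \<noteq> \<zero>\<^sub>K \<Longrightarrow> e \<noteq> \<zero>\<^sub>K"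
    "mterm K c a \<oplus>\<^sub>A mterm K d b = mterm K c \<one> \<otimes>\<^sub>A binomial K M a e b"
proof -
  note i = K_inv[OF c(1) nz]
  show e: "e \<in> carrier K" using i c by (simp add: e_def)
  have "mterm K (inv\<^sub>K c) \<one> \<otimes>\<^sub>A (mterm K c a \<oplus>\<^sub>A mterm K d b) \<in> J"
    using ideal_facts(6)[OF J t] i by simp
  then show "binomial K M a e b \<in> J"
    using i c a e by (simp add: mterm_mult_two binomial_eq) (simp add: e_def)
  show "e \<noteq> \<zero>\<^sub>K" if "d \<noteq> \<zero>\<^sub>K"
    using i c that unfolding e_def by (metis K.add.inv_eq_1_iff K.integral K.m_closed)
  have "c \<otimes>\<^sub>K (inv\<^sub>K c \<otimes>\<^sub>K d) = d" using i c by (metis K.l_one K.m_assoc)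
  then show "mterm K c a \<oplus>\<^sub>A mterm K d b = mterm K c \<one> \<otimes>\<^sub>A binomial K M a e b"
    using i c a e by (simp add: mterm_mult_binomial) (simp add: e_def K.r_minus)
qed

lemma mono_iff_binomial: "a \<in> carrier M \<Longrightarrow> b \<in> carrier M \<Longrightarrow> binomial K M a \<zero>\<^sub>K b = tmono K a"
  by (simp add: binomial_eq)

lemma mterm_in_ideal:
  assumes J: "ideal J A" and c: "c \<in> carrier K" "c \<noteq> \<zero>\<^sub>K" and a: "a \<in> carrier M"
    and t: "mterm K c a \<in> J"
  shows "tmono K a \<in> J"
proof -
  have "mterm K (inv\<^sub>K c) \<one> \<otimes>\<^sub>A mterm K c a \<in> J"
    by (rule ideal_facts(6)[OF J t]) (use K_inv[OF c] in blast)
  moreover have "mterm K (inv\<^sub>K c) \<one> \<otimes>\<^sub>A mterm K c a = tmono K a"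
    using K_inv[OF c] a c(1) by (simp add: mterm_mult)
  ultimately show ?thesis by simp
qed

text \<open>If binomials generate \<open>J\<close>, they lie in the ideal \<open>bspan J\<close>,
  which therefore contains \<open>J\<close>. Conversely the set of all binomials in \<open>J\<close>
  serves as generating set; a two-term element is a scalar multiple of a binomial after possibly
  exchanging its terms.\<close>

lemma bin_iff: "binomial_ideal K M J \<longleftrightarrow> bin J"
proof
  assume "binomial_ideal K M J"
  then obtain S where S: "S \<subseteq> binomials K M" "J = Idl\<^bsub>A\<^esub> S" by (auto simp: binomial_ideal_def)
  have SA: "S \<subseteq> carrier A" using S binomials_sub by auto
  have J: "ideal J A" using A.genideal_ideal[OF SA] S by simp
  have "S \<subseteq> J" using A.genideal_self[OF SA] S by simp
  have "S \<subseteq> bspan J"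
  proof
    fix f assume f: "f \<in> S"
    then obtain a c b where "f = binomial K M a c b" "a \<in> carrier M" "b \<in> carrier M" "c \<in> carrier K"
      using S(1) by (auto simp: binomials_def)
    then show "f \<in> bspan J" using bspan_binomial f \<open>S \<subseteq> J\<close> by blast
  qed
  then have "J \<subseteq> bspan J" using A.genideal_minimal[OF bspan_ideal[OF J]] S by simp
  then show "bin J" using J by (rule binI[rotated])
next
  assume b: "bin J"
  then have J: "ideal J A" by (rule bin_ideal)
  define S where "S = J \<inter> binomials K M"
  have SA: "S \<subseteq> carrier A" using S_def binomials_sub by auto
  let ?I = "Idl\<^bsub>A\<^esub> S"
  have I: "ideal ?I A" by (rule A.genideal_ideal[OF SA])
  have SI: "S \<subseteq> ?I" by (rule A.genideal_self[OF SA])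
  have IJ: "?I \<subseteq> J" by (rule A.genideal_minimal[OF J]) (auto simp: S_def)
  have one: "mterm K c a \<oplus>\<^sub>A mterm K d b \<in> ?I"
    if c: "c \<in> carrier K" "d \<in> carrier K" and a: "a \<in> carrier M" "b \<in> carrier M"
      and t: "mterm K c a \<oplus>\<^sub>A mterm K d b \<in> J" and nz: "c \<noteq> \<zero>\<^sub>K" for c a d b
  proof -
    note tt = two_term_cases[OF J c a t nz]
    then have "binomial K M a (\<ominus>\<^sub>K (inv\<^sub>K c \<otimes>\<^sub>K d)) b \<in> ?I"
      using SI a unfolding S_def binomials_def by auto
    then show ?thesis using tt(4) ideal_facts(6)[OF I] c by simp
  qed
  have "f \<in> ?I" if "f \<in> bspan J" for f
    using that
  proof induction
    case zero then show ?case using ideal_facts[OF I] by simp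
  next
    case (add a b c d f)
    have "mterm K c a \<oplus>\<^sub>A mterm K d b \<in> ?I"
    proof (cases "c = \<zero>\<^sub>K")
      case False then show ?thesis using one add by auto
    next
      case True
      show ?thesis
      proof (cases "d = \<zero>\<^sub>K")
        case False then show ?thesis using one[of d c b a] add by (simp add: A.a_comm)
      next
        case d: True
        then show ?thesis using True ideal_facts(2)[OF I] by simp
      qed
    qed
    then show ?case using ideal_facts(3)[OF I] add by blast
  qed
  then have "J = ?I" using b IJ by (auto simp: bin_def)
  then show "binomial_ideal K M J" unfolding binomial_ideal_def S_def by blast
qed

section \<open>Calculus of binomials modulo an ideal\<close>

lemma binomial_trans:
  assumes J: "ideal J A" and m: "a \<in> carrier M" "b \<in> carrier M" "e \<in> carrier M" and k: "c \<in> carrier K" "d \<in> carrier K"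
    and 1: "binomial K M a c b \<in> J" and 2: "binomial K M b d e \<in> J"
  shows "binomial K M a (c \<otimes>\<^sub>K d) e \<in> J"
proof -
  have "mterm K c \<one> \<otimes>\<^sub>A binomial K M b d e \<in> J"
    using ideal_facts(6)[OF J 2] k by simp
  then have "binomial K M a c b \<oplus>\<^sub>A mterm K c \<one> \<otimes>\<^sub>A binomial K M b d e \<in> J"
    using ideal_facts(3)[OF J 1] by blast
  moreover have "binomial K M a c b \<oplus>\<^sub>A mterm K c \<one> \<otimes>\<^sub>A binomial K M b d e = binomial K M a (c \<otimes>\<^sub>K d) e"
  proof -
    have c: "mterm K (\<ominus>\<^sub>K c) b \<oplus>\<^sub>A mterm K c b = \<zero>\<^sub>A"
      using k m by (simp add: mterm_add K.l_neg)
    have "binomial K M a c b \<oplus>\<^sub>A mterm K c \<one> \<otimes>\<^sub>A binomial K M b d e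
      = (tmono K a \<oplus>\<^sub>A mterm K (\<ominus>\<^sub>K c) b) \<oplus>\<^sub>A (mterm K c b \<oplus>\<^sub>A mterm K (\<ominus>\<^sub>K (c \<otimes>\<^sub>K d)) e)"
      using k m by (subst mterm_mult_binomial) (auto simp: binomial_eq)
    also have "\<dots> = tmono K a \<oplus>\<^sub>A ((mterm K (\<ominus>\<^sub>K c) b \<oplus>\<^sub>A mterm K c b) \<oplus>\<^sub>A mterm K (\<ominus>\<^sub>K (c \<otimes>\<^sub>K d)) e)"
      using k m by (simp add: A.a_assoc)
    also have "\<dots> = binomial K M a (c \<otimes>\<^sub>K d) e"
      unfolding c using k m by (simp add: binomial_eq)
    finally show ?thesis .
  qed
  ultimately show ?thesis by simp
qed

lemma binomial_refl: "ideal J A \<Longrightarrow> a \<in> carrier M \<Longrightarrow> binomial K M a \<one>\<^sub>K a \<in> J"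
  using ideal_facts(2) by (simp add: binomial_eq mterm_add K.r_neg)

lemma binomial_sym:
  assumes J: "ideal J A" and m: "a \<in> carrier M" "b \<in> carrier M" and k: "c \<in> carrier K" "c \<noteq> \<zero>\<^sub>K"
    and 1: "binomial K M a c b \<in> J"
  shows "binomial K M b (inv\<^sub>K c) a \<in> J"
proof -
  note i = K_inv[OF k]
  have c: "\<ominus>\<^bsub>K\<^esub> c \<in> carrier K" "\<ominus>\<^bsub>K\<^esub> c \<noteq> \<zero>\<^sub>K" using k by (auto simp: K.add.inv_eq_1_iff)
  \<comment> \<open>The factor is -1/c: it turns the coefficient of t^b into 1 and that of t^a into
    -1/c.\<close>
  have "mterm K (\<ominus>\<^sub>K (inv\<^sub>K c)) \<one> \<otimes>\<^sub>A binomial K M a c b \<in> J"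
    by (rule ideal_facts(6)[OF J 1]) (use i in simp)
  moreover have "mterm K (\<ominus>\<^sub>K (inv\<^sub>K c)) \<one> \<otimes>\<^sub>A binomial K M a c b = binomial K M b (inv\<^sub>K c) a"
    using i m k(1) by (subst mterm_mult_binomial) (auto simp: binomial_eq K.l_minus A.a_comm)
  ultimately show ?thesis by simp
qed

lemma binomial_mult:
  assumes J: "ideal J A" and m: "a \<in> carrier M" "b \<in> carrier M" "x \<in> carrier M" and k: "c \<in> carrier K"
    and 1: "binomial K M a c b \<in> J"
  shows "binomial K M (x \<otimes> a) c (x \<otimes> b) \<in> J"
  using ideal_facts(6)[OF J 1, of "tmono K x"] m k by (simp add: tmono_mult_binomial)

lemma mono_mult:
  assumes J: "ideal J A" and m: "a \<in> carrier M" "x \<in> carrier M"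
    and 1: "tmono K a \<in> J"
  shows "tmono K (x \<otimes> a) \<in> J"
  using ideal_facts(6)[OF J 1, of "tmono K x"] m by (simp add: mterm_mult)

lemma mterm_in: assumes J: "ideal J A" and m: "a \<in> carrier M" "c \<in> carrier K" and 1: "tmono K a \<in> J"
  shows "mterm K c a \<in> J"
  using ideal_facts(6)[OF J 1, of "mterm K c \<one>"] m by (simp add: mterm_mult)

lemma mono_bin:
  assumes J: "ideal J A" and m: "a \<in> carrier M" "b \<in> carrier M" and k: "c \<in> carrier K"
    and 1: "tmono K a \<in> J" "tmono K b \<in> J"
  shows "binomial K M a c b \<in> J"
  using mterm_in[OF J _ _ 1(2), of "\<ominus>\<^bsub>K\<^esub> c"] 1(1) m k ideal_facts(3)[OF J] by (simp add: binomial_eq)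

lemma binomial_mono_left:
  assumes J: "ideal J A" and m: "a \<in> carrier M" "b \<in> carrier M" and k: "c \<in> carrier K"
    and 1: "binomial K M a c b \<in> J" "tmono K b \<in> J"
  shows "tmono K a \<in> J"
  using binomial_trans[OF J m(1,2,2) k K.zero_closed 1(1)] 1(2) m k by (simp add: mono_iff_binomial)

lemma binomial_mono_right:
  assumes J: "ideal J A" and m: "a \<in> carrier M" "b \<in> carrier M" and k: "c \<in> carrier K" "c \<noteq> \<zero>\<^sub>K"
    and 1: "binomial K M a c b \<in> J" "tmono K a \<in> J"
  shows "tmono K b \<in> J"
  using binomial_mono_left[OF J m(2,1) _ binomial_sym[OF J m k 1(1)] 1(2)] K_inv[OF k] by blast

text \<open>The difference of the two binomials is the nonzero multiple d - c of t^b. So two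
  monomials outside \<open>J\<close> are proportional modulo \<open>J\<close> by at most one scalar,
  which makes characters well defined.\<close>

lemma binomial_unique:
  assumes J: "ideal J A" and m: "a \<in> carrier M" "b \<in> carrier M" and k: "c \<in> carrier K" "d \<in> carrier K"
    and 1: "binomial K M a c b \<in> J" "binomial K M a d b \<in> J" and ne: "c \<noteq> d"
  shows "tmono K b \<in> J"
proof (rule mterm_in_ideal[OF J])
  have "d = (d \<ominus>\<^bsub>K\<^esub> c) \<oplus>\<^sub>K c" using k by (simp add: K.minus_eq K.a_assoc K.l_neg)
  then show "d \<ominus>\<^bsub>K\<^esub> c \<in> carrier K" "d \<ominus>\<^bsub>K\<^esub> c \<noteq> \<zero>\<^sub>K" using k ne by auto
  show "b \<in> carrier M" by fact
  have "binomial K M a c b \<ominus>\<^bsub>A\<^esub> binomial K M a d b = mterm K (d \<ominus>\<^bsub>K\<^esub> c) b"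
  proof
    fix q
    show "(binomial K M a c b \<ominus>\<^bsub>A\<^esub> binomial K M a d b) q = mterm K (d \<ominus>\<^bsub>K\<^esub> c) b q"
      using k m unfolding a_minus_def[of A]
      by (subst A_neg[OF binomial_closed]) (auto simp: binomial_eq A_add mterm_def K.minus_add K.minus_eq K.r_neg K.a_comm
        K.r_neg2 K.l_neg K.r_neg1 K.a_assoc K.a_lcomm)
  qed
  then show "mterm K (d \<ominus>\<^bsub>K\<^esub> c) b \<in> J" using ideal_facts(5)[OF J 1] by simp
qed

section \<open>The congruence induced by an ideal\<close>

abbreviation cong where "cong J \<equiv> ideal_cong K M J"

lemma congI: "a \<in> carrier M \<Longrightarrow> b \<in> carrier M \<Longrightarrow> c \<in> carrier K \<Longrightarrow> c \<noteq> \<zero>\<^sub>K \<Longrightarrow> binomial K M a c b \<in> J \<Longrightarrow> (a, b) \<in> cong J"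
  by (auto simp: ideal_cong_def)

lemma congE:
  assumes "(a, b) \<in> cong J"
  obtains c where "a \<in> carrier M" "b \<in> carrier M" "c \<in> carrier K" "c \<noteq> \<zero>\<^sub>K" "binomial K M a c b \<in> J"
  using assms by (auto simp: ideal_cong_def)

lemma cong_monoid_cong: assumes J: "ideal J A" shows "monoid_cong M (cong J)"
  unfolding monoid_cong_def
proof
  show "equiv (carrier M) (cong J)"
  proof (rule equivI)
    show "cong J \<subseteq> carrier M \<times> carrier M" by (auto simp: ideal_cong_def)
    show "refl_on (carrier M) (cong J)"
      using binomial_refl[OF J] K.one_not_zero by (auto simp: refl_on_def intro!: congI)
    show "sym (cong J)"
    proof (rule symI)
      fix a b assume "(a, b) \<in> cong J"
      then show "(b, a) \<in> cong J"
        by (rule congE) (use binomial_sym[OF J] K_inv congI in metis)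
    qed
    show "trans (cong J)"
    proof (rule transI)
      fix a b e assume "(a, b) \<in> cong J" "(b, e) \<in> cong J"
      then obtain c d where "a \<in> carrier M" "b \<in> carrier M" "c \<in> carrier K" "c \<noteq> \<zero>\<^sub>K" "binomial K M a c b \<in> J"
         "e \<in> carrier M" "d \<in> carrier K" "d \<noteq> \<zero>\<^sub>K" "binomial K M b d e \<in> J"
        by (auto elim!: congE)
      then show "(a, e) \<in> cong J"
        using binomial_trans[OF J, of a b e c d] K.integral_iff[of c d] K.m_closed[of c d] congI[of a e "c \<otimes>\<^sub>K d"] by metis
    qed
  qed
  show "\<forall>(a, b)\<in>cong J. \<forall>c\<in>carrier M. (a \<otimes> c, b \<otimes> c) \<in> cong J"
  proof clarify
    fix a b x assume "(a, b) \<in> cong J" and x: "x \<in> carrier M"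
    then show "(a \<otimes> x, b \<otimes> x) \<in> cong J"
      by (elim congE) (use binomial_mult[OF J] x in \<open>auto intro!: congI simp: M.m_comm[of _ x]\<close>)
  qed
qed

lemma cong_refl: "ideal J A \<Longrightarrow> a \<in> carrier M \<Longrightarrow> (a, a) \<in> cong J"
  using cong_monoid_cong by (auto simp: monoid_cong_def equiv_def refl_on_def)

lemma cong_sym: "ideal J A \<Longrightarrow> (a, b) \<in> cong J \<Longrightarrow> (b, a) \<in> cong J"
  using cong_monoid_cong by (auto simp: monoid_cong_def equiv_def dest: symD)

lemma cong_trans: "ideal J A \<Longrightarrow> (a, b) \<in> cong J \<Longrightarrow> (b, c) \<in> cong J \<Longrightarrow> (a, c) \<in> cong J"
  using cong_monoid_cong by (auto simp: monoid_cong_def equiv_def dest: transD)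

lemma cong_mult: "ideal J A \<Longrightarrow> (a, b) \<in> cong J \<Longrightarrow> c \<in> carrier M \<Longrightarrow> (a \<otimes> c, b \<otimes> c) \<in> cong J"
  using cong_monoid_cong[of J] by (fastforce simp: monoid_cong_def)

lemma cong_mult': "ideal J A \<Longrightarrow> (a, b) \<in> cong J \<Longrightarrow> c \<in> carrier M \<Longrightarrow> (c \<otimes> a, c \<otimes> b) \<in> cong J"
  using cong_mult[of J a b c] by (auto simp: ideal_cong_def M.m_comm)

lemma cong_carrier: "(a, b) \<in> cong J \<Longrightarrow> a \<in> carrier M \<and> b \<in> carrier M"
  by (auto simp: ideal_cong_def)

lemma cong_mono: "J \<subseteq> J' \<Longrightarrow> cong J \<subseteq> cong J'"
  by (auto simp: ideal_cong_def)

lemma cong_mono_iff: "ideal J A \<Longrightarrow> (a, b) \<in> cong J \<Longrightarrow> tmono K a \<in> J \<longleftrightarrow> tmono K b \<in> J"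
  using binomial_mono_left binomial_mono_right by (meson congE)

text \<open>The coefficient 1 works as well as any other. Hence all monomials of \<open>J\<close>
  form one class, which becomes the nil of the quotient monoid.\<close>

lemma cong_both_mono:
  assumes J: "ideal J A" "a \<in> carrier M" "b \<in> carrier M" "tmono K a \<in> J" "tmono K b \<in> J"
  shows "(a, b) \<in> cong J"
  by (rule congI[of _ _ "\<one>\<^sub>K"]) (use assms mono_bin in auto)

section \<open>The grading of the quotient algebra by the congruence\<close>

definition saturated :: "('q \<times> 'q) set \<Rightarrow> 'q set \<Rightarrow> bool" where
  "saturated r E \<longleftrightarrow> (\<forall>(a, b)\<in>r. a \<in> E \<longleftrightarrow> b \<in> E)"

text \<open>A two-term element of \<open>J\<close> with nonzero coefficients has congruent
  exponents, so \<open>E\<close> keeps both terms or neither; a single term is kept or dropped as a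
  whole. For a single class \<open>E\<close> this is homogeneity of \<open>J\<close>.\<close>

lemma res_in:
  assumes b: "bin J" and E: "saturated (cong J) E" and f: "f \<in> J"
  shows "res E f \<in> J"
proof -
  have J: "ideal J A" using b by (rule bin_ideal)
  have "f \<in> bspan J" using b f by (auto simp: bin_def)
  then show ?thesis
  proof induction
    case zero then show ?case using ideal_facts[OF J] by simp
  next
    case (add x y c d f)
    have "res E (mterm K c x \<oplus>\<^sub>A mterm K d y) \<in> J"
    proof (cases "c = \<zero>\<^sub>K \<or> d = \<zero>\<^sub>K")
      case True
      then show ?thesis using add(1-5) ideal_facts(2)[OF J] by (auto simp: res_add res_mterm)
    next
      case False
      then have "(x, y) \<in> cong J" using two_term_cases[OF J add(3,4,1,2,5)] add(1-4) by (auto intro!: congI)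
      then have "x \<in> E \<longleftrightarrow> y \<in> E" using E by (auto simp: saturated_def)
      then show ?thesis using add(1-5) ideal_facts(2)[OF J] by (auto simp: res_add res_mterm)
    qed
    then show ?case using add(7) ideal_facts(3)[OF J] by (simp add: res_add)
  qed
qed

lemma saturated_class: assumes J: "ideal J A" shows "saturated (cong J) (cong J `` {x})"
  unfolding saturated_def by (blast intro: cong_trans[OF J] cong_sym[OF J])

lemma saturated_translate: assumes J: "ideal J A" and E: "saturated (cong J) E" and x: "x \<in> carrier M"
  shows "saturated (cong J) {y. x \<otimes> y \<in> E}"
  using cong_mult'[OF J _ x] E by (fastforce simp: saturated_def)

lemma res_disjoint: assumes f: "f \<in> carrier A" and d: "D \<inter> E = {}" shows "res (D \<union> E) f = res D f \<oplus>\<^sub>A res E f"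
  using A_coeff[OF f] d by (auto simp: res_def A_add fun_eq_iff)

text \<open>Only the finitely many classes meeting the support contribute; their parts are added one
  class at a time, skipping a class that is already covered.\<close>

lemma graded_sum:
  assumes J: "ideal J A" and f: "f \<in> carrier A" and d: "\<And>x. x \<in> carrier M \<Longrightarrow> res (cong J `` {x}) f \<in> J"
  shows "f \<in> J"
proof -
  have "finite F \<Longrightarrow> F \<subseteq> carrier M \<Longrightarrow> res (cong J `` F) f \<in> J" for F
  proof (induction F rule: finite_induct)
    case empty
    have "res {} f = \<zero>\<^sub>A" by (simp add: res_def A_zero)
    then show ?case using ideal_facts(2)[OF J] by simp
  next
    case (insert x F)
    show ?case
    proof (cases "cong J `` {x} \<inter> cong J `` F = {}")
      case True
      have "cong J `` insert x F = cong J `` {x} \<union> cong J `` F" by auto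
      then show ?thesis using res_disjoint[OF f True] insert d ideal_facts(3)[OF J] by simp
    next
      case False
      then obtain z y where "(x, z) \<in> cong J" "(y, z) \<in> cong J" "y \<in> F" by auto
      then have "cong J `` {x} \<subseteq> cong J `` F" using cong_trans[OF J] cong_sym[OF J] by blast
      then have "cong J `` insert x F = cong J `` F" by auto
      then show ?thesis using insert by simp
    qed
  qed
  from this[OF supp_finite[OF f] supp_carrier[OF f]]
  moreover have "supp f \<subseteq> cong J `` supp f" using supp_carrier[OF f] cong_refl[OF J] by blast
  ultimately show ?thesis by (simp add: res_eq_self)
qed

lemma unit_binomial_cancel:
  assumes J: "ideal J A" and u: "u \<in> Units M" and f: "f \<in> carrier A" and t: "tmono K u \<otimes>\<^sub>A f \<in> J"
  shows "f \<in> J"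
proof -
  have "tmono K (inv u) \<otimes>\<^sub>A (tmono K u \<otimes>\<^sub>A f) \<in> J"
    using ideal_facts(6)[OF J t] u by simp
  moreover have "tmono K (inv u) \<otimes>\<^sub>A (tmono K u \<otimes>\<^sub>A f) = f"
    using u f by (simp add: A_assoc[symmetric] mterm_mult M.Units_closed A_one[symmetric] A_one_mult)
  ultimately show ?thesis by simp
qed

section \<open>Sums and generators of binomial ideals\<close>

lemma sum_ideal:
  assumes a: "ideal J1 A" "ideal J2 A"
  shows "ideal (J1 <+>\<^bsub>A\<^esub> J2) A" "J1 \<subseteq> J1 <+>\<^bsub>A\<^esub> J2" "J2 \<subseteq> J1 <+>\<^bsub>A\<^esub> J2"
    "ideal L A \<Longrightarrow> J1 \<subseteq> L \<Longrightarrow> J2 \<subseteq> L \<Longrightarrow> J1 <+>\<^bsub>A\<^esub> J2 \<subseteq> L"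
proof -
  note 1 = ideal_facts[OF a(1)] and 2 = ideal_facts[OF a(2)]
  show "ideal (J1 <+>\<^bsub>A\<^esub> J2) A" using a by (rule A.add_ideals)
  show "J1 \<subseteq> J1 <+>\<^bsub>A\<^esub> J2"
  proof
    fix f assume f: "f \<in> J1"
    then have "f = f \<oplus>\<^sub>A \<zero>\<^sub>A" using 1 by auto
    then show "f \<in> J1 <+>\<^bsub>A\<^esub> J2" using f 2(2) by (auto simp: set_add_def')
  qed
  show "J2 \<subseteq> J1 <+>\<^bsub>A\<^esub> J2"
  proof
    fix f assume f: "f \<in> J2"
    then have "f = \<zero>\<^sub>A \<oplus>\<^sub>A f" using 2 by auto
    then show "f \<in> J1 <+>\<^bsub>A\<^esub> J2" using f 1(2) by (auto simp: set_add_def')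
  qed
  show "J1 <+>\<^bsub>A\<^esub> J2 \<subseteq> L" if "ideal L A" "J1 \<subseteq> L" "J2 \<subseteq> L"
    using ideal_facts(3)[OF that(1)] that by (auto simp: set_add_def')
qed

lemma sum_bin:
  assumes b: "bin J1" "bin J2" shows "bin (J1 <+>\<^bsub>A\<^esub> J2)"
proof (rule binI)
  note s = sum_ideal[OF b[THEN bin_ideal]]
  show "ideal (J1 <+>\<^bsub>A\<^esub> J2) A" by (rule s)
  have "J1 \<subseteq> bspan (J1 <+>\<^bsub>A\<^esub> J2)" "J2 \<subseteq> bspan (J1 <+>\<^bsub>A\<^esub> J2)"
    using b bspan_mono[OF s(2)] bspan_mono[OF s(3)] by (auto simp: bin_def)
  then show "J1 <+>\<^bsub>A\<^esub> J2 \<subseteq> bspan (J1 <+>\<^bsub>A\<^esub> J2)"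
    using s(4)[OF bspan_ideal[OF s(1)]] by blast
qed

lemma Idl_bin:
  assumes "S \<subseteq> binomials K M" shows "bin (Idl\<^bsub>A\<^esub> S)" "S \<subseteq> Idl\<^bsub>A\<^esub> S"
    "ideal L A \<Longrightarrow> S \<subseteq> L \<Longrightarrow> Idl\<^bsub>A\<^esub> S \<subseteq> L"
proof -
  show "bin (Idl\<^bsub>A\<^esub> S)" using assms bin_iff by (auto simp: binomial_ideal_def)
  show "S \<subseteq> Idl\<^bsub>A\<^esub> S" using A.genideal_self assms binomials_sub by blast
  show "ideal L A \<Longrightarrow> S \<subseteq> L \<Longrightarrow> Idl\<^bsub>A\<^esub> S \<subseteq> L" by (rule A.genideal_minimal)
qed

lemma binomial_in_binomials: "a \<in> carrier M \<Longrightarrow> b \<in> carrier M \<Longrightarrow> c \<in> carrier K \<Longrightarrow> binomial K M a c b \<in> binomials K M"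
  by (auto simp: binomials_def)

lemma tmono_in_binomials: "a \<in> carrier M \<Longrightarrow> tmono K a \<in> binomials K M"
  using binomial_in_binomials[of a a "\<zero>\<^sub>K"] by (simp add: mono_iff_binomial)

lemma bin_sub_ideal:
  assumes b: "bin J" and L: "ideal L A"
    and s: "\<And>a c b. a \<in> carrier M \<Longrightarrow> b \<in> carrier M \<Longrightarrow> c \<in> carrier K \<Longrightarrow> binomial K M a c b \<in> J \<Longrightarrow> binomial K M a c b \<in> L"
  shows "J \<subseteq> L"
proof -
  obtain S where S: "S \<subseteq> binomials K M" "J = Idl\<^bsub>A\<^esub> S" using b unfolding bin_iff[symmetric] binomial_ideal_def by blast
  have "S \<subseteq> L"
  proof
    fix f assume f: "f \<in> S"
    then have "f \<in> J" using Idl_bin(2)[OF S(1)] S(2) by auto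
    moreover obtain a c b where "f = binomial K M a c b" "a \<in> carrier M" "b \<in> carrier M" "c \<in> carrier K"
      using f S(1) by (auto simp: binomials_def)
    ultimately show "f \<in> L" using s by auto
  qed
  then show ?thesis using Idl_bin(3)[OF S(1) L] S(2) by simp
qed

text \<open>Each degree of the quotient is spanned by any one monomial in it: a term whose exponent
  is congruent to \<open>x0\<close> is, modulo \<open>J\<close>, a scalar multiple of t^x0.\<close>

lemma class_decomp:
  assumes J: "ideal J A" and x0: "x0 \<in> carrier M" and g: "g \<in> carrier A"
  shows "\<exists>c\<in>carrier K. \<exists>h\<in>J. res (cong J `` {x0}) g = h \<oplus>\<^sub>A mterm K c x0"
  using g
proof (induction rule: A_induct)
  case zero
  have "res (cong J `` {x0}) \<zero>\<^sub>A = \<zero>\<^sub>A \<oplus>\<^sub>A mterm K \<zero>\<^sub>K x0" by simp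
  then show ?case using ideal_facts(2)[OF J] K.zero_closed by blast
next
  case (add d a g)
  then obtain c h where c: "c \<in> carrier K" and h: "h \<in> J" and e: "res (cong J `` {x0}) g = h \<oplus>\<^sub>A mterm K c x0" by auto
  have hA: "h \<in> carrier A" using h ideal_facts(1)[OF J] by auto
  show ?case
  proof (cases "a \<in> cong J `` {x0}")
    case False
    then have "res (cong J `` {x0}) (mterm K d a \<oplus>\<^sub>A g) = h \<oplus>\<^sub>A mterm K c x0"
      using e hA c x0 by (simp add: res_add res_mterm)
    then show ?thesis using c h by blast
  next
    case True
    then have "(a, x0) \<in> cong J" using cong_sym[OF J] by blast
    then obtain k where k: "k \<in> carrier K" "binomial K M a k x0 \<in> J" by (rule congE)
    \<comment> \<open>Modulo \<open>J\<close> this element replaces the new term d t^a by d k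
      t^x0.\<close>
    define b where "b = mterm K d \<one> \<otimes>\<^sub>A binomial K M a k x0"
    have b: "b \<in> J" unfolding b_def using ideal_facts(6)[OF J k(2)] add(1) by simp
    have bA: "b \<in> carrier A" using b ideal_facts(1)[OF J] by auto
    have be: "b = mterm K d a \<oplus>\<^sub>A mterm K (\<ominus>\<^bsub>K\<^esub> (d \<otimes>\<^sub>K k)) x0"
      unfolding b_def using add(1,2) k(1) x0 by (simp add: mterm_mult_binomial)
    have ma: "mterm K d a = b \<oplus>\<^sub>A mterm K (d \<otimes>\<^sub>K k) x0"
      unfolding be using add(1,2) k(1) x0 by (simp add: A.a_assoc mterm_add K.l_neg)
    have "res (cong J `` {x0}) (mterm K d a \<oplus>\<^sub>A g) = mterm K d a \<oplus>\<^sub>A (h \<oplus>\<^sub>A mterm K c x0)"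
      using e True by (simp add: res_add res_mterm)
    also have "\<dots> = (b \<oplus>\<^sub>A mterm K (d \<otimes>\<^sub>K k) x0) \<oplus>\<^sub>A (h \<oplus>\<^sub>A mterm K c x0)"
      by (simp only: ma)
    also have "\<dots> = (b \<oplus>\<^sub>A h) \<oplus>\<^sub>A (mterm K (d \<otimes>\<^sub>K k) x0 \<oplus>\<^sub>A mterm K c x0)"
      using bA hA add(1) k(1) c x0 by (simp add: A.a_ac)
    also have "\<dots> = (b \<oplus>\<^sub>A h) \<oplus>\<^sub>A mterm K (d \<otimes>\<^sub>K k \<oplus>\<^sub>K c) x0"
      using add(1) k(1) c by (simp add: mterm_add)
    finally show ?thesis using ideal_facts(3)[OF J b h] add(1) k(1) c by blast
  qed
qed

end

section \<open>Monoid homomorphisms\<close>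

locale monoid_alg_hom =
  dom: monoid_alg K M + cod: monoid_alg K N
  for K :: "('k, 'y) ring_scheme" and M :: "('q, 'x) monoid_scheme" and N :: "('n, 'z) monoid_scheme" +
  fixes h :: "'q \<Rightarrow> 'n"
  assumes h_closed [simp, intro]: "a \<in> carrier M \<Longrightarrow> h a \<in> carrier N"
    and h_mult [simp]: "a \<in> carrier M \<Longrightarrow> b \<in> carrier M \<Longrightarrow> h (a \<otimes>\<^bsub>M\<^esub> b) = h a \<otimes>\<^bsub>N\<^esub> h b"
    and h_one [simp]: "h \<one>\<^bsub>M\<^esub> = \<one>\<^bsub>N\<^esub>"
begin

text \<open>The induced algebra homomorphism. Summing over the part of a fibre inside the support is
  exactly the form of \<open>loc_hom\<close>, so the two coincide when \<open>h\<close> is the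
  localization map.\<close>

definition push :: "('q \<Rightarrow> 'k) \<Rightarrow> 'n \<Rightarrow> 'k" where
  "push f = (\<lambda>x. finsum K f {q. f q \<noteq> \<zero>\<^bsub>K\<^esub> \<and> h q = x})"

lemma push_superset:
  assumes f: "f \<in> carrier dom.A" and X: "finite X" "dom.supp f \<subseteq> X"
  shows "push f x = finsum K (\<lambda>q. if h q = x then f q else \<zero>\<^bsub>K\<^esub>) X"
  unfolding push_def
  by (rule dom.K.add.finprod_mono_neutral_cong_left)
    (use dom.A_coeff[OF f] X in \<open>auto simp: dom.supp_def\<close>)

lemma push_add:
  assumes f: "f \<in> carrier dom.A" and g: "g \<in> carrier dom.A"
  shows "push (f \<oplus>\<^bsub>dom.A\<^esub> g) = push f \<oplus>\<^bsub>cod.A\<^esub> push g"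
proof
  fix x
  define X where "X = dom.supp f \<union> dom.supp g"
  have X: "finite X" "dom.supp f \<subseteq> X" "dom.supp g \<subseteq> X" "dom.supp (f \<oplus>\<^bsub>dom.A\<^esub> g) \<subseteq> X"
    using f g by (auto simp: X_def dom.supp_finite) (auto simp: dom.A_add dom.supp_def)
  have fg: "f \<oplus>\<^bsub>dom.A\<^esub> g \<in> carrier dom.A" using f g by simp
  show "push (f \<oplus>\<^bsub>dom.A\<^esub> g) x = (push f \<oplus>\<^bsub>cod.A\<^esub> push g) x"
    unfolding cod.A_add push_superset[OF fg X(1,4)] push_superset[OF f X(1,2)] push_superset[OF g X(1,3)]
    by (rule trans[OF dom.K.finsum_cong' dom.K.finsum_addf])
      (use dom.A_coeff[OF f] dom.A_coeff[OF g] in \<open>auto simp: dom.A_add\<close>)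
qed

lemma push_mterm: assumes "c \<in> carrier K" "a \<in> carrier M" shows "push (mterm K c a) = mterm K c (h a)"
proof
  fix x
  have "push (mterm K c a) x = finsum K (\<lambda>q. if h q = x then mterm K c a q else \<zero>\<^bsub>K\<^esub>) {a}"
    by (rule push_superset) (use assms dom.supp_mterm in auto)
  then show "push (mterm K c a) x = mterm K c (h a) x" using assms by (simp add: mterm_def)
qed

lemma push_zero [simp]: "push \<zero>\<^bsub>dom.A\<^esub> = \<zero>\<^bsub>cod.A\<^esub>"
  by (rule ext) (simp add: push_def dom.A_zero cod.A_zero)

lemma push_closed [simp, intro]: "f \<in> carrier dom.A \<Longrightarrow> push f \<in> carrier cod.A"
  by (induction rule: dom.A_induct) (auto simp: push_add push_mterm)

lemma push_mult:
  assumes f: "f \<in> carrier dom.A" and g: "g \<in> carrier dom.A"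
  shows "push (f \<otimes>\<^bsub>dom.A\<^esub> g) = push f \<otimes>\<^bsub>cod.A\<^esub> push g"
proof -
  have 1: "push (mterm K c a \<otimes>\<^bsub>dom.A\<^esub> g) = mterm K c (h a) \<otimes>\<^bsub>cod.A\<^esub> push g"
    if "c \<in> carrier K" "a \<in> carrier M" for c a
    using g
    by (induction rule: dom.A_induct)
      (use that in \<open>auto simp: dom.A_mult_zero cod.A_mult_zero dom.A_r_distr cod.A_r_distr push_add push_mterm dom.mterm_mult cod.mterm_mult\<close>)
  show ?thesis using f
    by (induction rule: dom.A_induct)
      (use g 1 in \<open>auto simp: dom.A_zero_mult cod.A_zero_mult dom.A_l_distr cod.A_l_distr push_add push_mterm\<close>)
qed

lemma push_binomial:
  assumes "c \<in> carrier K" "a \<in> carrier M" "b \<in> carrier M"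
  shows "push (binomial K M a c b) = binomial K N (h a) c (h b)"
  using assms by (simp add: dom.binomial_eq cod.binomial_eq push_add push_mterm)

definition pull :: "('n \<Rightarrow> 'k) set \<Rightarrow> ('q \<Rightarrow> 'k) set" where
  "pull J = {f \<in> carrier dom.A. push f \<in> J}"

lemma pull_ideal: assumes J: "ideal J cod.A" shows "ideal (pull J) dom.A"
  by (rule dom.ideal_intro)
    (use cod.ideal_facts[OF J] in \<open>auto simp: pull_def push_add push_mult push_mterm\<close>)

text \<open>Induction on the size of the support. For a term at \<open>a\<close>, either t^(h a)
  lies in \<open>J\<close> and a monomial of the preimage can be split off, or another point
  \<open>b\<close> of the support lands in the class of \<open>h a\<close>: otherwise the part of
  \<open>push f\<close> in that degree, which lies in \<open>J\<close>, would be a single term. Then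
  a multiple of a binomial of the preimage on \<open>a\<close> and \<open>b\<close> removes
  \<open>a\<close> without enlarging the support.\<close>

lemma pull_bin: assumes b: "cod.bin J" shows "dom.bin (pull J)"
proof (rule dom.binI)
  have J: "ideal J cod.A" using b by (rule cod.bin_ideal)
  show I: "ideal (pull J) dom.A" using J by (rule pull_ideal)
  note bs = dom.bspan_ideal[OF I]
  have "f \<in> pull J \<Longrightarrow> f \<in> dom.bspan (pull J)" for f
  proof (induction "card (dom.supp f)" arbitrary: f rule: less_induct)
    case less
    have f: "f \<in> carrier dom.A" and pf: "push f \<in> J" using less(2) by (auto simp: pull_def)
    show ?case
    proof (cases "dom.supp f = {}")
      case True
      then have "f = \<zero>\<^bsub>dom.A\<^esub>" by (auto simp: dom.supp_def dom.A_zero)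
      then show ?thesis by (simp add: dom.bspan.zero)
    next
      case False
      then obtain a where a: "a \<in> dom.supp f" by auto
      have aM: "a \<in> carrier M" using a dom.supp_carrier[OF f] by auto
      have fa: "f a \<in> carrier K" using dom.A_coeff[OF f] .
      have fa0: "f a \<noteq> \<zero>\<^bsub>K\<^esub>" using a by (simp add: dom.supp_def)
      \<comment> \<open>The coefficient 0 covers the monomial case, where \<open>b\<close> is a mere
        placeholder; otherwise \<open>b\<close> must lie in the support already, so that subtraction
        creates no new exponent.\<close>
      have step: ?thesis
        if c: "c \<in> carrier K" and bM: "b \<in> carrier M"
          and t: "binomial K M a c b \<in> pull J" and bs0: "c = \<zero>\<^bsub>K\<^esub> \<or> b \<in> dom.supp f \<and> b \<noteq> a" for c b
      proof -
        define u where "u = mterm K (f a) \<one>\<^bsub>M\<^esub> \<otimes>\<^bsub>dom.A\<^esub> binomial K M a c b"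
        have u: "u \<in> pull J" unfolding u_def using dom.ideal_facts(6)[OF I t] fa by simp
        have uA: "u \<in> carrier dom.A" using u by (auto simp: pull_def)
        have ub: "u \<in> dom.bspan (pull J)"
          unfolding u_def using dom.ideal_facts(6)[OF bs dom.bspan_binomial[OF aM bM c t]] fa by simp
        have ue: "u = mterm K (f a) a \<oplus>\<^bsub>dom.A\<^esub> mterm K (\<ominus>\<^bsub>K\<^esub> (f a \<otimes>\<^bsub>K\<^esub> c)) b"
          unfolding u_def using fa c aM bM by (simp add: dom.mterm_mult_binomial)
        define g where "g = f \<ominus>\<^bsub>dom.A\<^esub> u"
        have g: "g \<in> pull J" unfolding g_def using dom.ideal_facts(5)[OF I less(2) u] .
        have gq: "g q = f q \<ominus>\<^bsub>K\<^esub> u q" for q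
          unfolding g_def a_minus_def[of dom.A] using uA by (simp add: dom.A_add dom.A_neg a_minus_def)
        have "dom.supp g \<subseteq> dom.supp f - {a}"
        proof
          fix q assume q: "q \<in> dom.supp g"
          have "q \<noteq> a"
          proof
            assume "q = a"
            then have "u q = f a" using bs0 fa aM bM c unfolding ue by (auto simp: dom.A_add mterm_def)
            then show False using q gq[of q] fa \<open>q = a\<close> by (simp add: dom.supp_def a_minus_def dom.K.r_neg)
          qed
          moreover have "q \<in> dom.supp f"
          proof (rule ccontr)
            assume nq: "q \<notin> dom.supp f"
            then have "u q = \<zero>\<^bsub>K\<^esub>" using bs0 a fa unfolding ue by (auto simp: dom.A_add mterm_def)
            then show False using q gq[of q] nq by (simp add: dom.supp_def a_minus_def)
          qed
          ultimately show "q \<in> dom.supp f - {a}" by simp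
        qed
        then have "card (dom.supp g) < card (dom.supp f)"
          using a dom.supp_finite[OF f] by (meson card_Diff1_less card_mono finite_Diff le_less_trans)
        then have gb: "g \<in> dom.bspan (pull J)" using less(1) g by simp
        have gA: "g \<in> carrier dom.A" using g by (auto simp: pull_def)
        have "f = g \<oplus>\<^bsub>dom.A\<^esub> u" unfolding g_def using f uA by (simp add: a_minus_def dom.A.a_assoc dom.A.l_neg)
        then show ?thesis using dom.bspan_add[OF gb ub] by simp
      qed
      show ?thesis
      proof (cases "tmono K (h a) \<in> J")
        case True
        then have "binomial K M a \<zero>\<^bsub>K\<^esub> a \<in> pull J" using aM by (simp add: dom.mono_iff_binomial pull_def push_mterm)
        then show ?thesis using step[of "\<zero>\<^bsub>K\<^esub>" a] aM by simp
      next
        case nJ: False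
        let ?E = "ideal_cong K N J `` {h a}"
        have rE: "cod.res ?E (push f) \<in> J"
          by (rule cod.res_in[OF b cod.saturated_class[OF J] pf])
        have "\<exists>b \<in> dom.supp f. b \<noteq> a \<and> (h a, h b) \<in> ideal_cong K N J"
        proof (rule ccontr)
          assume non: "\<not> ?thesis"
          \<comment> \<open>In the class of \<open>h a\<close> the only contribution comes from
            \<open>a\<close>, hence the coefficient at \<open>h a\<close> is f a and all others
            vanish.\<close>
          have eq: "cod.res ?E (push f) = mterm K (f a) (h a)"
          proof
            fix x
            have ha: "(h a, h a) \<in> ideal_cong K N J" using cod.cong_refl[OF J] aM by simp
            have p: "push f x = finsum K (\<lambda>q. if h q = x then f q else \<zero>\<^bsub>K\<^esub>) (dom.supp f)"
              by (rule push_superset[OF f dom.supp_finite[OF f]]) simp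
            have "push f x = f a" if "x = h a"
            proof -
              have "push f x = finsum K (\<lambda>q. if a = q then f q else \<zero>\<^bsub>K\<^esub>) (dom.supp f)"
                unfolding p using dom.A_coeff[OF f] that non ha
                by (intro dom.K.finsum_cong') auto
              also have "\<dots> = f a"
                using dom.K.add.finprod_singleton[OF a dom.supp_finite[OF f], of f] dom.A_coeff[OF f] by auto
              finally show ?thesis .
            qed
            moreover have "push f x = \<zero>\<^bsub>K\<^esub>" if "x \<noteq> h a" "(h a, x) \<in> ideal_cong K N J"
              unfolding p using non that by (intro dom.K.add.finprod_one_eqI) auto
            ultimately show "cod.res ?E (push f) x = mterm K (f a) (h a) x"
              using ha by (auto simp: cod.res_def mterm_def)
          qed
          then show False using cod.mterm_in_ideal[OF J fa fa0] rE aM nJ by simp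
        qed
        then obtain b where bb: "b \<in> dom.supp f" "b \<noteq> a" "(h a, h b) \<in> ideal_cong K N J" by auto
        then obtain c where c: "c \<in> carrier K" "binomial K N (h a) c (h b) \<in> J" by (auto elim: cod.congE)
        have bM: "b \<in> carrier M" using bb dom.supp_carrier[OF f] by auto
        have "binomial K M a c b \<in> pull J" using c aM bM by (simp add: pull_def push_binomial)
        then show ?thesis using step[OF c(1) bM] bb by simp
      qed
    qed
  qed
  then show "pull J \<subseteq> dom.bspan (pull J)" by blast
qed

end

section \<open>Localization\<close>

locale localization = Q: comm_monoid Q for Q :: "('q, 'x) monoid_scheme" (structure) +
  fixes P :: "'q set"
  assumes prime: "monoid_prime Q P"
begin

abbreviation N where "N \<equiv> loc_monoid Q P"
abbreviation times_N (infixl "\<otimes>\<^sub>N" 70) where "x \<otimes>\<^sub>N y \<equiv> x \<otimes>\<^bsub>N\<^esub> y"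
abbreviation inv_N ("inv\<^sub>N _" [81] 80) where "inv\<^sub>N x \<equiv> inv\<^bsub>N\<^esub> x"
abbreviation one_N ("\<one>\<^sub>N") where "\<one>\<^sub>N \<equiv> \<one>\<^bsub>N\<^esub>"

definition F where "F = carrier Q - P"

lemma F_sub: "f \<in> F \<Longrightarrow> f \<in> carrier Q" by (simp add: F_def)

lemma F_one [simp, intro]: "\<one> \<in> F"
  using prime by (auto simp: monoid_prime_def F_def submonoid_def)

lemma F_mult [intro]: "f \<in> F \<Longrightarrow> g \<in> F \<Longrightarrow> f \<otimes> g \<in> F"
  using prime submonoid.m_closed[of "carrier Q - P" Q f g] by (simp add: monoid_prime_def F_def)

lemma P_sub: "p \<in> P \<Longrightarrow> p \<in> carrier Q"
  using prime by (auto simp: monoid_prime_def monoid_ideal_def)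

lemma P_mult: "p \<in> P \<Longrightarrow> q \<in> carrier Q \<Longrightarrow> p \<otimes> q \<in> P"
  using prime by (auto simp: monoid_prime_def monoid_ideal_def)

lemma F_or_P: "q \<in> carrier Q \<Longrightarrow> q \<in> F \<or> q \<in> P"
  by (simp add: F_def)

definition frac where "frac a f = loc_rel Q P `` {(a, f)}"

lemma loc_rel_iff: "((a, f), (b, g)) \<in> loc_rel Q P \<longleftrightarrow>
  a \<in> carrier Q \<and> b \<in> carrier Q \<and> f \<in> F \<and> g \<in> F \<and>
  (\<exists>h\<in>F. a \<otimes> g \<otimes> h = b \<otimes> f \<otimes> h)"
  by (auto simp: loc_rel_def F_def)

lemma loc_rel_equiv: "equiv (carrier Q \<times> F) (loc_rel Q P)"
proof (rule equivI)
  show "loc_rel Q P \<subseteq> (carrier Q \<times> F) \<times> carrier Q \<times> F" by (auto simp: loc_rel_def F_def)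
  show "refl_on (carrier Q \<times> F) (loc_rel Q P)"
    using F_one by (auto simp: refl_on_def loc_rel_iff)
  show "sym (loc_rel Q P)" by (rule symI) (auto simp: loc_rel_iff, metis)
  show "trans (loc_rel Q P)"
  proof (rule transI, clarify)
    fix a f b g c k assume "((a, f), (b, g)) \<in> loc_rel Q P" "((b, g), (c, k)) \<in> loc_rel Q P"
    then obtain h h' where m: "a \<in> carrier Q" "b \<in> carrier Q" "c \<in> carrier Q" "f \<in> F" "g \<in> F" "k \<in> F" "h \<in> F" "h' \<in> F"
      and 1: "a \<otimes> g \<otimes> h = b \<otimes> f \<otimes> h"
      and 2: "b \<otimes> k \<otimes> h' = c \<otimes> g \<otimes> h'" by (auto simp: loc_rel_iff)
    note c = m(1-3) m(4-8)[THEN F_sub]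
    have "a \<otimes> k \<otimes> (g \<otimes> h \<otimes> h') = (a \<otimes> g \<otimes> h) \<otimes> (k \<otimes> h')"
      using c by (simp add: Q.m_ac)
    also have "\<dots> = (b \<otimes> k \<otimes> h') \<otimes> (f \<otimes> h)"
      unfolding 1 using c by (simp add: Q.m_ac)
    also have "\<dots> = c \<otimes> f \<otimes> (g \<otimes> h \<otimes> h')"
      unfolding 2 using c by (simp add: Q.m_ac)
    finally show "((a, f), (c, k)) \<in> loc_rel Q P"
      using m by (auto simp: loc_rel_iff intro!: bexI[of _ "g \<otimes> h \<otimes> h'"])
  qed
qed

lemma frac_eq: assumes "a \<in> carrier Q" "f \<in> F" "b \<in> carrier Q" "g \<in> F"
  shows "frac a f = frac b g \<longleftrightarrow> (\<exists>h\<in>F. a \<otimes> g \<otimes> h = b \<otimes> f \<otimes> h)"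
  unfolding frac_def using eq_equiv_class_iff[OF loc_rel_equiv, of "(a, f)" "(b, g)"] assms
  by (simp add: loc_rel_iff)

lemma carrier_N: "carrier N = {frac a f |a f. a \<in> carrier Q \<and> f \<in> F}"
  by (auto simp: loc_monoid_def quotient_def frac_def F_def)

lemma N_mult:
  assumes m: "a \<in> carrier Q" "f \<in> F" "b \<in> carrier Q" "g \<in> F"
  shows "frac a f \<otimes>\<^sub>N frac b g = frac (a \<otimes> b) (f \<otimes> g)"
proof -
  have eq: "loc_rel Q P `` {(a' \<otimes> b', f' \<otimes> g')} = frac (a \<otimes> b) (f \<otimes> g)"
    if tt: "(a', f') \<in> frac a f" "(b', g') \<in> frac b g" for a' f' b' g'
  proof -
    obtain h k where n: "a' \<in> carrier Q" "f' \<in> F" "b' \<in> carrier Q" "g' \<in> F" "h \<in> F" "k \<in> F"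
      and 1: "a \<otimes> f' \<otimes> h = a' \<otimes> f \<otimes> h" and 2: "b \<otimes> g' \<otimes> k = b' \<otimes> g \<otimes> k"
      using tt unfolding frac_def Image_singleton_iff loc_rel_iff by blast
    note c = m(1,3) n(1,3) m(2,4)[THEN F_sub] n(2,4,5,6)[THEN F_sub]
    have "(a \<otimes> b) \<otimes> (f' \<otimes> g') \<otimes> (h \<otimes> k) = (a \<otimes> f' \<otimes> h) \<otimes> (b \<otimes> g' \<otimes> k)"
      using c by (simp add: Q.m_ac)
    also have "\<dots> = (a' \<otimes> b') \<otimes> (f \<otimes> g) \<otimes> (h \<otimes> k)"
      unfolding 1 2 using c by (simp add: Q.m_ac)
    finally have "frac (a \<otimes> b) (f \<otimes> g) = frac (a' \<otimes> b') (f' \<otimes> g')"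
      using m n F_sub by (subst frac_eq) (auto intro!: bexI[of _ "h \<otimes> k"])
    then show ?thesis by (simp add: frac_def)
  qed
  have ne: "(a, f) \<in> frac a f" "(b, g) \<in> frac b g"
    using m equiv_class_self[OF loc_rel_equiv] by (auto simp: frac_def)
  have "frac a f \<otimes>\<^sub>N frac b g =
    (\<Union>(a', f')\<in>frac a f. \<Union>(b', g')\<in>frac b g. loc_rel Q P `` {(a' \<otimes> b', f' \<otimes> g')})"
    by (simp add: loc_monoid_def)
  also have "\<dots> = frac (a \<otimes> b) (f \<otimes> g)"
  proof -
    have "(\<Union>(b', g')\<in>frac b g. loc_rel Q P `` {(a' \<otimes> b', f' \<otimes> g')}) = frac (a \<otimes> b) (f \<otimes> g)"
      if x: "(a', f') \<in> frac a f" for a' f'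
      by (rule UN_constant_eq[OF ne(2)]) (clarify, rule eq[OF x])
    then show ?thesis
      by (intro UN_constant_eq[OF ne(1)]) clarify
  qed
  finally show ?thesis .
qed

lemma N_one: "\<one>\<^sub>N = frac \<one> \<one>"
  by (simp add: loc_monoid_def frac_def)

lemma N_comm_monoid: "comm_monoid N"
  by (rule comm_monoidI)
    (auto simp: carrier_N N_one N_mult F_sub Q.m_ac F_mult, (use F_mult Q.m_closed F_one Q.one_closed in blast)+)

sublocale N: comm_monoid N by (rule N_comm_monoid)

lemma to_loc_frac: "to_loc Q P q = frac q \<one>"
  by (simp add: to_loc_def frac_def)

lemma to_loc_closed [simp, intro]: "q \<in> carrier Q \<Longrightarrow> to_loc Q P q \<in> carrier N"
  by (auto simp: to_loc_frac carrier_N)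

lemma to_loc_mult [simp]: "a \<in> carrier Q \<Longrightarrow> b \<in> carrier Q \<Longrightarrow>
    to_loc Q P (a \<otimes> b) = to_loc Q P a \<otimes>\<^sub>N to_loc Q P b"
  by (simp add: to_loc_frac N_mult)

lemma to_loc_one [simp]: "to_loc Q P \<one> = \<one>\<^sub>N"
  by (simp add: to_loc_frac N_one)

lemma to_loc_eq: "a \<in> carrier Q \<Longrightarrow> b \<in> carrier Q \<Longrightarrow>
    to_loc Q P a = to_loc Q P b \<longleftrightarrow> (\<exists>h\<in>F. h \<otimes> a = h \<otimes> b)"
  unfolding to_loc_frac by (subst frac_eq) (auto simp: F_sub Q.m_comm[of a] Q.m_comm[of b] cong: bex_cong)

lemma to_loc_unit [intro]: assumes f: "f \<in> F" shows "to_loc Q P f \<in> Units N"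
proof -
  have 1: "frac \<one> f \<otimes>\<^sub>N to_loc Q P f = \<one>\<^sub>N"
    using f F_sub[OF f] by (auto simp: to_loc_frac N_mult N_one frac_eq intro!: bexI[of _ "\<one>"])
  have 2: "frac \<one> f \<in> carrier N" using f by (auto simp: carrier_N)
  have 3: "to_loc Q P f \<in> carrier N" using F_sub[OF f] by simp
  then have "to_loc Q P f \<otimes>\<^sub>N frac \<one> f = \<one>\<^sub>N" using 1 N.m_comm[OF 3 2] by simp
  then show ?thesis using 1 2 3 unfolding Units_def by blast
qed

lemma N_cases:
  assumes x: "x \<in> carrier N"
  obtains a f where "a \<in> carrier Q" "f \<in> F" "to_loc Q P f \<otimes>\<^sub>N x = to_loc Q P a"
proof -
  obtain a f where "x = frac a f" "a \<in> carrier Q" "f \<in> F" using x by (auto simp: carrier_N)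
  then show ?thesis using F_sub
    by (intro that[of a f]) (auto simp: to_loc_frac N_mult frac_eq Q.m_ac intro!: bexI[of _ "\<one>"])
qed

lemma common_denominator:
  assumes m: "x \<in> carrier N" "y \<in> carrier N"
  obtains a b u where "a \<in> carrier Q" "b \<in> carrier Q" "u \<in> F"
    "to_loc Q P u \<otimes>\<^sub>N x = to_loc Q P a" "to_loc Q P u \<otimes>\<^sub>N y = to_loc Q P b"
proof -
  obtain a f where af: "a \<in> carrier Q" "f \<in> F" "to_loc Q P f \<otimes>\<^sub>N x = to_loc Q P a" using N_cases[OF m(1)] .
  obtain b e where be: "b \<in> carrier Q" "e \<in> F" "to_loc Q P e \<otimes>\<^sub>N y = to_loc Q P b" using N_cases[OF m(2)] .
  note fe = F_sub[OF af(2)] F_sub[OF be(2)]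
  show ?thesis
  proof (rule that)
    show "to_loc Q P (f \<otimes> e) \<otimes>\<^sub>N x = to_loc Q P (e \<otimes> a)"
      using af(1) fe m af(3)[symmetric] by (simp add: N.m_ac)
    show "to_loc Q P (f \<otimes> e) \<otimes>\<^sub>N y = to_loc Q P (f \<otimes> b)"
      using be(1) fe m be(3)[symmetric] by (simp add: N.m_assoc)
  qed (use af be fe in auto)
qed

text \<open>The numerator of a fraction lies outside P or in P. Conditions on all elements of the
  localization thus split into a case of units and a case of multiples of P.\<close>

lemma N_unit_or_P:
  assumes x: "x \<in> carrier N"
  shows "x \<in> Units N \<or> (\<exists>p\<in>P. \<exists>y\<in>carrier N. x = to_loc Q P p \<otimes>\<^sub>N y)"
proof -
  obtain a f where af: "a \<in> carrier Q" "f \<in> F" "to_loc Q P f \<otimes>\<^sub>N x = to_loc Q P a" using N_cases[OF x] .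
  note u = to_loc_unit[OF af(2)]
  have xa: "x = to_loc Q P a \<otimes>\<^sub>N inv\<^sub>N (to_loc Q P f)"
  proof -
    have "inv\<^sub>N (to_loc Q P f) \<otimes>\<^sub>N (to_loc Q P f \<otimes>\<^sub>N x) = x"
      using u x by (simp add: N.m_assoc[symmetric] N.Units_closed)
    then show ?thesis unfolding af(3) using u af(1) N.m_comm by simp
  qed
  show ?thesis
  proof (cases "a \<in> P")
    case True
    then show ?thesis using xa u by auto
  next
    case False
    then have "a \<in> F" using af by (simp add: F_def)
    then show ?thesis using xa u by (simp add: to_loc_unit N.Units_m_closed)
  qed
qed

end

section \<open>Localized ideals and their congruences\<close>

locale loc_alg = K: field K + localization Q P
  for K :: "('k, 'y) ring_scheme" and Q :: "('q, 'x) monoid_scheme" (structure) and P :: "'q set"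
begin

sublocale monoid_alg_hom K Q "loc_monoid Q P" "to_loc Q P"
  by unfold_locales auto

abbreviation AQ where "AQ \<equiv> monoid_algebra K Q"
abbreviation AN where "AN \<equiv> monoid_algebra K N"
abbreviation times_AN (infixl "\<otimes>\<^sub>A" 70) where "f \<otimes>\<^sub>A g \<equiv> f \<otimes>\<^bsub>AN\<^esub> g"
abbreviation plus_AN (infixl "\<oplus>\<^sub>A" 65) where "f \<oplus>\<^sub>A g \<equiv> f \<oplus>\<^bsub>AN\<^esub> g"
abbreviation zero_AN ("\<zero>\<^sub>A") where "\<zero>\<^sub>A \<equiv> \<zero>\<^bsub>AN\<^esub>"
abbreviation loc where "loc \<equiv> to_loc Q P"

lemma loc_hom_eq: "loc_hom K Q P = push"
  by (simp add: loc_hom_def push_def fun_eq_iff)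

lemma loc_preimage_eq: "loc_preimage K Q P J = pull J"
  by (simp add: loc_preimage_def pull_def loc_hom_eq)

text \<open>\<open>pull_bin\<close> for the zero ideal shows that the kernel is spanned by two-term
  elements. Such an element has c + d = 0 and exponents identified by a shift from \<open>F\<close>,
  or is itself zero; the annihilating monomials of the summands are multiplied.\<close>

lemma kernel:
  assumes g: "g \<in> carrier AQ" and z: "push g = \<zero>\<^sub>A"
  shows "\<exists>h\<in>F. tmono K h \<otimes>\<^bsub>AQ\<^esub> g = \<zero>\<^bsub>AQ\<^esub>"
proof -
  have "cod.bin {\<zero>\<^sub>A}"
    by (rule cod.binI) (auto simp: cod.A.zeroideal cod.bspan.zero)
  then have "dom.bin (pull {\<zero>\<^sub>A})" by (rule pull_bin)
  moreover have "g \<in> pull {\<zero>\<^sub>A}" using g z by (simp add: pull_def)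
  ultimately have "g \<in> dom.bspan (pull {\<zero>\<^sub>A})" by (auto simp: dom.bin_def)
  then show ?thesis
  proof induction
    case zero
    show ?case using F_one by (intro bexI[of _ "\<one>"]) (auto simp: dom.A_mult_zero)
  next
    case (add a b c d f)
    obtain h where h: "h \<in> F" "tmono K h \<otimes>\<^bsub>AQ\<^esub> f = \<zero>\<^bsub>AQ\<^esub>" using add by auto
    have fA: "f \<in> carrier AQ" using dom.bspan_closed[OF add(6)] .
    define t where "t = mterm K c a \<oplus>\<^bsub>AQ\<^esub> mterm K d b"
    have tA: "t \<in> carrier AQ" using add(1-4) by (simp add: t_def)
    have "push t = \<zero>\<^sub>A" using add(5) by (simp add: pull_def t_def)
    then have s: "mterm K c (loc a) \<oplus>\<^sub>A mterm K d (loc b) = \<zero>\<^sub>A"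
      using add(1-4) by (simp add: t_def push_add push_mterm)
    have v: "mterm K c (loc a) x \<oplus>\<^bsub>K\<^esub> mterm K d (loc b) x = \<zero>\<^bsub>K\<^esub>" for x
      using fun_cong[OF s, of x] by (simp add: cod.A_add cod.A_zero)
    have "\<exists>h\<in>F. tmono K h \<otimes>\<^bsub>AQ\<^esub> t = \<zero>\<^bsub>AQ\<^esub>"
    proof (cases "loc a = loc b")
      case True
      then obtain k where k: "k \<in> F" "k \<otimes> a = k \<otimes> b" using add(1,2) to_loc_eq by auto
      have "c \<oplus>\<^bsub>K\<^esub> d = \<zero>\<^bsub>K\<^esub>" using v[of "loc a"] True by (simp add: mterm_def)
      then have "tmono K k \<otimes>\<^bsub>AQ\<^esub> t = \<zero>\<^bsub>AQ\<^esub>"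
        using k add(1-4) F_sub by (simp add: t_def dom.mterm_mult_two dom.mterm_add)
      then show ?thesis using k by auto
    next
      case False
      then have "c = \<zero>\<^bsub>K\<^esub>" "d = \<zero>\<^bsub>K\<^esub>" using v[of "loc a"] v[of "loc b"] add(3,4) by (auto simp: mterm_def)
      then show ?thesis using F_one by (intro bexI[of _ "\<one>"]) (auto simp: t_def dom.A_mult_zero)
    qed
    then obtain k where k: "k \<in> F" "tmono K k \<otimes>\<^bsub>AQ\<^esub> t = \<zero>\<^bsub>AQ\<^esub>" by auto
    note hk = F_sub[OF h(1)] F_sub[OF k(1)]
    have "tmono K (h \<otimes> k) \<otimes>\<^bsub>AQ\<^esub> (t \<oplus>\<^bsub>AQ\<^esub> f) =
      tmono K h \<otimes>\<^bsub>AQ\<^esub> (tmono K k \<otimes>\<^bsub>AQ\<^esub> t) \<oplus>\<^bsub>AQ\<^esub> tmono K k \<otimes>\<^bsub>AQ\<^esub> (tmono K h \<otimes>\<^bsub>AQ\<^esub> f)"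
      using hk fA tA by (simp add: dom.A_r_distr dom.A_assoc[symmetric] dom.mterm_mult Q.m_comm)
    then have "tmono K (h \<otimes> k) \<otimes>\<^bsub>AQ\<^esub> (t \<oplus>\<^bsub>AQ\<^esub> f) = \<zero>\<^bsub>AQ\<^esub>"
      using hk h k by (simp add: dom.A_mult_zero)
    then show ?case using F_mult[OF h(1) k(1)] by (auto simp: t_def)
  qed
qed

abbreviation LI where "LI \<equiv> loc_ideal K Q P"

lemma LI_ideal: assumes I: "ideal I AQ" shows "ideal (LI I) AN" and "push ` I \<subseteq> LI I"
proof -
  have s: "push ` I \<subseteq> carrier AN" using dom.ideal_facts(1)[OF I] by auto
  show "ideal (LI I) AN" "push ` I \<subseteq> LI I"
    unfolding loc_ideal_def loc_hom_eq
    using cod.A.genideal_ideal[OF s] cod.A.genideal_self[OF s] by auto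
qed

lemma LI_minimal: "ideal I AQ \<Longrightarrow> ideal J AN \<Longrightarrow> push ` I \<subseteq> J \<Longrightarrow> LI I \<subseteq> J"
  unfolding loc_ideal_def loc_hom_eq by (rule cod.A.genideal_minimal)

lemma LI_bin: assumes b: "dom.bin I" shows "cod.bin (LI I)"
proof (rule cod.binI)
  have I: "ideal I AQ" using b by (rule dom.bin_ideal)
  show J: "ideal (LI I) AN" by (rule LI_ideal[OF I])
  note sub = LI_ideal(2)[OF I]
  have "push f \<in> cod.bspan (LI I)" if "f \<in> dom.bspan I" for f
    using that
  proof induction
    case zero then show ?case by (simp add: cod.bspan.zero)
  next
    case (add a b c d f)
    have "push (mterm K c a \<oplus>\<^bsub>AQ\<^esub> mterm K d b) \<in> LI I" using add(5) sub by auto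
    then show ?case using add dom.bspan_closed[OF add(6)]
      by (simp add: push_add push_mterm cod.bspan.add)
  qed
  then show "LI I \<subseteq> cod.bspan (LI I)"
    using b cod.bspan_ideal[OF J] by (intro LI_minimal[OF I]) (auto simp: dom.bin_def)
qed

text \<open>Denominators can be cleared: the elements that some monomial from outside P moves into
  the image of \<open>I\<close> are closed under sums and under terms of the localized algebra, and
  the monomial used is a unit there.\<close>

lemma LI_iff:
  assumes I: "ideal I AQ"
  shows "G \<in> LI I \<longleftrightarrow> G \<in> carrier AN \<and> (\<exists>h\<in>F. \<exists>g\<in>I. tmono K (loc h) \<otimes>\<^sub>A G = push g)"
proof
  define S where "S = {G \<in> carrier AN. \<exists>h\<in>F. \<exists>g\<in>I. tmono K (loc h) \<otimes>\<^sub>A G = push g}"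
  note If = dom.ideal_facts[OF I]
  have "ideal S AN"
  proof (rule cod.ideal_intro)
    show "S \<subseteq> carrier AN" by (auto simp: S_def)
    show "\<zero>\<^sub>A \<in> S" using If(2) F_one F_sub
      by (auto simp: S_def cod.A_mult_zero intro!: bexI[of _ "\<one>"] bexI[of _ "\<zero>\<^bsub>AQ\<^esub>"])
  next
    fix G G' assume "G \<in> S" "G' \<in> S"
    then obtain h g h' g' where m: "G \<in> carrier AN" "G' \<in> carrier AN" "h \<in> F" "h' \<in> F" "g \<in> I" "g' \<in> I"
      and 1: "tmono K (loc h) \<otimes>\<^sub>A G = push g" and 2: "tmono K (loc h') \<otimes>\<^sub>A G' = push g'"
      by (auto simp: S_def)
    have c: "h \<in> carrier Q" "h' \<in> carrier Q" "g \<in> carrier AQ" "g' \<in> carrier AQ" using m F_sub If(1) by auto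
    have e: "tmono K (loc (h \<otimes> h')) = tmono K (loc h') \<otimes>\<^sub>A tmono K (loc h)"
      "tmono K (loc (h \<otimes> h')) = tmono K (loc h) \<otimes>\<^sub>A tmono K (loc h')"
      using c by (simp_all add: cod.mterm_mult N.m_comm)
    have "tmono K (loc (h \<otimes> h')) \<otimes>\<^sub>A G = push (tmono K h' \<otimes>\<^bsub>AQ\<^esub> g)"
      unfolding e(1) using c m 1 by (simp add: cod.A_assoc push_mult push_mterm)
    moreover have "tmono K (loc (h \<otimes> h')) \<otimes>\<^sub>A G' = push (tmono K h \<otimes>\<^bsub>AQ\<^esub> g')"
      unfolding e(2) using c m 2 by (simp add: cod.A_assoc push_mult push_mterm)
    ultimately have "tmono K (loc (h \<otimes> h')) \<otimes>\<^sub>A (G \<oplus>\<^sub>A G') = push (tmono K h' \<otimes>\<^bsub>AQ\<^esub> g \<oplus>\<^bsub>AQ\<^esub> tmono K h \<otimes>\<^bsub>AQ\<^esub> g')"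
      using c m by (simp add: cod.A_r_distr push_add del: to_loc_mult)
    moreover have "tmono K h' \<otimes>\<^bsub>AQ\<^esub> g \<oplus>\<^bsub>AQ\<^esub> tmono K h \<otimes>\<^bsub>AQ\<^esub> g' \<in> I"
      using If c m by (intro If(3) If(6)) auto
    ultimately show "G \<oplus>\<^sub>A G' \<in> S"
      using m F_mult[OF m(3,4)] unfolding S_def by blast
  next
    fix c x G assume c: "c \<in> carrier K" and x: "x \<in> carrier N" and "G \<in> S"
    then obtain h g where m: "G \<in> carrier AN" "h \<in> F" "g \<in> I"
      and 1: "tmono K (loc h) \<otimes>\<^sub>A G = push g"
      by (auto simp: S_def)
    obtain a f where af: "a \<in> carrier Q" "f \<in> F" "loc f \<otimes>\<^sub>N x = loc a" using N_cases[OF x] .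
    have cc: "h \<in> carrier Q" "f \<in> carrier Q" "g \<in> carrier AQ" using m af F_sub If(1) by auto
    have "tmono K (loc (f \<otimes> h)) \<otimes>\<^sub>A (mterm K c x \<otimes>\<^sub>A G)
      = (tmono K (loc f) \<otimes>\<^sub>A mterm K c x) \<otimes>\<^sub>A (tmono K (loc h) \<otimes>\<^sub>A G)"
    proof -
      have "tmono K (loc (f \<otimes> h)) = tmono K (loc f) \<otimes>\<^sub>A tmono K (loc h)"
        using cc by (simp add: cod.mterm_mult)
      then show ?thesis using cc c x m(1) by (simp add: cod.A.m_ac)
    qed
    also have "tmono K (loc f) \<otimes>\<^sub>A mterm K c x = mterm K c (loc a)"
      using cc c x af by (simp add: cod.mterm_mult)
    finally have "tmono K (loc (f \<otimes> h)) \<otimes>\<^sub>A (mterm K c x \<otimes>\<^sub>A G) = push (mterm K c a \<otimes>\<^bsub>AQ\<^esub> g)"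
      unfolding 1 using cc c af(1) by (simp add: push_mult push_mterm)
    moreover have "mterm K c a \<otimes>\<^bsub>AQ\<^esub> g \<in> I" using If(6)[OF m(3)] c af(1) by simp
    ultimately show "mterm K c x \<otimes>\<^sub>A G \<in> S"
      using m(1) c x F_mult[OF af(2) m(2)] unfolding S_def by blast
  qed
  moreover have "push ` I \<subseteq> S"
  proof
    fix G assume "G \<in> push ` I"
    then obtain g where g: "g \<in> I" "G = push g" by auto
    then have "tmono K (loc \<one>) \<otimes>\<^sub>A G = push g" "G \<in> carrier AN"
      using If(1) cod.A_one_mult[of G] by (auto simp: cod.A_one)
    then show "G \<in> S" using g F_one unfolding S_def by blast
  qed
  ultimately have "LI I \<subseteq> S" using LI_minimal[OF I] by blast
  then show "G \<in> LI I \<Longrightarrow> G \<in> carrier AN \<and> (\<exists>h\<in>F. \<exists>g\<in>I. tmono K (loc h) \<otimes>\<^sub>A G = push g)"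
    by (auto simp: S_def)
  show "G \<in> LI I" if G: "G \<in> carrier AN \<and> (\<exists>h\<in>F. \<exists>g\<in>I. tmono K (loc h) \<otimes>\<^sub>A G = push g)"
  proof -
    obtain h g where m: "h \<in> F" "g \<in> I" "tmono K (loc h) \<otimes>\<^sub>A G = push g" using G by auto
    show ?thesis
      by (rule cod.unit_binomial_cancel[OF LI_ideal(1)[OF I] to_loc_unit[OF m(1)]])
        (use G m LI_ideal(2)[OF I] in auto)
  qed
qed

text \<open>Clearing denominators gives t^h g and some \<open>g'\<close> in \<open>I\<close> with
  equal images. They may still differ by an element of the kernel, which a further monomial from
  outside P annihilates.\<close>

lemma push_LI_iff:
  assumes I: "ideal I AQ" and g: "g \<in> carrier AQ"
  shows "push g \<in> LI I \<longleftrightarrow> (\<exists>h\<in>F. tmono K h \<otimes>\<^bsub>AQ\<^esub> g \<in> I)"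
proof
  note If = dom.ideal_facts[OF I]
  assume "push g \<in> LI I"
  then obtain h g' where m: "h \<in> F" "g' \<in> I" "tmono K (loc h) \<otimes>\<^sub>A push g = push g'"
    using LI_iff[OF I] by auto
  have c: "h \<in> carrier Q" "g' \<in> carrier AQ" using m F_sub If(1) by auto
  define d where "d = tmono K h \<otimes>\<^bsub>AQ\<^esub> g \<ominus>\<^bsub>AQ\<^esub> g'"
  have d: "d \<in> carrier AQ" using c g by (simp add: d_def)
  have de: "d \<oplus>\<^bsub>AQ\<^esub> g' = tmono K h \<otimes>\<^bsub>AQ\<^esub> g"
    using c g by (simp add: d_def a_minus_def dom.A.a_assoc dom.A.l_neg)
  have "push d \<oplus>\<^sub>A push g' = push g'"
    using arg_cong[OF de, of push] d c g m(3) by (simp add: push_add push_mult push_mterm)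
  then have "push d = \<zero>\<^sub>A" using d c by (metis cod.A.add.l_cancel_one cod.A.a_comm push_closed)
  then obtain k where k: "k \<in> F" "tmono K k \<otimes>\<^bsub>AQ\<^esub> d = \<zero>\<^bsub>AQ\<^esub>" using kernel[OF d] by auto
  have kc: "k \<in> carrier Q" using k F_sub by auto
  have "tmono K (k \<otimes> h) \<otimes>\<^bsub>AQ\<^esub> g = tmono K k \<otimes>\<^bsub>AQ\<^esub> (tmono K h \<otimes>\<^bsub>AQ\<^esub> g)"
    using kc c g by (simp add: dom.A_assoc[symmetric] dom.mterm_mult)
  also have "\<dots> = tmono K k \<otimes>\<^bsub>AQ\<^esub> g'"
    unfolding de[symmetric] using kc c d k by (simp add: dom.A_r_distr)
  also have "\<dots> \<in> I" using If(6)[OF m(2)] kc by simp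
  finally show "\<exists>h\<in>F. tmono K h \<otimes>\<^bsub>AQ\<^esub> g \<in> I" using F_mult[OF k(1) m(1)] by auto
next
  assume "\<exists>h\<in>F. tmono K h \<otimes>\<^bsub>AQ\<^esub> g \<in> I"
  then obtain h where h: "h \<in> F" "tmono K h \<otimes>\<^bsub>AQ\<^esub> g \<in> I" by auto
  then have "tmono K (loc h) \<otimes>\<^sub>A push g = push (tmono K h \<otimes>\<^bsub>AQ\<^esub> g)"
    using F_sub g by (simp add: push_mult push_mterm)
  then show "push g \<in> LI I" using LI_iff[OF I] h g by blast
qed

lemma binomial_one_mult:
  assumes "c \<in> carrier K" "u \<in> carrier N" "q \<in> carrier N"
  shows "binomial K N u c \<one>\<^sub>N \<otimes>\<^sub>A tmono K q = binomial K N (u \<otimes>\<^sub>N q) c q"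
  using assms cod.A_comm[of "binomial K N u c \<one>\<^sub>N" "tmono K q"]
  by (simp add: cod.tmono_mult_binomial N.m_comm)

text \<open>The congruence \<open>r0\<close> makes the intersected family nonempty; this is what
  keeps the intersection inside the square of the carrier.\<close>

lemma gen_cong_is_cong:
  assumes S: "S \<subseteq> r0" and r0: "monoid_cong N r0"
  shows "monoid_cong N (gen_cong N S)"
proof -
  define G where "G = \<Inter>{r. monoid_cong N r \<and> S \<subseteq> r}"
  have "monoid_cong N G"
    unfolding monoid_cong_def
  proof (intro conjI equivI)
    show "G \<subseteq> carrier N \<times> carrier N" using S r0 by (auto simp: G_def monoid_cong_def equiv_def)
    show "refl_on (carrier N) G" by (auto simp: G_def refl_on_def monoid_cong_def equiv_def)
    show "sym G" by (rule symI) (auto simp: G_def monoid_cong_def equiv_def dest: symD)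
    show "trans G" by (rule transI) (auto simp: G_def monoid_cong_def equiv_def dest: transD)
    have "(a \<otimes>\<^sub>N c, b \<otimes>\<^sub>N c) \<in> r" if "monoid_cong N r" "(a, b) \<in> r" "c \<in> carrier N" for r a b c
      using that unfolding monoid_cong_def by blast
    then show "\<forall>(a, b)\<in>G. \<forall>c\<in>carrier N. (a \<otimes>\<^sub>N c, b \<otimes>\<^sub>N c) \<in> G"
      unfolding G_def by blast
  qed
  then show ?thesis by (simp add: G_def gen_cong_def)
qed

text \<open>A binomial of the localized ideal becomes one of \<open>I\<close> after a common
  denominator \<open>f\<close> and a further \<open>h\<close> are multiplied in; its exponents are
  then related by a generator of the congruence, and the unit h + f is cancelled. With this,
  \<open>loc_bar\<close> and \<open>stab\<close> turn into questions about membership in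
  \<open>LI I\<close>.\<close>

lemma loc_cong_eq:
  assumes I: "ideal I AQ"
  shows "loc_cong Q P (ideal_cong K Q I) = ideal_cong K N (LI I)"
proof
  let ?S = "{(loc a, loc b) |a b. (a, b) \<in> ideal_cong K Q I}"
  have J: "ideal (LI I) AN" by (rule LI_ideal[OF I])
  have c: "monoid_cong N (ideal_cong K N (LI I))" by (rule cod.cong_monoid_cong[OF J])
  have S: "?S \<subseteq> ideal_cong K N (LI I)"
  proof clarify
    fix a b assume "(a, b) \<in> ideal_cong K Q I"
    then obtain c where "a \<in> carrier Q" "b \<in> carrier Q" "c \<in> carrier K" "c \<noteq> \<zero>\<^bsub>K\<^esub>" "binomial K Q a c b \<in> I"
      by (rule dom.congE)
    moreover from this have "binomial K N (loc a) c (loc b) \<in> LI I"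
      using LI_ideal(2)[OF I] push_binomial[of c a b] by force
    ultimately show "(loc a, loc b) \<in> ideal_cong K N (LI I)" by (intro cod.congI[of _ _ c]) auto
  qed
  show "loc_cong Q P (ideal_cong K Q I) \<subseteq> ideal_cong K N (LI I)"
    unfolding loc_cong_def gen_cong_def using S c by blast
  have g: "monoid_cong N (gen_cong N ?S)" by (rule gen_cong_is_cong[OF S c])
  have sub: "?S \<subseteq> gen_cong N ?S" unfolding gen_cong_def by blast
  show "ideal_cong K N (LI I) \<subseteq> loc_cong Q P (ideal_cong K Q I)"
  proof clarify
    fix x y assume "(x, y) \<in> ideal_cong K N (LI I)"
    then obtain c where xy: "x \<in> carrier N" "y \<in> carrier N" and c: "c \<in> carrier K" "c \<noteq> \<zero>\<^bsub>K\<^esub>" "binomial K N x c y \<in> LI I"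
      by (rule cod.congE)
    obtain a b f where ab: "a \<in> carrier Q" "b \<in> carrier Q" and f: "f \<in> F"
      and 1: "loc f \<otimes>\<^sub>N x = loc a" and 2: "loc f \<otimes>\<^sub>N y = loc b" using common_denominator[OF xy] .
    have fQ: "f \<in> carrier Q" using f F_sub by auto
    have "push (binomial K Q a c b) \<in> LI I"
      using cod.binomial_mult[OF J xy _ c(1,3), of "loc f"] fQ ab c(1) by (simp add: 1 2 push_binomial)
    then obtain h where h: "h \<in> F" "tmono K h \<otimes>\<^bsub>AQ\<^esub> binomial K Q a c b \<in> I"
      using push_LI_iff[OF I] c ab by auto
    have hc: "h \<in> carrier Q" using h F_sub by auto
    have "(h \<otimes> a, h \<otimes> b) \<in> ideal_cong K Q I"
      by (rule dom.congI[of _ _ c]) (use h hc c ab in \<open>auto simp: dom.tmono_mult_binomial\<close>)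
    then have "(loc (h \<otimes> a), loc (h \<otimes> b)) \<in> gen_cong N ?S" using sub by blast
    then have k: "(loc (h \<otimes> f) \<otimes>\<^sub>N x, loc (h \<otimes> f) \<otimes>\<^sub>N y) \<in> gen_cong N ?S"
      using 1 2 hc fQ ab xy by (simp add: N.m_assoc)
    define u where "u = loc (h \<otimes> f)"
    have u: "u \<in> Units N" unfolding u_def using h f by auto
    have ui: "(u \<otimes>\<^sub>N z) \<otimes>\<^sub>N inv\<^sub>N u = z" if "z \<in> carrier N" for z
    proof -
      have "(u \<otimes>\<^sub>N z) \<otimes>\<^sub>N inv\<^sub>N u = (u \<otimes>\<^sub>N inv\<^sub>N u) \<otimes>\<^sub>N z"
        using u that N.Units_closed[OF u] N.Units_inv_closed[OF u] by (simp only: N.m_ac N.m_closed)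
      then show ?thesis using u that by simp
    qed
    have "((u \<otimes>\<^sub>N x) \<otimes>\<^sub>N inv\<^sub>N u, (u \<otimes>\<^sub>N y) \<otimes>\<^sub>N inv\<^sub>N u) \<in> gen_cong N ?S"
      using k g u unfolding u_def[symmetric] monoid_cong_def by blast
    then show "(x, y) \<in> loc_cong Q P (ideal_cong K Q I)"
      using ui xy by (simp add: loc_cong_def)
  qed
qed

end

section \<open>Quotients by congruences\<close>

lemma (in comm_monoid) ideal_of_eq:
  assumes q: "q \<in> carrier G" shows "ideal_of G q = {q \<otimes> x |x. x \<in> carrier G}"
proof
  have "monoid_ideal G {q \<otimes> x |x. x \<in> carrier G}"
    unfolding monoid_ideal_def using q by (auto simp: m_assoc)
  moreover have "q \<in> {q \<otimes> x |x. x \<in> carrier G}" using q r_one[OF q] by (metis (mono_tags, lifting) CollectI one_closed)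
  ultimately show "ideal_of G q \<subseteq> {q \<otimes> x |x. x \<in> carrier G}"
    unfolding ideal_of_def by blast
  show "{q \<otimes> x |x. x \<in> carrier G} \<subseteq> ideal_of G q"
    unfolding ideal_of_def monoid_ideal_def by blast
qed

lemma (in comm_monoid) green_le_iff:
  assumes a: "a \<in> carrier G" "b \<in> carrier G" shows "green_le G a b \<longleftrightarrow> b \<in> ideal_of G a"
proof
  have "b \<in> ideal_of G b" by (auto simp: ideal_of_def)
  then show "green_le G a b \<Longrightarrow> b \<in> ideal_of G a" by (auto simp: green_le_def)
  show "b \<in> ideal_of G a \<Longrightarrow> green_le G a b"
    using a by (auto simp: green_le_def ideal_of_eq m_assoc)
qed

locale cong_monoid = M: comm_monoid M for M :: "('q, 'x) monoid_scheme" (structure) +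
  fixes r :: "('q \<times> 'q) set"
  assumes cong: "monoid_cong M r"
begin

abbreviation R where "R \<equiv> quot_monoid M r"

lemma equiv: "equiv (carrier M) r" using cong by (simp add: monoid_cong_def)

lemma r_mult: "(a, b) \<in> r \<Longrightarrow> c \<in> carrier M \<Longrightarrow> (a \<otimes> c, b \<otimes> c) \<in> r"
  using cong by (auto simp: monoid_cong_def)

lemma r_carrier: "(a, b) \<in> r \<Longrightarrow> a \<in> carrier M \<and> b \<in> carrier M"
  using equiv by (auto simp: equiv_def)

lemma r_refl: "a \<in> carrier M \<Longrightarrow> (a, a) \<in> r" using equiv by (auto simp: equiv_def refl_on_def)
lemma r_sym: "(a, b) \<in> r \<Longrightarrow> (b, a) \<in> r" using equiv by (auto simp: equiv_def dest: symD)
lemma r_trans: "(a, b) \<in> r \<Longrightarrow> (b, c) \<in> r \<Longrightarrow> (a, c) \<in> r" using equiv by (auto simp: equiv_def dest: transD)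

lemma class_eq: "a \<in> carrier M \<Longrightarrow> b \<in> carrier M \<Longrightarrow> r `` {a} = r `` {b} \<longleftrightarrow> (a, b) \<in> r"
  using eq_equiv_class_iff[OF equiv] by simp

lemma class_mult:
  assumes m: "a \<in> carrier M" "b \<in> carrier M"
  shows "r `` {a} \<otimes>\<^bsub>R\<^esub> r `` {b} = r `` {a \<otimes> b}"
proof -
  have 1: "r `` {a' \<otimes> b'} = r `` {a \<otimes> b}" if t: "(a, a') \<in> r" "(b, b') \<in> r" for a' b'
  proof -
    have c: "a' \<in> carrier M" "b' \<in> carrier M" using t r_carrier by auto
    have "(a' \<otimes> b', a \<otimes> b') \<in> r" using r_mult[OF r_sym[OF t(1)] c(2)] .
    moreover have "(a \<otimes> b', a \<otimes> b) \<in> r"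
      using r_mult[OF r_sym[OF t(2)] m(1)] m c by (simp add: M.m_comm)
    ultimately have "(a' \<otimes> b', a \<otimes> b) \<in> r" by (rule r_trans)
    then show ?thesis using class_eq m c by auto
  qed
  have 2: "(\<Union>b'\<in>r `` {b}. r `` {a' \<otimes> b'}) = r `` {a \<otimes> b}" if "a' \<in> r `` {a}" for a'
    by (rule UN_constant_eq[of b]) (use that r_refl[OF m(2)] 1[of a'] in auto)
  show ?thesis unfolding quot_monoid_def monoid.simps partial_object.simps
    by (rule UN_constant_eq[of a]) (use r_refl[OF m(1)] 2 in auto)
qed

lemma R_carrier: "carrier R = {r `` {a} |a. a \<in> carrier M}"
  by (auto simp: quot_monoid_def quotient_def)

lemma class_closed [simp, intro]: "a \<in> carrier M \<Longrightarrow> r `` {a} \<in> carrier R"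
  by (auto simp: R_carrier)

lemma R_one: "\<one>\<^bsub>R\<^esub> = r `` {\<one>}" by (simp add: quot_monoid_def)

lemma R_comm_monoid: "comm_monoid R"
proof (rule comm_monoidI)
  show "\<one>\<^bsub>R\<^esub> \<in> carrier R" by (simp add: R_one class_closed)
  fix x y assume "x \<in> carrier R" "y \<in> carrier R"
  then obtain a b where ab: "a \<in> carrier M" "x = r `` {a}" "b \<in> carrier M" "y = r `` {b}" by (auto simp: R_carrier)
  show "x \<otimes>\<^bsub>R\<^esub> y \<in> carrier R" using ab by (simp add: class_mult class_closed)
  show "x \<otimes>\<^bsub>R\<^esub> y = y \<otimes>\<^bsub>R\<^esub> x" using ab by (simp add: class_mult M.m_comm)
  show "\<one>\<^bsub>R\<^esub> \<otimes>\<^bsub>R\<^esub> x = x" using ab by (simp add: class_mult R_one)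
  fix z assume "z \<in> carrier R"
  then obtain c where c: "c \<in> carrier M" "z = r `` {c}" by (auto simp: R_carrier)
  show "x \<otimes>\<^bsub>R\<^esub> y \<otimes>\<^bsub>R\<^esub> z = x \<otimes>\<^bsub>R\<^esub> (y \<otimes>\<^bsub>R\<^esub> z)" using ab c by (simp add: class_mult M.m_assoc)
qed

sublocale R: comm_monoid R by (rule R_comm_monoid)

lemma class_in_ideal_of:
  assumes m: "a \<in> carrier M" "b \<in> carrier M"
  shows "r `` {a} \<in> ideal_of R (r `` {b}) \<longleftrightarrow> (\<exists>z\<in>carrier M. (a, b \<otimes> z) \<in> r)"
proof -
  have "r `` {a} \<in> ideal_of R (r `` {b}) \<longleftrightarrow> (\<exists>z\<in>carrier M. r `` {a} = r `` {b} \<otimes>\<^bsub>R\<^esub> r `` {z})"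
    unfolding R.ideal_of_eq[OF class_closed[OF m(2)]] by (auto simp: R_carrier)
  also have "\<dots> \<longleftrightarrow> (\<exists>z\<in>carrier M. (a, b \<otimes> z) \<in> r)"
    using m by (auto simp: class_mult class_eq)
  finally show ?thesis .
qed

lemma class_green_less:
  assumes m: "a \<in> carrier M" "b \<in> carrier M"
  shows "green_less R (r `` {a}) (r `` {b}) \<longleftrightarrow>
    (\<exists>z\<in>carrier M. (b, a \<otimes> z) \<in> r) \<and> \<not> (\<exists>z\<in>carrier M. (a, b \<otimes> z) \<in> r)"
  using m by (simp add: green_less_def R.green_le_iff class_in_ideal_of)

lemma class_is_nil:
  assumes m: "a \<in> carrier M"
  shows "is_nil R (r `` {a}) \<longleftrightarrow> (\<forall>b\<in>carrier M. (a \<otimes> b, a) \<in> r)"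
proof -
  have "is_nil R (r `` {a}) \<longleftrightarrow> (\<forall>b\<in>carrier M. r `` {a} \<otimes>\<^bsub>R\<^esub> r `` {b} = r `` {a})"
    using m by (auto simp: is_nil_def R_carrier)
  then show ?thesis using m by (simp add: class_mult class_eq)
qed

lemma class_cancellative:
  assumes m: "c \<in> carrier M"
  shows "cancellative R (r `` {c}) \<longleftrightarrow>
    (\<forall>a\<in>carrier M. \<forall>b\<in>carrier M. (a \<otimes> c, b \<otimes> c) \<in> r \<longrightarrow> (a, b) \<in> r)"
proof -
  have "cancellative R (r `` {c}) \<longleftrightarrow>
    (\<forall>a\<in>carrier M. \<forall>b\<in>carrier M. r `` {a} \<otimes>\<^bsub>R\<^esub> r `` {c} = r `` {b} \<otimes>\<^bsub>R\<^esub> r `` {c} \<longrightarrow> r `` {a} = r `` {b})"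
    using m by (auto simp: cancellative_def R_carrier)
  then show ?thesis using m by (simp add: class_mult class_eq)
qed

lemma class_pow: "a \<in> carrier M \<Longrightarrow> r `` {a} [^]\<^bsub>R\<^esub> (n::nat) = r `` {a [^] n}"
  by (induction n) (auto simp: R_one class_mult)

end

lemma (in loc_alg) bar_in_ideal_of:
  assumes I: "ideal I' AQ" and m: "a \<in> carrier Q" "b \<in> carrier Q"
  shows "loc_bar Q P (ideal_cong K Q I') a \<in> ideal_of (loc_quot Q P (ideal_cong K Q I')) (loc_bar Q P (ideal_cong K Q I') b)
    \<longleftrightarrow> (\<exists>z\<in>carrier N. (loc a, loc b \<otimes>\<^sub>N z) \<in> ideal_cong K N (LI I'))"
proof -
  interpret c: cong_monoid N "ideal_cong K N (LI I')"
    by unfold_locales (rule cod.cong_monoid_cong[OF LI_ideal(1)[OF I]])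
  show ?thesis unfolding loc_bar_def loc_quot_def loc_cong_eq[OF I]
    using m by (simp add: c.class_in_ideal_of)
qed

section \<open>Finitely generated monoids\<close>

text \<open>Some subsequence is monotone. If it decreases, it is constant from an index with minimal
  value on.\<close>

lemma nat_seq_mono_subseq: "\<exists>\<phi>::nat \<Rightarrow> nat. strict_mono \<phi> \<and> mono (\<lambda>n. (s (\<phi> n) :: nat))"
proof -
  obtain f :: "nat \<Rightarrow> nat" where f: "strict_mono f" "monoseq (\<lambda>n. s (f n))" using seq_monosub[of s] by auto
  show ?thesis
  proof (cases "\<forall>m n. m \<le> n \<longrightarrow> s (f m) \<le> s (f n)")
    case True
    then show ?thesis using f by (auto simp: mono_def)
  next
    case False
    then have dec: "s (f n) \<le> s (f m)" if "m \<le> n" for m n using f(2) that by (auto simp: monoseq_def)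
    obtain n0 where n0: "\<And>n. s (f n0) \<le> s (f n)" using ex_has_least_nat[of "\<lambda>_. True" _ "\<lambda>n. s (f n)"] by auto
    have "s (f (n0 + n)) = s (f n0)" for n using dec[of n0 "n0 + n"] n0[of "n0 + n"] by simp
    moreover have "strict_mono (\<lambda>n. f (n0 + n))" using f(1) by (auto simp: strict_mono_def)
    ultimately show ?thesis by (intro exI[of _ "\<lambda>n. f (n0 + n)"]) (simp add: mono_def)
  qed
qed

text \<open>Coordinates are treated one after the other: passing to a further subsequence keeps the
  coordinates already treated monotone.\<close>

lemma dickson_subseq:
  fixes e :: "nat \<Rightarrow> 's \<Rightarrow> nat"
  assumes "finite S"
  shows "\<exists>\<phi>::nat \<Rightarrow> nat. strict_mono \<phi> \<and> (\<forall>s\<in>S. mono (\<lambda>n. e (\<phi> n) s))"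
  using assms
proof (induction S rule: finite_induct)
  case empty
  show ?case by (rule exI[of _ id]) (simp add: strict_mono_def)
next
  case (insert x S)
  then obtain \<phi> :: "nat \<Rightarrow> nat" where p: "strict_mono \<phi>" "\<forall>s\<in>S. mono (\<lambda>n. e (\<phi> n) s)"
    by blast
  obtain \<psi> :: "nat \<Rightarrow> nat" where q: "strict_mono \<psi>" "mono (\<lambda>n. e (\<phi> (\<psi> n)) x)"
    using nat_seq_mono_subseq[of "\<lambda>n. e (\<phi> n) x"] by auto
  have "mono (\<lambda>n. e (\<phi> (\<psi> n)) s)" if "s \<in> S" for s
    using p(2) that strict_mono_mono[OF q(1)] by (auto simp: mono_def)
  moreover have "strict_mono (\<lambda>n. \<phi> (\<psi> n))" using p(1) q(1) by (auto simp: strict_mono_def)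
  ultimately show ?case using q(2) by (intro exI[of _ "\<lambda>n. \<phi> (\<psi> n)"]) auto
qed

context comm_monoid
begin

lemma fin_gen_monoid_induct:
  assumes g: "\<Inter>{H. submonoid H G \<and> S \<subseteq> H} = carrier G" and S: "S \<subseteq> carrier G"
    and one: "Pr \<one>" and gen: "\<And>s. s \<in> S \<Longrightarrow> Pr s"
    and mult: "\<And>a b. a \<in> carrier G \<Longrightarrow> b \<in> carrier G \<Longrightarrow> Pr a \<Longrightarrow> Pr b \<Longrightarrow> Pr (a \<otimes> b)"
    and q: "q \<in> carrier G"
  shows "Pr q"
proof -
  have "submonoid {q \<in> carrier G. Pr q} G"
    by (rule submonoid.intro) (use one mult in auto)
  then have "carrier G \<subseteq> {q \<in> carrier G. Pr q}" using g gen S by blast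
  then show ?thesis using q by blast
qed

lemma fin_gen_exponents:
  assumes g: "\<Inter>{H. submonoid H G \<and> S \<subseteq> H} = carrier G" and S: "finite S" "S \<subseteq> carrier G"
    and q: "q \<in> carrier G"
  shows "\<exists>e::'a \<Rightarrow> nat. q = (\<Otimes>s\<in>S. s [^] e s)"
proof (rule fin_gen_monoid_induct[OF g S(2) _ _ _ q])
  show "\<exists>e::'a \<Rightarrow> nat. \<one> = (\<Otimes>s\<in>S. s [^] e s)"
    by (rule exI[of _ "\<lambda>_. 0"]) simp
  show "\<exists>e::'a \<Rightarrow> nat. s = (\<Otimes>s\<in>S. s [^] e s)" if s: "s \<in> S" for s
  proof (rule exI[of _ "\<lambda>x. if s = x then 1 else 0"])
    have "(\<Otimes>x\<in>S. x [^] (if s = x then 1 else 0 :: nat)) = (\<Otimes>x\<in>S. if s = x then x else \<one>)"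
      by (rule finprod_cong') (use S in auto)
    also have "\<dots> = s" using finprod_singleton[OF s S(1), of "\<lambda>x. x"] S by auto
    finally show "s = (\<Otimes>x\<in>S. x [^] (if s = x then 1 else 0 :: nat))" by simp
  qed
  fix a b assume "\<exists>e::'a \<Rightarrow> nat. a = (\<Otimes>s\<in>S. s [^] e s)" "\<exists>e::'a \<Rightarrow> nat. b = (\<Otimes>s\<in>S. s [^] e s)"
  then obtain e e' :: "'a \<Rightarrow> nat" where e: "a = (\<Otimes>s\<in>S. s [^] e s)" "b = (\<Otimes>s\<in>S. s [^] e' s)" by auto
  have "(\<Otimes>s\<in>S. s [^] (e s + e' s)) = a \<otimes> b"
    unfolding e by (rule trans[OF finprod_cong' finprod_multf]) (use S in \<open>auto simp: nat_pow_mult\<close>)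
  then show "\<exists>e::'a \<Rightarrow> nat. a \<otimes> b = (\<Otimes>s\<in>S. s [^] e s)" by (intro exI[of _ "\<lambda>s. e s + e' s"]) simp
qed

text \<open>Dickson's lemma for exponent vectors with respect to a finite generating set. The
  exponents of an element are not unique; any choice will do.\<close>

lemma dickson:
  assumes fg: "fin_gen_monoid G" and x: "\<And>n. x n \<in> carrier G"
  shows "\<exists>i j :: nat. i < j \<and> (\<exists>y\<in>carrier G. x j = x i \<otimes> y)"
proof -
  obtain S where S: "finite S" "S \<subseteq> carrier G" "\<Inter>{H. submonoid H G \<and> S \<subseteq> H} = carrier G"
    using fg by (auto simp: fin_gen_monoid_def)
  have "\<forall>n. \<exists>e::'a \<Rightarrow> nat. x n = (\<Otimes>s\<in>S. s [^] e s)" using fin_gen_exponents[OF S(3,1,2) x] by blast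
  then obtain e :: "nat \<Rightarrow> 'a \<Rightarrow> nat" where e: "\<And>n. x n = (\<Otimes>s\<in>S. s [^] e n s)" by metis
  obtain \<phi> :: "nat \<Rightarrow> nat" where p: "strict_mono \<phi>" "\<forall>s\<in>S. mono (\<lambda>n. e (\<phi> n) s)"
    using dickson_subseq[OF S(1), of e] by auto
  \<comment> \<open>The subtractions are exact, since every exponent grows along the chosen
    subsequence.\<close>
  define y where "y = (\<Otimes>s\<in>S. s [^] (e (\<phi> 1) s - e (\<phi> 0) s))"
  have le: "e (\<phi> 0) s \<le> e (\<phi> 1) s" if "s \<in> S" for s using p(2) that by (auto simp: mono_def)
  have "x (\<phi> 1) = x (\<phi> 0) \<otimes> y"
    unfolding e y_def
    by (rule trans[OF finprod_cong' finprod_multf]) (use S le in \<open>auto simp: nat_pow_mult subset_iff\<close>)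
  moreover have "y \<in> carrier G" unfolding y_def using S by (auto intro!: finprod_closed)
  moreover have "\<phi> 0 < \<phi> 1" using p(1) by (simp add: strict_mono_def)
  ultimately show ?thesis by blast
qed

end

text \<open>The generators of the monoid that lie in P suffice: a product of generators outside P
  stays outside P, so an element of P has a generator from P as a factor.\<close>

lemma (in localization) P_fin_gen:
  assumes fg: "fin_gen_monoid Q"
  shows "\<exists>B. finite B \<and> B \<subseteq> P \<and> (\<forall>p\<in>P. \<exists>b\<in>B. \<exists>q\<in>carrier Q. p = b \<otimes> q)"
proof -
  obtain S where S: "finite S" "S \<subseteq> carrier Q" "\<Inter>{H. submonoid H Q \<and> S \<subseteq> H} = carrier Q"
    using fg by (auto simp: fin_gen_monoid_def)
  define Pr where "Pr q \<longleftrightarrow> q \<in> F \<or> (\<exists>b\<in>S \<inter> P. \<exists>y\<in>carrier Q. q = b \<otimes> y)" for q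
  have Pr: "Pr q" if "q \<in> carrier Q" for q
  proof (rule Q.fin_gen_monoid_induct[OF S(3,2) _ _ _ that])
    show "Pr \<one>" by (simp add: Pr_def)
    show "Pr s" if "s \<in> S" for s
    proof (cases "s \<in> P")
      case True
      then have "s = s \<otimes> \<one>" using P_sub by simp
      then show ?thesis using that True unfolding Pr_def by blast
    next
      case False then show ?thesis using that S by (auto simp: Pr_def F_def)
    qed
    fix a b assume ab: "a \<in> carrier Q" "b \<in> carrier Q" and p: "Pr a" "Pr b"
    show "Pr (a \<otimes> b)"
    proof (cases "a \<in> F \<and> b \<in> F")
      case True then show ?thesis by (auto simp: Pr_def)
    next
      case False
      then obtain s y where sy: "s \<in> S \<inter> P" "y \<in> carrier Q" "a = s \<otimes> y \<or> b = s \<otimes> y"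
        using p by (auto simp: Pr_def)
      have s: "s \<in> carrier Q" using sy P_sub by auto
      have "a \<otimes> b = s \<otimes> (y \<otimes> b) \<or> a \<otimes> b = s \<otimes> (y \<otimes> a)"
        using sy s ab by (auto simp: Q.m_ac)
      then show ?thesis using sy ab unfolding Pr_def by blast
    qed
  qed
  have "\<forall>p\<in>P. \<exists>b\<in>S \<inter> P. \<exists>q\<in>carrier Q. p = b \<otimes> q"
    using Pr P_sub by (fastforce simp: Pr_def F_def)
  then show ?thesis using S by (intro exI[of _ "S \<inter> P"]) auto
qed

text \<open>If \<open>a\<close> is outside a maximal colon set \<open>col s\<close>, then a + s is
  again admissible and its colon set contains that of \<open>s\<close>. A \<open>b\<close> outside
  \<open>col s\<close> with a + b in it would make this inclusion strict, so the complement is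
  closed under addition. Dickson's lemma provides the maximum.\<close>

lemma (in monoid_alg) exists_associated_prime:
  assumes fg: "fin_gen_monoid M" and I: "ideal I A" and f: "f \<in> carrier A" and fI: "f \<notin> I"
  shows "\<exists>s\<in>carrier M. monoid_prime M {q \<in> carrier M. tmono K q \<otimes>\<^sub>A (tmono K s \<otimes>\<^sub>A f) \<in> I}"
proof -
  note If = ideal_facts[OF I]
  define col where "col s = {q \<in> carrier M. tmono K q \<otimes>\<^sub>A (tmono K s \<otimes>\<^sub>A f) \<in> I}" for s
  define rel where "rel = {(s', s). s \<in> carrier M \<and> s' \<in> carrier M \<and> col s \<subset> col s'}"
  define S where "S = {s \<in> carrier M. tmono K s \<otimes>\<^sub>A f \<notin> I}"
  have mm: "tmono K a \<otimes>\<^sub>A (tmono K b \<otimes>\<^sub>A g) = tmono K (a \<otimes> b) \<otimes>\<^sub>A g"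
    if "a \<in> carrier M" "b \<in> carrier M" "g \<in> carrier A" for a b g
    using that by (simp add: A_assoc[symmetric] mterm_mult)
  have col_ideal: "q \<otimes> y \<in> col s" if "q \<in> col s" "y \<in> carrier M" "s \<in> carrier M" for q y s
  proof -
    have q: "q \<in> carrier M" "tmono K q \<otimes>\<^sub>A (tmono K s \<otimes>\<^sub>A f) \<in> I" using that by (auto simp: col_def)
    have "tmono K y \<otimes>\<^sub>A (tmono K q \<otimes>\<^sub>A (tmono K s \<otimes>\<^sub>A f)) \<in> I" using If(6)[OF q(2)] that by simp
    then show ?thesis using q that f by (simp add: col_def mm M.m_ac)
  qed
  have wf: "wf rel"
    unfolding wf_iff_no_infinite_down_chain
  proof
    assume "\<exists>s. \<forall>i. (s (Suc i), s i) \<in> rel"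
    then obtain s where s: "\<And>i. (s (Suc i), s i) \<in> rel" by blast
    have sM: "s i \<in> carrier M" for i using s[of i] by (auto simp: rel_def)
    have inc: "col (s i) \<subset> col (s (Suc i))" for i using s[of i] by (auto simp: rel_def)
    have "\<exists>x. x \<in> col (s (Suc i)) \<and> x \<notin> col (s i)" for i using inc[of i] by blast
    \<comment> \<open>Each \<open>x i\<close> enters the colon set at position i + 1. For i < j with
      \<open>x j\<close> a multiple of \<open>x i\<close>, the element \<open>x j\<close> would have
      entered by position j already.\<close>
    then obtain x where x: "\<And>i. x i \<in> col (s (Suc i))" "\<And>i. x i \<notin> col (s i)" by metis
    have "x i \<in> carrier M" for i using x(1)[of i] by (simp add: col_def)
    then obtain i j y where ij: "i < j" "y \<in> carrier M" "x j = x i \<otimes> y"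
      using M.dickson[OF fg, of x] by blast
    have "col (s (Suc i)) \<subseteq> col (s j)"
      using lift_Suc_mono_le[of "\<lambda>i. col (s i)" "Suc i" j] inc ij(1) by (simp add: psubset_imp_subset)
    then have "x j \<in> col (s j)" using x(1)[of i] col_ideal ij sM by auto
    then show False using x(2) by blast
  qed
  have "\<one> \<in> S" using f fI by (simp add: S_def A_one[symmetric] A_one_mult)
  then obtain s where s: "s \<in> S" and mx: "\<And>s'. (s', s) \<in> rel \<Longrightarrow> s' \<notin> S" using wfE_min[OF wf] by metis
  have sM: "s \<in> carrier M" and sI: "tmono K s \<otimes>\<^sub>A f \<notin> I" using s by (auto simp: S_def)
  have one: "\<one> \<notin> col s" using sM sI f by (simp add: col_def mm)
  have mult: "a \<otimes> b \<notin> col s" if a: "a \<in> carrier M" "a \<notin> col s" and b: "b \<in> carrier M" "b \<notin> col s" for a b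
  proof
    assume ab: "a \<otimes> b \<in> col s"
    have "a \<otimes> s \<in> S" using a sM f by (simp add: S_def col_def mm)
    moreover have "col s \<subseteq> col (a \<otimes> s)"
    proof
      fix q assume q: "q \<in> col s"
      then have "q \<otimes> a \<in> col s" using col_ideal a sM by simp
      then show "q \<in> col (a \<otimes> s)" using q a sM f by (simp add: col_def mm M.m_assoc)
    qed
    moreover have "b \<in> col (a \<otimes> s)"
      using ab a b sM f by (simp add: col_def mm M.m_ac)
    ultimately show False using mx[of "a \<otimes> s"] a b sM by (auto simp: rel_def)
  qed
  have "monoid_prime M (col s)"
    unfolding monoid_prime_def monoid_ideal_def
  proof (intro conjI ballI)
    show "col s \<subseteq> carrier M" by (auto simp: col_def)
    show "a \<otimes> q \<in> col s" if "a \<in> col s" "q \<in> carrier M" for a q using col_ideal that sM by blast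
    show "col s \<noteq> carrier M" using one by auto
    show "submonoid (carrier M - col s) M"
      by (rule submonoid.intro) (use one mult in auto)
  qed
  then show ?thesis using sM by (auto simp: col_def)
qed

section \<open>The ideal determined by one degree\<close>

locale cogen_degree = monoid_alg K M for K :: "('k, 'y) ring_scheme" and M :: "('n, 'z) monoid_scheme" (structure) +
  fixes J :: "('n \<Rightarrow> 'k) set" and w :: 'n
  assumes bJ: "bin J" and w [simp, intro]: "w \<in> carrier M" and wJ: "tmono K w \<notin> J"
begin

lemma J: "ideal J A" using bJ by (rule bin_ideal)

definition C where "C = cong J `` {w}"

text \<open>The largest ideal whose part in the degree \<open>C\<close> of \<open>w\<close> is that of \<open>J\<close>.\<close>

definition W where "W = {f \<in> carrier A. \<forall>x\<in>carrier M. res C (tmono K x \<otimes>\<^sub>A f) \<in> J}"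

lemma C_iff: "x \<in> C \<longleftrightarrow> (x, w) \<in> cong J"
  using cong_sym[OF J] by (auto simp: C_def)

lemma w_C [simp, intro]: "w \<in> C" using cong_refl[OF J] by (simp add: C_iff)

lemma C_carrier: "x \<in> C \<Longrightarrow> x \<in> carrier M" using cong_carrier C_iff by blast

lemma C_cong: "(x, y) \<in> cong J \<Longrightarrow> x \<in> C \<longleftrightarrow> y \<in> C"
  unfolding C_iff by (blast intro: cong_sym[OF J] cong_trans[OF J])

lemma C_both: "x \<in> C \<Longrightarrow> y \<in> C \<Longrightarrow> (x, y) \<in> cong J"
  unfolding C_iff by (blast intro: cong_sym[OF J] cong_trans[OF J])

lemma C_mono: "x \<in> C \<Longrightarrow> tmono K x \<notin> J"
  using cong_mono_iff[OF J] wJ by (auto simp: C_iff)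

lemma C_saturated: "saturated (cong J) C"
  unfolding C_def by (rule saturated_class[OF J])

lemma W_ideal: "ideal W A"
proof (rule ideal_intro)
  note Jf = ideal_facts[OF J]
  show "W \<subseteq> carrier A" by (auto simp: W_def)
  show "\<zero>\<^sub>A \<in> W" using Jf(2) by (auto simp: W_def A_mult_zero)
  show "f \<oplus>\<^sub>A g \<in> W" if "f \<in> W" "g \<in> W" for f g
    using that Jf(3) by (auto simp: W_def A_r_distr res_add)
  show "mterm K c x \<otimes>\<^sub>A f \<in> W" if c: "c \<in> carrier K" and x: "x \<in> carrier M" and f: "f \<in> W" for c x f
  proof -
    have fA: "f \<in> carrier A" using f by (simp add: W_def)
    have "res C (tmono K y \<otimes>\<^sub>A (mterm K c x \<otimes>\<^sub>A f)) \<in> J" if y: "y \<in> carrier M" for y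
    proof -
      define g where "g = tmono K (y \<otimes> x) \<otimes>\<^sub>A f"
      have g: "g \<in> carrier A" "res C g \<in> J" using f fA x y by (auto simp: g_def W_def)
      have "tmono K y \<otimes>\<^sub>A (mterm K c x \<otimes>\<^sub>A f) = mterm K c \<one> \<otimes>\<^sub>A g"
        using c x y fA by (simp add: g_def A_assoc[symmetric] mterm_mult)
      \<comment> \<open>On the carrier 1 is neutral; off the carrier the product is unspecified, but
        \<open>g\<close> vanishes there.\<close>
      moreover have "res {z. \<one> \<otimes> z \<in> C} g = res C g"
      proof
        fix z show "res {z. \<one> \<otimes> z \<in> C} g z = res C g z"
          using g(1) by (cases "z \<in> carrier M") (auto simp: res_def carrier_A)
      qed
      ultimately show ?thesis using Jf(6)[OF g(2)] c g(1) by (simp add: res_mult_mterm)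
    qed
    then show ?thesis using c x fA by (simp add: W_def)
  qed
qed

lemma J_sub_W: "J \<subseteq> W"
proof
  fix f assume f: "f \<in> J"
  then have fA: "f \<in> carrier A" using ideal_facts(1)[OF J] by auto
  have "res C (tmono K x \<otimes>\<^sub>A f) \<in> J" if "x \<in> carrier M" for x
    using res_in[OF bJ C_saturated] ideal_facts(6)[OF J f, of "tmono K x"] that by simp
  then show "f \<in> W" using fA by (simp add: W_def)
qed

lemma res_C_binomial:
  assumes "a \<in> carrier M" "b \<in> carrier M" "c \<in> carrier K"
  shows "res C (binomial K M a c b) =
    (if a \<in> C then if b \<in> C then binomial K M a c b else tmono K a
     else if b \<in> C then mterm K (\<ominus>\<^bsub>K\<^esub> c) b else \<zero>\<^sub>A)"
  using assms by (simp add: binomial_eq res_add res_mterm)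

text \<open>A translate of a binomial has at most two terms, so its part on \<open>C\<close> is
  zero, one term, or everything, and one term with exponent in \<open>C\<close> is never in
  \<open>J\<close>. Therefore each translate must meet \<open>C\<close> in all of its terms or in
  none, and in the first case lie in \<open>J\<close>; \<open>W_binD\<close> is the converse. The
  guard on \<open>c\<close> is there because for c = 0 the exponent \<open>b\<close> does not
  occur.\<close>

lemma W_binI:
  assumes m: "a \<in> carrier M" "b \<in> carrier M" "c \<in> carrier K"
    and z: "\<And>z. z \<in> carrier M \<Longrightarrow> z \<otimes> a \<in> C \<or> c \<noteq> \<zero>\<^sub>K \<and> z \<otimes> b \<in> C \<Longrightarrow>
      z \<otimes> a \<in> C \<and> z \<otimes> b \<in> C \<and> binomial K M (z \<otimes> a) c (z \<otimes> b) \<in> J"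
  shows "binomial K M a c b \<in> W"
proof -
  have "res C (tmono K x \<otimes>\<^sub>A binomial K M a c b) \<in> J" if x: "x \<in> carrier M" for x
    using z[OF x] m x ideal_facts(2)[OF J]
    by (cases "c = \<zero>\<^sub>K") (auto simp: tmono_mult_binomial res_C_binomial)
  then show ?thesis using m by (simp add: W_def)
qed

lemma W_binD:
  assumes m: "a \<in> carrier M" "b \<in> carrier M" "c \<in> carrier K" and t: "binomial K M a c b \<in> W"
    and z: "z \<in> carrier M"
  shows "z \<otimes> a \<in> C \<Longrightarrow> c \<noteq> \<zero>\<^sub>K \<and> z \<otimes> b \<in> C \<and> binomial K M (z \<otimes> a) c (z \<otimes> b) \<in> J"
    and "c \<noteq> \<zero>\<^sub>K \<Longrightarrow> z \<otimes> b \<in> C \<Longrightarrow> z \<otimes> a \<in> C \<and> binomial K M (z \<otimes> a) c (z \<otimes> b) \<in> J"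
proof -
  have 1: "res C (binomial K M (z \<otimes> a) c (z \<otimes> b)) \<in> J"
    using t m z by (auto simp: W_def tmono_mult_binomial)
  show "c \<noteq> \<zero>\<^sub>K \<and> z \<otimes> b \<in> C \<and> binomial K M (z \<otimes> a) c (z \<otimes> b) \<in> J" if a: "z \<otimes> a \<in> C"
  proof -
    have b: "z \<otimes> b \<in> C" using 1 a C_mono[OF a] m z by (auto simp: res_C_binomial split: if_splits)
    then have "binomial K M (z \<otimes> a) c (z \<otimes> b) \<in> J" using 1 a m z by (simp add: res_C_binomial)
    moreover from this have "c \<noteq> \<zero>\<^sub>K" using C_mono[OF a] m z by (auto simp: mono_iff_binomial)
    ultimately show ?thesis using b by simp
  qed
  show "z \<otimes> a \<in> C \<and> binomial K M (z \<otimes> a) c (z \<otimes> b) \<in> J" if c: "c \<noteq> \<zero>\<^sub>K" and b: "z \<otimes> b \<in> C"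
  proof -
    have c': "\<ominus>\<^bsub>K\<^esub> c \<in> carrier K" "\<ominus>\<^bsub>K\<^esub> c \<noteq> \<zero>\<^sub>K" using c m by (auto simp: K.add.inv_eq_1_iff)
    have "z \<otimes> a \<in> C"
    proof (rule ccontr)
      assume "z \<otimes> a \<notin> C"
      then have "mterm K (\<ominus>\<^bsub>K\<^esub> c) (z \<otimes> b) \<in> J" using 1 b m z by (simp add: res_C_binomial)
      then show False using mterm_in_ideal[OF J c'] C_mono[OF b] m z by simp
    qed
    then show ?thesis using 1 b m z by (simp add: res_C_binomial)
  qed
qed

text \<open>Monomials with exponent in \<open>C\<close> are not in \<open>J\<close>, so t^a survives
  modulo \<open>W\<close> exactly when \<open>a\<close> divides \<open>w\<close> up to the
  congruence.\<close>

lemma W_mono_iff: assumes a: "a \<in> carrier M"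
  shows "tmono K a \<in> W \<longleftrightarrow> (\<forall>z\<in>carrier M. z \<otimes> a \<notin> C)"
proof -
  have "res C (tmono K z \<otimes>\<^sub>A tmono K a) \<in> J \<longleftrightarrow> z \<otimes> a \<notin> C" if "z \<in> carrier M" for z
    using that a C_mono ideal_facts(2)[OF J] by (auto simp: mterm_mult res_mterm)
  then show ?thesis using a by (auto simp: W_def)
qed

lemma C_notin_W: "a \<in> C \<Longrightarrow> tmono K a \<notin> W"
  using C_carrier[of a] by (auto simp: W_mono_iff intro!: bexI[of _ "\<one>"])

lemma one_notin_W: "tmono K \<one> \<notin> W"
  by (auto simp: W_mono_iff intro!: bexI[of _ w])

lemma W_res: "f \<in> W \<Longrightarrow> res C f \<in> J"
  using A_one_mult[of f] M.one_closed unfolding W_def A_one by fastforce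

text \<open>The translate by \<open>u\<close> lies in \<open>J\<close> because it meets
  \<open>C\<close>, and t^u can be cancelled. This is the sense in which \<open>W\<close> and
  \<open>J\<close> agree in the degrees that a unit moves to \<open>w\<close>.\<close>

lemma W_unit_J:
  assumes m: "a \<in> carrier M" "b \<in> carrier M" "c \<in> carrier K" and t: "binomial K M a c b \<in> W"
    and u: "u \<in> Units M" and ua: "u \<otimes> a \<in> C"
  shows "binomial K M a c b \<in> J"
proof (rule unit_binomial_cancel[OF J u])
  have uc: "u \<in> carrier M" using u by (rule M.Units_closed)
  show "tmono K u \<otimes>\<^sub>A binomial K M a c b \<in> J"
    using W_binD(1)[OF m t uc ua] m uc by (simp add: tmono_mult_binomial)
qed (use m in auto)

lemma cong_unit_cancel:
  assumes m: "x \<in> carrier M" "y \<in> carrier M" and u: "u \<in> Units M" and t: "(x \<otimes> u, y \<otimes> u) \<in> cong J"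
  shows "(x, y) \<in> cong J"
  using cong_mult[OF J t M.Units_inv_closed[OF u]] m u by (simp add: M.m_assoc M.Units_closed)

text \<open>For units one good translate decides all of them: if z + a or z + b lies in
  \<open>C\<close>, cancelling the unit shows that \<open>z\<close> and \<open>y\<close> are
  congruent. With t^z congruent to d t^y, the coefficient for \<open>z\<close> is d c d^-1, which is
  \<open>c\<close>. Both the character ideal and the mesoprimary condition rest on this.\<close>

lemma W_units:
  assumes a: "a \<in> Units M" "b \<in> Units M" and c: "c \<in> carrier K" and y: "y \<in> carrier M"
    and C: "y \<otimes> a \<in> C" "y \<otimes> b \<in> C" and t: "binomial K M (y \<otimes> a) c (y \<otimes> b) \<in> J"
  shows "binomial K M a c b \<in> W"
proof (rule W_binI)
  show m: "a \<in> carrier M" "b \<in> carrier M" using a by (auto intro: M.Units_closed)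
  fix z assume z: "z \<in> carrier M" and "z \<otimes> a \<in> C \<or> c \<noteq> \<zero>\<^sub>K \<and> z \<otimes> b \<in> C"
  then have zy: "(z, y) \<in> cong J" using C_both C cong_unit_cancel z y a by blast
  then obtain d where d: "d \<in> carrier K" "d \<noteq> \<zero>\<^sub>K" "binomial K M z d y \<in> J" by (rule congE)
  note i = K_inv[OF d(1,2)]
  have 1: "binomial K M (z \<otimes> a) d (y \<otimes> a) \<in> J" "binomial K M (z \<otimes> b) d (y \<otimes> b) \<in> J"
    using binomial_mult[OF J z y _ d(1,3)] m z y by (auto simp: M.m_comm)
  have 2: "binomial K M (y \<otimes> b) (inv\<^bsub>K\<^esub> d) (z \<otimes> b) \<in> J"
    by (rule binomial_sym[OF J _ _ d(1,2) 1(2)]) (use m z y in auto)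
  have 3: "binomial K M (z \<otimes> a) (d \<otimes>\<^sub>K c) (y \<otimes> b) \<in> J"
    by (rule binomial_trans[OF J _ _ _ d(1) c 1(1) t]) (use m z y in auto)
  have 4: "binomial K M (z \<otimes> a) (d \<otimes>\<^sub>K c \<otimes>\<^sub>K inv\<^bsub>K\<^esub> d) (z \<otimes> b) \<in> J"
    by (rule binomial_trans[OF J _ _ _ _ _ 3 2]) (use m z y c d i in auto)
  have "d \<otimes>\<^sub>K c \<otimes>\<^sub>K inv\<^bsub>K\<^esub> d = c \<otimes>\<^sub>K (d \<otimes>\<^sub>K inv\<^bsub>K\<^esub> d)"
    using c d(1) i by (simp add: K.m_ac)
  then have "d \<otimes>\<^sub>K c \<otimes>\<^sub>K inv\<^bsub>K\<^esub> d = c" using c i by simp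
  moreover have "z \<otimes> a \<in> C" "z \<otimes> b \<in> C"
    using C_cong[OF cong_mult[OF J zy m(1)]] C_cong[OF cong_mult[OF J zy m(2)]] C by auto
  ultimately show "z \<otimes> a \<in> C \<and> z \<otimes> b \<in> C \<and> binomial K M (z \<otimes> a) c (z \<otimes> b) \<in> J"
    using 4 by simp
qed (use c in simp)

end

section \<open>The binoccular component\<close>

locale component = loc_alg K Q P
  for K :: "('k, 'y) ring_scheme" and Q :: "('q, 'x) monoid_scheme" (structure) and P :: "'q set" +
  fixes I :: "('q \<Rightarrow> 'k) set" and w :: 'q
  assumes fg: "fin_gen_monoid Q" and bI: "dom.bin I" and wQ [simp, intro]: "w \<in> carrier Q"
    and wI: "tmono K (loc w) \<notin> LI I"
    and wP: "\<And>p x. p \<in> P \<Longrightarrow> x \<in> carrier N \<Longrightarrow>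
      (loc w, loc w \<otimes>\<^sub>N (loc p \<otimes>\<^sub>N x)) \<notin> ideal_cong K N (LI I)"
begin

sublocale X: cogen_degree K N "LI I" "loc w"
  using LI_bin[OF bI] wI by unfold_locales auto

abbreviation r where "r \<equiv> ideal_cong K N (LI I)"

lemma I_ideal: "ideal I AQ" using bI by (rule dom.bin_ideal)

text \<open>If a multiple of w + p divided \<open>w\<close>, so would w + p itself, against
  \<open>wP\<close>. Thus P annihilates t^w modulo \<open>X.W\<close>.\<close>

lemma W_P: assumes p: "p \<in> P" and y: "y \<in> carrier N" shows "tmono K (loc w \<otimes>\<^sub>N (loc p \<otimes>\<^sub>N y)) \<in> X.W"
proof -
  have pc: "loc p \<in> carrier N" using p P_sub by simp
  have "z \<otimes>\<^sub>N (loc w \<otimes>\<^sub>N (loc p \<otimes>\<^sub>N y)) \<notin> X.C" if z: "z \<in> carrier N" for z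
  proof
    assume "z \<otimes>\<^sub>N (loc w \<otimes>\<^sub>N (loc p \<otimes>\<^sub>N y)) \<in> X.C"
    then have "(loc w, z \<otimes>\<^sub>N (loc w \<otimes>\<^sub>N (loc p \<otimes>\<^sub>N y))) \<in> r"
      using cod.cong_sym[OF X.J] by (simp add: X.C_iff)
    moreover have "z \<otimes>\<^sub>N (loc w \<otimes>\<^sub>N (loc p \<otimes>\<^sub>N y)) = loc w \<otimes>\<^sub>N (loc p \<otimes>\<^sub>N (z \<otimes>\<^sub>N y))"
      using z y pc by (simp add: N.m_ac)
    ultimately show False using wP[OF p, of "z \<otimes>\<^sub>N y"] z y by simp
  qed
  then show ?thesis using pc y by (subst X.W_mono_iff) auto
qed

text \<open>The last condition says that the target of the step still divides \<open>w\<close> up to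
  the congruence. The multiple stands first in the pair, so a property is inherited by
  \<open>a\<close> from its surviving multiples a + p.\<close>

definition step_rel where
  "step_rel = {(a \<otimes> p, a) |a p. a \<in> carrier Q \<and> p \<in> P \<and> tmono K (loc (a \<otimes> p)) \<notin> X.W}"

text \<open>In an infinite chain every member from the second on has a cofactor \<open>x i\<close>
  that completes it to \<open>w\<close>, up to a unit. If the cofactor at j is that at i plus
  \<open>y\<close>, for some i < j, then between these two places the chain gained some
  \<open>t\<close> in P and the cofactor gained \<open>y\<close>. Comparing both completions makes
  \<open>w\<close> divisible by w + t, which \<open>wP\<close> excludes.\<close>

lemma wf_step: "wf step_rel"
  unfolding wf_iff_no_infinite_down_chain
proof
  assume "\<exists>s. \<forall>i. (s (Suc i), s i) \<in> step_rel"
  then obtain s where s: "\<And>i. (s (Suc i), s i) \<in> step_rel" by blast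
  have sQ: "s i \<in> carrier Q" for i using s[of i] by (auto simp: step_rel_def)
  have st: "\<exists>p\<in>P. s (Suc i) = s i \<otimes> p" for i using s[of i] by (auto simp: step_rel_def)
  have sW: "tmono K (loc (s (Suc i))) \<notin> X.W" for i using s[of i] by (auto simp: step_rel_def)
  have "\<exists>x f. x \<in> carrier Q \<and> f \<in> F \<and> (loc x \<otimes>\<^sub>N loc (s (Suc i)), loc f \<otimes>\<^sub>N loc w) \<in> r" for i
  proof -
    obtain z where z: "z \<in> carrier N" "z \<otimes>\<^sub>N loc (s (Suc i)) \<in> X.C"
      using sW[of i] sQ X.W_mono_iff[of "loc (s (Suc i))"] by auto
    obtain x f where xf: "x \<in> carrier Q" "f \<in> F" "loc f \<otimes>\<^sub>N z = loc x" using N_cases[OF z(1)] .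
    have "(loc f \<otimes>\<^sub>N (z \<otimes>\<^sub>N loc (s (Suc i))), loc f \<otimes>\<^sub>N loc w) \<in> r"
      using cod.cong_mult'[OF X.J] z(2) xf(2) F_sub by (auto simp: X.C_iff)
    moreover have "loc f \<otimes>\<^sub>N (z \<otimes>\<^sub>N loc (s (Suc i))) = loc x \<otimes>\<^sub>N loc (s (Suc i))"
      using xf F_sub[OF xf(2)] z(1) sQ by (simp add: N.m_assoc[symmetric])
    ultimately show ?thesis using xf by auto
  qed
  then obtain x f where xf: "\<And>i. x i \<in> carrier Q" "\<And>i. f i \<in> F"
    "\<And>i. (loc (x i) \<otimes>\<^sub>N loc (s (Suc i)), loc (f i) \<otimes>\<^sub>N loc w) \<in> r" by metis
  obtain i j y where ij: "i < j" "y \<in> carrier Q" "x j = x i \<otimes> y"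
    using Q.dickson[OF fg, of x] xf(1) by blast
  \<comment> \<open>Collects successive steps into one element of P; the inner successor ensures
    that at least one step is taken.\<close>
  have tp: "\<exists>t\<in>P. s (Suc (i + Suc k)) = s (Suc i) \<otimes> t" for k
  proof (induction k)
    case 0
    then show ?case using st[of "Suc i"] by simp
  next
    case (Suc k)
    then obtain t where t: "t \<in> P" "s (Suc (i + Suc k)) = s (Suc i) \<otimes> t" by auto
    obtain p where p: "p \<in> P" "s (Suc (Suc (i + Suc k))) = s (Suc (i + Suc k)) \<otimes> p" using st by blast
    have "s (Suc (i + Suc (Suc k))) = s (Suc i) \<otimes> (t \<otimes> p)"
      using p t sQ P_sub by (simp add: Q.m_assoc)
    then show ?case using P_mult[OF t(1)] P_sub[OF p(1)] by blast
  qed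
  obtain t where t: "t \<in> P" "s (Suc j) = s (Suc i) \<otimes> t"
    using tp[of "j - i - 1"] ij(1) by auto
  have tc: "t \<in> carrier Q" using t P_sub by simp
  have fc: "f i \<in> carrier Q" "f j \<in> carrier Q" using xf(2) F_sub by auto
  \<comment> \<open>The unit by which the completion at position j misses \<open>w\<close>;
    multiplying with its inverse isolates \<open>w\<close>.\<close>
  define g where "g = loc (f j)"
  have g: "g \<in> Units N" unfolding g_def using xf(2) by auto
  have gc: "g \<in> carrier N" "inv\<^sub>N g \<in> carrier N" using g by auto
  have "loc (x j) \<otimes>\<^sub>N loc (s (Suc j)) = (loc (x i) \<otimes>\<^sub>N loc (s (Suc i))) \<otimes>\<^sub>N (loc y \<otimes>\<^sub>N loc t)"
    unfolding ij(3) t(2) using xf(1) sQ ij(2) tc by (simp add: N.m_ac)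
  then have "(loc (x j) \<otimes>\<^sub>N loc (s (Suc j)), (loc (f i) \<otimes>\<^sub>N loc w) \<otimes>\<^sub>N (loc y \<otimes>\<^sub>N loc t)) \<in> r"
    using cod.cong_mult[OF X.J xf(3)[of i], of "loc y \<otimes>\<^sub>N loc t"] ij(2) tc by simp
  then have "(g \<otimes>\<^sub>N loc w, (loc (f i) \<otimes>\<^sub>N loc w) \<otimes>\<^sub>N (loc y \<otimes>\<^sub>N loc t)) \<in> r"
    unfolding g_def using cod.cong_trans[OF X.J cod.cong_sym[OF X.J xf(3)[of j]]] by blast
  then have "(inv\<^sub>N g \<otimes>\<^sub>N (g \<otimes>\<^sub>N loc w), inv\<^sub>N g \<otimes>\<^sub>N ((loc (f i) \<otimes>\<^sub>N loc w) \<otimes>\<^sub>N (loc y \<otimes>\<^sub>N loc t))) \<in> r"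
    by (rule cod.cong_mult'[OF X.J _ gc(2)])
  moreover have "inv\<^sub>N g \<otimes>\<^sub>N (g \<otimes>\<^sub>N loc w) = loc w"
    using g gc by (simp add: N.m_assoc[symmetric])
  moreover have "inv\<^sub>N g \<otimes>\<^sub>N ((loc (f i) \<otimes>\<^sub>N loc w) \<otimes>\<^sub>N (loc y \<otimes>\<^sub>N loc t))
    = loc w \<otimes>\<^sub>N (loc t \<otimes>\<^sub>N (inv\<^sub>N g \<otimes>\<^sub>N (loc (f i) \<otimes>\<^sub>N loc y)))"
    using gc(2) fc ij(2) tc by (simp add: N.m_ac)
  ultimately show False using wP[OF t(1), of "inv\<^sub>N g \<otimes>\<^sub>N (loc (f i) \<otimes>\<^sub>N loc y)"] gc fc ij(2) by simp
qed

section \<open>Characters and the coprincipal component\<close>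

lemma stab_charD:
  assumes k: "k \<in> stab K Q P I w"
  shows "stab_char K Q P I w k \<in> carrier K" "stab_char K Q P I w k \<noteq> \<zero>\<^bsub>K\<^esub>"
    "binomial K N (k \<otimes>\<^sub>N loc w) (stab_char K Q P I w k) (loc w) \<in> LI I"
proof -
  have ku: "k \<in> Units N" and kw: "(k \<otimes>\<^sub>N loc w, loc w) \<in> r"
    using k by (auto simp: stab_def loc_cong_eq[OF I_ideal])
  have kc: "k \<in> carrier N" using ku by auto
  note eq = binomial_one_mult[OF _ kc, of _ "loc w"]
  obtain c where c: "c \<in> carrier K" "c \<noteq> \<zero>\<^bsub>K\<^esub>" "binomial K N (k \<otimes>\<^sub>N loc w) c (loc w) \<in> LI I"
    using kw by (rule cod.congE)
  have "stab_char K Q P I w k = c"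
    unfolding stab_char_def
  proof (rule the_equality)
    show "c \<in> carrier K - {\<zero>\<^bsub>K\<^esub>} \<and> binomial K N k c \<one>\<^sub>N \<otimes>\<^sub>A tmono K (loc w) \<in> LI I"
      using c eq by simp
    fix d assume "d \<in> carrier K - {\<zero>\<^bsub>K\<^esub>} \<and> binomial K N k d \<one>\<^sub>N \<otimes>\<^sub>A tmono K (loc w) \<in> LI I"
    then have d: "d \<in> carrier K" "binomial K N (k \<otimes>\<^sub>N loc w) d (loc w) \<in> LI I" using eq by auto
    \<comment> \<open>Two different coefficients would put t^w into \<open>LI I\<close>.\<close>
    show "d = c"
      using cod.binomial_unique[OF X.J _ _ d(1) c(1) d(2) c(3)] kc wI by auto
  qed
  then show "stab_char K Q P I w k \<in> carrier K" "stab_char K Q P I w k \<noteq> \<zero>\<^bsub>K\<^esub>"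
    "binomial K N (k \<otimes>\<^sub>N loc w) (stab_char K Q P I w k) (loc w) \<in> LI I" using c by auto
qed

lemma char_ideal_W: "cod.bin (char_ideal K Q P I w)" "char_ideal K Q P I w \<subseteq> X.W"
proof -
  let ?T = "{binomial K N u (stab_char K Q P I w (u \<otimes>\<^sub>N inv\<^sub>N v)) v |u v.
        u \<in> Units N \<and> v \<in> Units N \<and> u \<otimes>\<^sub>N inv\<^sub>N v \<in> stab K Q P I w}"
  have T: "?T \<subseteq> binomials K N"
    using stab_charD(1) by (auto intro!: cod.binomial_in_binomials)
  show "cod.bin (char_ideal K Q P I w)" unfolding char_ideal_def by (rule cod.Idl_bin(1)[OF T])
  have "?T \<subseteq> X.W"
  proof clarify
    fix u v assume u: "u \<in> Units N" and v: "v \<in> Units N" and s: "u \<otimes>\<^sub>N inv\<^sub>N v \<in> stab K Q P I w"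
    note sc = stab_charD[OF s]
    have c: "u \<in> carrier N" "v \<in> carrier N" "inv\<^sub>N v \<in> carrier N" using u v by auto
    \<comment> \<open>Translation by w - v sends \<open>v\<close> to \<open>w\<close> and
      \<open>u\<close> to (u - v) + w, which lies in the class of \<open>w\<close> because u - v
      stabilizes it. This is the one translate that \<open>X.W_units\<close> asks for.\<close>
    define y where "y = loc w \<otimes>\<^sub>N inv\<^sub>N v"
    have yu: "y \<otimes>\<^sub>N u = (u \<otimes>\<^sub>N inv\<^sub>N v) \<otimes>\<^sub>N loc w" unfolding y_def using c by (simp add: N.m_ac)
    have yv: "y \<otimes>\<^sub>N v = loc w" unfolding y_def using c v by (simp add: N.m_assoc)
    have "((u \<otimes>\<^sub>N inv\<^sub>N v) \<otimes>\<^sub>N loc w, loc w) \<in> r"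
      using s by (simp add: stab_def loc_cong_eq[OF I_ideal])
    then have "y \<otimes>\<^sub>N u \<in> X.C" unfolding yu X.C_iff .
    then show "binomial K N u (stab_char K Q P I w (u \<otimes>\<^sub>N inv\<^sub>N v)) v \<in> X.W"
      using sc(3) yv c by (intro X.W_units[OF u v sc(1), of y]) (simp_all add: yu, simp add: y_def)
  qed
  then show "char_ideal K Q P I w \<subseteq> X.W" unfolding char_ideal_def
    by (rule cod.Idl_bin(3)[OF T X.W_ideal])
qed

text \<open>The condition on generators says that \<open>u\<close> does not divide \<open>w\<close>,
  which is the criterion \<open>X.W_mono_iff\<close> for membership in \<open>X.W\<close>. The third
  claim is what starts the induction in \<open>W_binomial_in_Js\<close>.\<close>

lemma cogen_W: "cod.bin (cogen_monomial_ideal K Q P I w)" "cogen_monomial_ideal K Q P I w \<subseteq> X.W"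
  "\<And>u. u \<in> carrier Q \<Longrightarrow> tmono K (loc u) \<in> X.W \<Longrightarrow> tmono K (loc u) \<in> cogen_monomial_ideal K Q P I w"
proof -
  let ?T = "{tmono K (loc u) |u. u \<in> carrier Q \<and>
          loc_bar Q P (ideal_cong K Q I) w
            \<notin> ideal_of (loc_quot Q P (ideal_cong K Q I)) (loc_bar Q P (ideal_cong K Q I) u)}"
  have T: "?T \<subseteq> binomials K N" using cod.tmono_in_binomials by auto
  have iff: "loc_bar Q P (ideal_cong K Q I) w
            \<notin> ideal_of (loc_quot Q P (ideal_cong K Q I)) (loc_bar Q P (ideal_cong K Q I) u)
     \<longleftrightarrow> tmono K (loc u) \<in> X.W" if u: "u \<in> carrier Q" for u
  proof -
    have "(loc w, loc u \<otimes>\<^sub>N z) \<in> r \<longleftrightarrow> z \<otimes>\<^sub>N loc u \<in> X.C" if "z \<in> carrier N" for z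
      using u that cod.cong_sym[OF X.J] by (auto simp: X.C_iff N.m_comm)
    then show ?thesis using u by (simp add: bar_in_ideal_of[OF I_ideal] X.W_mono_iff)
  qed
  show "cod.bin (cogen_monomial_ideal K Q P I w)"
    unfolding cogen_monomial_ideal_def by (rule cod.Idl_bin(1)[OF T])
  have "?T \<subseteq> X.W" using iff by auto
  then show "cogen_monomial_ideal K Q P I w \<subseteq> X.W"
    unfolding cogen_monomial_ideal_def by (rule cod.Idl_bin(3)[OF T X.W_ideal])
  show "tmono K (loc u) \<in> cogen_monomial_ideal K Q P I w" if "u \<in> carrier Q" "tmono K (loc u) \<in> X.W" for u
    unfolding cogen_monomial_ideal_def using cod.Idl_bin(2)[OF T] iff that by blast
qed

abbreviation J0 where "J0 \<equiv> coprincipal_component K Q P I w"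

text \<open>All three summands are binomial and contained in \<open>X.W\<close>, and
  \<open>pull_bin\<close> carries the binomial property over to the preimage. Already before any
  collapse, the component contains everything from the localization of \<open>I\<close> and every
  monomial that \<open>X.W\<close> permits.\<close>

lemma J0_facts:
  "dom.bin J0" "J0 \<subseteq> pull X.W" "pull (LI I) \<subseteq> J0"
  "\<And>u. u \<in> carrier Q \<Longrightarrow> tmono K (loc u) \<in> X.W \<Longrightarrow> tmono K u \<in> J0"
proof -
  let ?S = "LI I <+>\<^bsub>AN\<^esub> char_ideal K Q P I w"
  let ?S' = "?S <+>\<^bsub>AN\<^esub> cogen_monomial_ideal K Q P I w"
  have eq: "J0 = pull ?S'" by (simp add: coprincipal_component_def loc_preimage_eq)
  note b1 = cod.sum_bin[OF LI_bin[OF bI] char_ideal_W(1)]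
  note s1 = cod.sum_ideal[OF X.J cod.bin_ideal[OF char_ideal_W(1)]]
  note s2 = cod.sum_ideal[OF s1(1) cod.bin_ideal[OF cogen_W(1)]]
  show "dom.bin J0" unfolding eq
    by (rule pull_bin[OF cod.sum_bin[OF b1 cogen_W(1)]])
  have "?S' \<subseteq> X.W" by (intro s2(4) s1(4) X.W_ideal X.J_sub_W char_ideal_W(2) cogen_W(2))
  then show "J0 \<subseteq> pull X.W" unfolding eq pull_def by blast
  have "LI I \<subseteq> ?S'" using s1(2) s2(2) by blast
  then show "pull (LI I) \<subseteq> J0" unfolding eq pull_def by blast
  show "tmono K u \<in> J0" if u: "u \<in> carrier Q" and t: "tmono K (loc u) \<in> X.W" for u
  proof -
    have "tmono K (loc u) \<in> ?S'" using cogen_W(3)[OF u t] s2(3) by blast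
    then show ?thesis unfolding eq pull_def using u by (simp add: push_mterm)
  qed
qed

lemma J0_I: "I \<subseteq> J0"
proof -
  have "I \<subseteq> pull (LI I)" using LI_ideal(2)[OF I_ideal] dom.ideal_facts(1)[OF I_ideal] by (auto simp: pull_def)
  then show ?thesis using J0_facts(3) by blast
qed

text \<open>The invariant of the collapses. Its lower bound supplies \<open>I\<close> and the
  monomials of \<open>X.W\<close>; its upper bound lets congruences of later ideals be tested in
  \<open>X.W\<close>.\<close>

definition good where "good J \<longleftrightarrow> dom.bin J \<and> J0 \<subseteq> J \<and> J \<subseteq> pull X.W"

lemma goodD:
  assumes g: "good J"
  shows "ideal J AQ" "LI I \<subseteq> LI J" "LI J \<subseteq> X.W"
proof -
  show 1: "ideal J AQ" using g by (simp add: good_def dom.bin_ideal)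
  have "push ` I \<subseteq> LI J" using g J0_I LI_ideal(2)[OF 1] by (auto simp: good_def)
  then show "LI I \<subseteq> LI J" by (rule LI_minimal[OF I_ideal LI_ideal(1)[OF 1]])
  show "LI J \<subseteq> X.W" by (rule LI_minimal[OF 1 X.W_ideal]) (use g in \<open>auto simp: good_def pull_def\<close>)
qed

section \<open>Collapses stay below the ideal of the degree\<close>

abbreviation in_w_ideal where
  "in_w_ideal J q \<equiv> loc_bar Q P (ideal_cong K Q J) q
            \<in> ideal_of (loc_quot Q P (ideal_cong K Q J)) (loc_bar Q P (ideal_cong K Q J) w)"

lemma unit_C_in_w_ideal:
  assumes g: "good J" and q: "q \<in> carrier Q" and u: "u \<in> Units N" and C: "u \<otimes>\<^sub>N loc q \<in> X.C"
  shows "in_w_ideal J q"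
proof -
  have uc: "u \<in> carrier N" "inv\<^sub>N u \<in> carrier N" using u by auto
  have "(loc q, loc w \<otimes>\<^sub>N inv\<^sub>N u) \<in> r"
  proof -
    have "((u \<otimes>\<^sub>N loc q) \<otimes>\<^sub>N inv\<^sub>N u, loc w \<otimes>\<^sub>N inv\<^sub>N u) \<in> r"
      using cod.cong_mult[OF X.J _ uc(2)] C by (simp add: X.C_iff)
    moreover have "(u \<otimes>\<^sub>N loc q) \<otimes>\<^sub>N inv\<^sub>N u = (u \<otimes>\<^sub>N inv\<^sub>N u) \<otimes>\<^sub>N loc q"
      using uc q by (simp only: N.m_ac N.m_closed to_loc_closed)
    ultimately show ?thesis using u q by simp
  qed
  then have "(loc q, loc w \<otimes>\<^sub>N inv\<^sub>N u) \<in> ideal_cong K N (LI J)"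
    using cod.cong_mono[OF goodD(2)[OF g]] by blast
  then show ?thesis using uc q by (auto simp: bar_in_ideal_of[OF goodD(1)[OF g]])
qed

text \<open>The congruence is that of \<open>J\<close>, possibly coarser than \<open>r\<close>, so
  the relation between \<open>q\<close> and w + y is read as a binomial of \<open>X.W\<close>. If
  \<open>y\<close> is a unit, the translate by its inverse sends w + y into \<open>C\<close>, and
  hence \<open>q\<close> too. Otherwise \<open>y\<close> is a multiple of P, t^(w + y) lies in
  \<open>X.W\<close> by \<open>W_P\<close>, and t^q would follow.\<close>

lemma in_w_ideal_unit_C:
  assumes g: "good J" and q: "q \<in> carrier Q" and i: "in_w_ideal J q" and qW: "tmono K (loc q) \<notin> X.W"
  shows "\<exists>u\<in>Units N. u \<otimes>\<^sub>N loc q \<in> X.C"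
proof -
  obtain y where y: "y \<in> carrier N" "(loc q, loc w \<otimes>\<^sub>N y) \<in> ideal_cong K N (LI J)"
    using i q by (auto simp: bar_in_ideal_of[OF goodD(1)[OF g]])
  then obtain d where d: "d \<in> carrier K" "d \<noteq> \<zero>\<^bsub>K\<^esub>" "binomial K N (loc q) d (loc w \<otimes>\<^sub>N y) \<in> X.W"
    using goodD(3)[OF g] by (auto elim!: cod.congE)
  from N_unit_or_P[OF y(1)] show ?thesis
  proof
    assume yu: "y \<in> Units N"
    have "inv\<^sub>N y \<otimes>\<^sub>N (loc w \<otimes>\<^sub>N y) = (inv\<^sub>N y \<otimes>\<^sub>N y) \<otimes>\<^sub>N loc w"
      using yu y(1) by (simp only: N.m_ac N.m_closed to_loc_closed N.Units_inv_closed wQ)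
    then have "inv\<^sub>N y \<otimes>\<^sub>N (loc w \<otimes>\<^sub>N y) = loc w" using yu by simp
    then have "inv\<^sub>N y \<otimes>\<^sub>N loc q \<in> X.C"
      using X.W_binD(2)[OF _ _ d(1) d(3) _ d(2), of "inv\<^sub>N y"] y(1) q yu by auto
    then show ?thesis using yu by blast
  next
    assume "\<exists>p\<in>P. \<exists>y'\<in>carrier N. y = loc p \<otimes>\<^sub>N y'"
    then have "tmono K (loc w \<otimes>\<^sub>N y) \<in> X.W" using W_P by auto
    then have "tmono K (loc q) \<in> X.W"
      using cod.binomial_mono_left[OF X.W_ideal _ _ d(1) d(3)] q y(1) by simp
    then show ?thesis using qW by simp
  qed
qed

abbreviation collapse where "collapse \<equiv> binoccular_collapse K Q P w"

text \<open>Let a translate by \<open>z\<close> of a new generator meet \<open>C\<close>. A unit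
  \<open>z\<close> would put \<open>a\<close> or \<open>b\<close> into the ideal of
  \<open>w\<close>, which is excluded for generators. So \<open>z\<close> is a multiple of some
  \<open>p\<close> in P, and the translate by \<open>p\<close> lies in \<open>J\<close>, hence in
  \<open>X.W\<close>, where all its further translates are under control.\<close>

lemma collapse_good:
  assumes g: "good J"
  shows "good (collapse J)" "J \<subseteq> collapse J"
    "\<And>a c b. a \<in> carrier Q \<Longrightarrow> b \<in> carrier Q \<Longrightarrow> c \<in> carrier K \<Longrightarrow> \<not> in_w_ideal J a \<Longrightarrow> \<not> in_w_ideal J b \<Longrightarrow>
      (\<And>p. p \<in> P \<Longrightarrow> tmono K p \<otimes>\<^bsub>AQ\<^esub> binomial K Q a c b \<in> J) \<Longrightarrow> binomial K Q a c b \<in> collapse J"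
proof -
  define T where "T = {binomial K Q a c b |a c b.
          a \<in> carrier Q \<and> b \<in> carrier Q \<and> c \<in> carrier K \<and> \<not> in_w_ideal J a \<and> \<not> in_w_ideal J b \<and>
          (\<forall>p\<in>P. tmono K p \<otimes>\<^bsub>AQ\<^esub> binomial K Q a c b \<in> J)}"
  have eq: "collapse J = J <+>\<^bsub>AQ\<^esub> Idl\<^bsub>AQ\<^esub> T" by (simp add: binoccular_collapse_def T_def)
  have T: "T \<subseteq> binomials K Q" unfolding T_def using dom.binomial_in_binomials by blast
  note I2 = dom.Idl_bin[OF T]
  note s = dom.sum_ideal[OF goodD(1)[OF g] dom.bin_ideal[OF I2(1)]]
  have pW: "ideal (pull X.W) AQ" by (rule pull_ideal[OF X.W_ideal])
  have "T \<subseteq> pull X.W"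
  proof
    fix f assume "f \<in> T"
    then obtain a c b where f: "f = binomial K Q a c b" and m: "a \<in> carrier Q" "b \<in> carrier Q" "c \<in> carrier K"
      and n: "\<not> in_w_ideal J a" "\<not> in_w_ideal J b"
      and p: "\<And>p. p \<in> P \<Longrightarrow> tmono K p \<otimes>\<^bsub>AQ\<^esub> binomial K Q a c b \<in> J" by (auto simp: T_def)
    have fA: "f \<in> carrier AQ" using f m by simp
    have "push f = binomial K N (loc a) c (loc b)" using f m by (simp add: push_binomial)
    moreover have "binomial K N (loc a) c (loc b) \<in> X.W"
    proof (rule X.W_binI)
      fix z assume z: "z \<in> carrier N" and zC: "z \<otimes>\<^sub>N loc a \<in> X.C \<or> c \<noteq> \<zero>\<^bsub>K\<^esub> \<and> z \<otimes>\<^sub>N loc b \<in> X.C"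
      have "z \<notin> Units N" using zC n unit_C_in_w_ideal[OF g] m by blast
      then obtain p y where py: "p \<in> P" "y \<in> carrier N" "z = loc p \<otimes>\<^sub>N y" using N_unit_or_P[OF z] by blast
      have pc: "p \<in> carrier Q" using py P_sub by simp
      have "binomial K Q (p \<otimes> a) c (p \<otimes> b) \<in> J"
        using p[OF py(1)] m pc by (simp add: dom.tmono_mult_binomial)
      then have pq: "binomial K N (loc p \<otimes>\<^sub>N loc a) c (loc p \<otimes>\<^sub>N loc b) \<in> X.W"
        using g m pc push_binomial[of c "p \<otimes> a" "p \<otimes> b"] by (auto simp: good_def pull_def)
      have e: "z \<otimes>\<^sub>N loc a = y \<otimes>\<^sub>N (loc p \<otimes>\<^sub>N loc a)" "z \<otimes>\<^sub>N loc b = y \<otimes>\<^sub>N (loc p \<otimes>\<^sub>N loc b)"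
        using py pc m by (simp_all add: N.m_ac)
      show "z \<otimes>\<^sub>N loc a \<in> X.C \<and> z \<otimes>\<^sub>N loc b \<in> X.C \<and> binomial K N (z \<otimes>\<^sub>N loc a) c (z \<otimes>\<^sub>N loc b) \<in> LI I"
        using X.W_binD[OF _ _ m(3) pq py(2)] zC pc m unfolding e by auto
    qed (use m in auto)
    ultimately show "f \<in> pull X.W" using fA by (simp add: pull_def)
  qed
  then have sub: "Idl\<^bsub>AQ\<^esub> T \<subseteq> pull X.W" by (rule I2(3)[OF pW])
  show "J \<subseteq> collapse J" unfolding eq by (rule s(2))
  then show "good (collapse J)"
    using g s(4)[OF pW _ sub] dom.sum_bin[OF _ I2(1)] unfolding eq good_def by blast
  fix a c b assume m: "a \<in> carrier Q" "b \<in> carrier Q" "c \<in> carrier K" and n: "\<not> in_w_ideal J a" "\<not> in_w_ideal J b"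
    and p: "\<And>p. p \<in> P \<Longrightarrow> tmono K p \<otimes>\<^bsub>AQ\<^esub> binomial K Q a c b \<in> J"
  then have "binomial K Q a c b \<in> T" unfolding T_def by blast
  then show "binomial K Q a c b \<in> collapse J" unfolding eq using I2(2) s(3) by blast
qed

lemma J0_good: "good J0" using J0_facts by (simp add: good_def)

abbreviation Js where "Js i \<equiv> (collapse ^^ i) J0"

lemma Js_good: "good (Js i)"
  by (induction i) (auto simp: J0_good collapse_good)

lemma Js_mono: "i \<le> j \<Longrightarrow> Js i \<subseteq> Js j"
proof (induction rule: dec_induct)
  case (step n)
  then show ?case using collapse_good(2)[OF Js_good[of n]] by simp
qed simp

section \<open>The binoccular closure and its binomials\<close>

abbreviation V where "V \<equiv> binoccular_component K Q P I w"

lemma V_eq: "V = (\<Union>i. Js i)" by (simp add: binoccular_component_def)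

lemma V_ideal: "ideal V AQ"
proof (rule dom.ideal_intro)
  note Jf = dom.ideal_facts[OF goodD(1)[OF Js_good]]
  show "V \<subseteq> carrier AQ" using Jf(1) by (auto simp: V_eq)
  show "\<zero>\<^bsub>AQ\<^esub> \<in> V" using Jf(2) by (auto simp: V_eq)
  show "f \<oplus>\<^bsub>AQ\<^esub> g \<in> V" if fg: "f \<in> V" "g \<in> V" for f g
  proof -
    obtain i j where "f \<in> Js i" "g \<in> Js j" using fg by (auto simp: V_eq)
    then have "f \<in> Js (max i j)" "g \<in> Js (max i j)" using Js_mono[of i "max i j"] Js_mono[of j "max i j"] by auto
    then show ?thesis using Jf(3) by (auto simp: V_eq)
  qed
  show "mterm K c x \<otimes>\<^bsub>AQ\<^esub> f \<in> V" if cx: "c \<in> carrier K" "x \<in> carrier Q" and f: "f \<in> V" for c x f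
  proof -
    obtain i where "f \<in> Js i" using f by (auto simp: V_eq)
    then have "mterm K c x \<otimes>\<^bsub>AQ\<^esub> f \<in> Js i" by (rule Jf(6)) (use cx in simp)
    then show ?thesis unfolding V_eq by blast
  qed
qed

lemma V_good: "good V"
  unfolding good_def
proof (intro conjI dom.binI V_ideal)
  show "V \<subseteq> dom.bspan V"
  proof
    fix f assume "f \<in> V"
    then obtain i where "f \<in> Js i" by (auto simp: V_eq)
    then have "f \<in> dom.bspan (Js i)" using Js_good[of i] by (auto simp: good_def dom.bin_def)
    moreover have "Js i \<subseteq> V" by (auto simp: V_eq)
    ultimately show "f \<in> dom.bspan V" using dom.bspan_mono by blast
  qed
  show "J0 \<subseteq> V" unfolding V_eq using UN_upper[of 0 UNIV Js] by simp
  show "V \<subseteq> pull X.W" unfolding V_eq using Js_good by (auto simp: good_def)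
qed

lemma V_bin: "dom.bin V" using V_good by (simp add: good_def)

lemma I_sub_V: "I \<subseteq> V" using V_good J0_I by (auto simp: good_def)

text \<open>If c is nonzero then t^b is in \<open>X.W\<close> as well, so the binomial is a
  combination of monomials that \<open>J0\<close> contains.\<close>

lemma W_left_mono_J0:
  assumes m: "a \<in> carrier Q" "b \<in> carrier Q" "c \<in> carrier K" and t: "binomial K N (loc a) c (loc b) \<in> X.W"
    and a: "tmono K (loc a) \<in> X.W"
  shows "binomial K Q a c b \<in> J0"
proof (cases "c = \<zero>\<^bsub>K\<^esub>")
  case True
  then show ?thesis using J0_facts(4)[OF m(1) a] m by (simp add: dom.mono_iff_binomial)
next
  case False
  have "tmono K (loc b) \<in> X.W"
    using cod.binomial_mono_right[OF X.W_ideal _ _ m(3) False t a] m by simp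
  then show ?thesis
    using dom.mono_bin[OF dom.bin_ideal[OF J0_facts(1)] m] J0_facts(4) a m by simp
qed

text \<open>Translates by P are degenerate or come from the induction hypothesis, so they all lie in
  one stage \<open>Js n\<close>. Then either neither exponent is in the ideal of \<open>w\<close> at
  that stage, and the next collapse adds the binomial, or some unit moves an exponent into
  \<open>C\<close>, where \<open>X.W\<close> and the localization of \<open>I\<close> have the same
  binomials and \<open>J0\<close> contains it from the start.\<close>

lemma W_binomial_in_Js:
  assumes a: "a \<in> carrier Q"
  shows "b \<in> carrier Q \<Longrightarrow> c \<in> carrier K \<Longrightarrow> binomial K N (loc a) c (loc b) \<in> X.W \<Longrightarrow>
    \<exists>i. binomial K Q a c b \<in> Js i"
  using a
proof (induction a arbitrary: b c rule: wf_induct_rule[OF wf_step])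
  case (1 a)
  note m = 1(5,2,3) and t = 1(4)
  have J0: "\<exists>i. x \<in> Js i" if "x \<in> J0" for x using that by (intro exI[of _ 0]) simp
  show ?case
  proof (cases "tmono K (loc a) \<in> X.W")
    case True
    then show ?thesis using W_left_mono_J0[OF m t] J0 by blast
  next
    case aW: False
    have c0: "c \<noteq> \<zero>\<^bsub>K\<^esub>" using aW t m by (auto simp: cod.mono_iff_binomial)
    have bW: "tmono K (loc b) \<notin> X.W"
      using aW cod.binomial_mono_left[OF X.W_ideal _ _ m(3) t] m by auto
    have Pcase: "\<exists>i. binomial K Q (p \<otimes> a) c (p \<otimes> b) \<in> Js i" if p: "p \<in> P" for p
    proof -
      have pc: "p \<in> carrier Q" using p P_sub by simp
      have pa: "p \<otimes> a = a \<otimes> p" using pc m by (simp add: Q.m_comm)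
      have tp: "binomial K N (loc (p \<otimes> a)) c (loc (p \<otimes> b)) \<in> X.W"
        using cod.binomial_mult[OF X.W_ideal _ _ _ m(3) t, of "loc p"] pc m by simp
      show ?thesis
      proof (cases "tmono K (loc (p \<otimes> a)) \<in> X.W")
        case True
        then show ?thesis using W_left_mono_J0[OF _ _ m(3) tp] J0 pc m by blast
      next
        case False
        then have "(p \<otimes> a, a) \<in> step_rel" using p m unfolding step_rel_def pa by blast
        then show ?thesis using 1(1)[OF _ _ m(3) tp] pc m by blast
      qed
    qed
    \<comment> \<open>Finitely many generators of P are needed to bound the stages found for the
      single translates by one common \<open>n\<close>.\<close>
    obtain B where B: "finite B" "B \<subseteq> P" "\<And>p. p \<in> P \<Longrightarrow> \<exists>b\<in>B. \<exists>q\<in>carrier Q. p = b \<otimes> q"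
      using P_fin_gen[OF fg] by blast
    have "\<forall>p\<in>B. \<exists>i. binomial K Q (p \<otimes> a) c (p \<otimes> b) \<in> Js i" using Pcase B(2) by blast
    then obtain ix where ix: "\<And>p. p \<in> B \<Longrightarrow> binomial K Q (p \<otimes> a) c (p \<otimes> b) \<in> Js (ix p)" by metis
    obtain n where n: "\<And>p. p \<in> B \<Longrightarrow> ix p \<le> n"
      using finite_nat_set_iff_bounded_le[of "ix ` B"] B(1) by auto
    note gn = Js_good[of n]
    have all: "tmono K p \<otimes>\<^bsub>AQ\<^esub> binomial K Q a c b \<in> Js n" if p: "p \<in> P" for p
    proof -
      obtain b' q where bq: "b' \<in> B" "q \<in> carrier Q" "p = b' \<otimes> q" using B(3)[OF p] by blast
      have b'c: "b' \<in> carrier Q" using bq(1) B(2) P_sub by auto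
      have "binomial K Q (b' \<otimes> a) c (b' \<otimes> b) \<in> Js n" using ix[OF bq(1)] Js_mono[OF n[OF bq(1)]] by blast
      then have "binomial K Q (q \<otimes> (b' \<otimes> a)) c (q \<otimes> (b' \<otimes> b)) \<in> Js n"
        by (rule dom.binomial_mult[OF goodD(1)[OF gn] _ _ bq(2) m(3), rotated 2]) (use b'c m in auto)
      moreover have "q \<otimes> (b' \<otimes> a) = p \<otimes> a" "q \<otimes> (b' \<otimes> b) = p \<otimes> b"
        unfolding bq(3) using bq(2) b'c m by (simp_all add: Q.m_ac)
      ultimately show ?thesis using m P_sub[OF p] by (simp add: dom.tmono_mult_binomial)
    qed
    show ?thesis
    proof (cases "in_w_ideal (Js n) a \<or> in_w_ideal (Js n) b")
      case False
      then have "binomial K Q a c b \<in> collapse (Js n)" using collapse_good(3)[OF gn m _ _ all] by blast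
      then show ?thesis by (intro exI[of _ "Suc n"]) simp
    next
      case True
      \<comment> \<open>Which of the two exponents is in the ideal of \<open>w\<close> does not
        matter: a translate that meets \<open>C\<close> in one term of the binomial meets it in
        both.\<close>
      obtain u where u: "u \<in> Units N" and uab: "u \<otimes>\<^sub>N loc a \<in> X.C \<or> u \<otimes>\<^sub>N loc b \<in> X.C"
        using True in_w_ideal_unit_C[OF gn m(1) _ aW] in_w_ideal_unit_C[OF gn m(2) _ bW] by blast
      have "u \<otimes>\<^sub>N loc a \<in> X.C"
        using uab X.W_binD(2)[OF _ _ m(3) t N.Units_closed[OF u] c0] m by auto
      then have "binomial K N (loc a) c (loc b) \<in> LI I"
        using X.W_unit_J[OF _ _ m(3) t u] m by auto
      then have "binomial K Q a c b \<in> J0"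
        using J0_facts(3) m by (auto simp: pull_def push_binomial)
      then show ?thesis by (rule J0)
    qed
  qed
qed

lemma V_binomial_iff:
  assumes m: "a \<in> carrier Q" "b \<in> carrier Q" "c \<in> carrier K"
  shows "binomial K Q a c b \<in> V \<longleftrightarrow> binomial K N (loc a) c (loc b) \<in> X.W"
proof
  assume "binomial K Q a c b \<in> V"
  then show "binomial K N (loc a) c (loc b) \<in> X.W"
    using V_good m by (auto simp: good_def pull_def push_binomial)
next
  assume "binomial K N (loc a) c (loc b) \<in> X.W"
  then show "binomial K Q a c b \<in> V"
    using W_binomial_in_Js m by (auto simp: V_eq)
qed

lemma V_mono_iff: "a \<in> carrier Q \<Longrightarrow> tmono K a \<in> V \<longleftrightarrow> tmono K (loc a) \<in> X.W"
  using V_binomial_iff[of a a "\<zero>\<^bsub>K\<^esub>"] by (simp add: dom.mono_iff_binomial cod.mono_iff_binomial)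

lemma LI_V_binomial_iff:
  assumes m: "x \<in> carrier N" "y \<in> carrier N" "c \<in> carrier K"
  shows "binomial K N x c y \<in> LI V \<longleftrightarrow> binomial K N x c y \<in> X.W"
proof
  show "binomial K N x c y \<in> LI V \<Longrightarrow> binomial K N x c y \<in> X.W" using goodD(3)[OF V_good] by blast
  assume t: "binomial K N x c y \<in> X.W"
  obtain a b f where ab: "a \<in> carrier Q" "b \<in> carrier Q" and f: "f \<in> F"
    and 1: "loc f \<otimes>\<^sub>N x = loc a" and 2: "loc f \<otimes>\<^sub>N y = loc b" using common_denominator[OF m(1,2)] .
  have fQ: "f \<in> carrier Q" using f F_sub by auto
  have "binomial K Q a c b \<in> V"
    using cod.binomial_mult[OF X.W_ideal m(1,2) _ m(3) t, of "loc f"] fQ V_binomial_iff[OF ab m(3)] by (simp add: 1 2)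
  then have "push (binomial K Q a c b) \<in> LI V" using LI_ideal(2)[OF V_ideal] by blast
  then have "tmono K (loc f) \<otimes>\<^sub>A binomial K N x c y \<in> LI V"
    using m fQ ab by (simp add: cod.tmono_mult_binomial 1 2 push_binomial)
  then show "binomial K N x c y \<in> LI V"
    by (rule cod.unit_binomial_cancel[OF LI_ideal(1)[OF V_ideal] to_loc_unit[OF f], rotated]) (use m in simp)
qed

lemma LI_V_mono_iff: "x \<in> carrier N \<Longrightarrow> tmono K x \<in> LI V \<longleftrightarrow> tmono K x \<in> X.W"
  using LI_V_binomial_iff[of x x "\<zero>\<^bsub>K\<^esub>"] by (simp add: cod.mono_iff_binomial)

section \<open>Mesoprimes at the cogenerators\<close>

lemma stab_char_eq:
  assumes c: "cogenerator K Q P V c"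
  shows "stab K Q P I c = stab K Q P V c"
    and "u \<in> stab K Q P I c \<Longrightarrow> stab_char K Q P I c u = stab_char K Q P V c u"
proof -
  have cQ: "c \<in> carrier Q" and cV: "tmono K (loc c) \<notin> X.W"
    and cP: "\<And>p. p \<in> P \<Longrightarrow> tmono K (loc (c \<otimes> p)) \<in> X.W"
    using c P_sub LI_V_mono_iff by (auto simp: cogenerator_def)
  obtain x where x: "x \<in> carrier N" "x \<otimes>\<^sub>N loc c \<in> X.C"
    using cV cQ X.W_mono_iff[of "loc c"] by auto
  \<comment> \<open>Since t^c survives modulo \<open>X.W\<close>, some \<open>x\<close> moves
    \<open>c\<close> into \<open>C\<close>. A multiple of P cannot do so, because P annihilates t^c
    there.\<close>
  have xu: "x \<in> Units N"
  proof (rule ccontr)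
    assume "x \<notin> Units N"
    then obtain p y where py: "p \<in> P" "y \<in> carrier N" "x = loc p \<otimes>\<^sub>N y" using N_unit_or_P[OF x(1)] by blast
    have "x \<otimes>\<^sub>N loc c = y \<otimes>\<^sub>N loc (c \<otimes> p)" using py P_sub cQ by (simp add: N.m_ac)
    then have "tmono K (x \<otimes>\<^sub>N loc c) \<in> X.W"
      using cod.mono_mult[OF X.W_ideal _ py(2) cP[OF py(1)]] P_sub[OF py(1)] cQ by (simp del: to_loc_mult)
    then show False using X.C_notin_W[OF x(2)] by simp
  qed
  \<comment> \<open>Translation by the unit \<open>x\<close> brings both exponents into
    \<open>C\<close>, where \<open>X.W_unit_J\<close> leads back from the ideal of the component to
    that of \<open>I\<close>.\<close>
  have key: "binomial K N (u \<otimes>\<^sub>N loc c) d (loc c) \<in> LI I \<longleftrightarrow> binomial K N (u \<otimes>\<^sub>N loc c) d (loc c) \<in> LI V"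
    if u: "u \<in> Units N" and d: "d \<in> carrier K" "d \<noteq> \<zero>\<^bsub>K\<^esub>" for u d
  proof
    have uc: "u \<in> carrier N" using u by auto
    show "binomial K N (u \<otimes>\<^sub>N loc c) d (loc c) \<in> LI I \<Longrightarrow> binomial K N (u \<otimes>\<^sub>N loc c) d (loc c) \<in> LI V"
      using goodD(2)[OF V_good] by blast
    assume "binomial K N (u \<otimes>\<^sub>N loc c) d (loc c) \<in> LI V"
    then have t: "binomial K N (u \<otimes>\<^sub>N loc c) d (loc c) \<in> X.W" using goodD(3)[OF V_good] by blast
    have "x \<otimes>\<^sub>N (u \<otimes>\<^sub>N loc c) \<in> X.C"
      using X.W_binD(2)[OF _ _ d(1) t x(1) d(2) x(2)] uc cQ by simp
    then show "binomial K N (u \<otimes>\<^sub>N loc c) d (loc c) \<in> LI I"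
      using X.W_unit_J[OF _ _ d(1) t xu] uc cQ by simp
  qed
  have "(u \<otimes>\<^sub>N loc c, loc c) \<in> r \<longleftrightarrow> (u \<otimes>\<^sub>N loc c, loc c) \<in> ideal_cong K N (LI V)"
    if u: "u \<in> Units N" for u
    using key[OF u] by (auto simp: ideal_cong_def)
  then show "stab K Q P I c = stab K Q P V c"
    by (auto simp: stab_def loc_cong_eq[OF I_ideal] loc_cong_eq[OF V_ideal])
  show "stab_char K Q P I c u = stab_char K Q P V c u" if us: "u \<in> stab K Q P I c"
  proof -
    have u: "u \<in> Units N" using us by (simp add: stab_def)
    then have uc: "u \<in> carrier N" by auto
    note eq = binomial_one_mult[OF _ uc, of _ "loc c"]
    have "(d \<in> carrier K - {\<zero>\<^bsub>K\<^esub>} \<and> binomial K N u d \<one>\<^sub>N \<otimes>\<^sub>A tmono K (loc c) \<in> LI I) \<longleftrightarrow>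
      (d \<in> carrier K - {\<zero>\<^bsub>K\<^esub>} \<and> binomial K N u d \<one>\<^sub>N \<otimes>\<^sub>A tmono K (loc c) \<in> LI V)" for d
      using eq[of d] key[OF u, of d] cQ by auto
    then show ?thesis unfolding stab_char_def by simp
  qed
qed

lemma mesoprime_eq:
  assumes c: "cogenerator K Q P V c"
  shows "mesoprime K Q P I c = mesoprime K Q P V c"
proof -
  note s = stab_char_eq(1)[OF c] and e = stab_char_eq(2)[OF c]
  have "char_ideal K Q P I c = char_ideal K Q P V c"
    unfolding char_ideal_def s[symmetric]
  proof (intro arg_cong[where f = "\<lambda>S. Idl\<^bsub>AN\<^esub> S"] Collect_cong iff_exI)
    fix x u v
    show "(x = binomial K N u (stab_char K Q P I c (u \<otimes>\<^sub>N inv\<^sub>N v)) v \<and> u \<in> Units N \<and> v \<in> Units N \<and>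
        u \<otimes>\<^sub>N inv\<^sub>N v \<in> stab K Q P I c) \<longleftrightarrow>
      (x = binomial K N u (stab_char K Q P V c (u \<otimes>\<^sub>N inv\<^sub>N v)) v \<and> u \<in> Units N \<and> v \<in> Units N \<and>
        u \<otimes>\<^sub>N inv\<^sub>N v \<in> stab K Q P I c)"
      by (cases "u \<otimes>\<^sub>N inv\<^sub>N v \<in> stab K Q P I c") (simp_all only: e simp_thms)
  qed
  then show ?thesis by (simp add: mesoprime_def)
qed

section \<open>The closure is mesoprimary\<close>

abbreviation sim where "sim \<equiv> ideal_cong K Q V"

sublocale c: cong_monoid Q sim
  by unfold_locales (rule dom.cong_monoid_cong[OF V_ideal])

lemma V_mono_nil: assumes a: "a \<in> carrier Q" "tmono K a \<in> V" shows "is_nil c.R (sim `` {a})"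
proof -
  have "(a \<otimes> b, a) \<in> sim" if b: "b \<in> carrier Q" for b
  proof (rule dom.cong_both_mono[OF V_ideal])
    show "tmono K (a \<otimes> b) \<in> V"
      using dom.mono_mult[OF V_ideal a(1) b a(2)] Q.m_comm[OF a(1) b] by simp
  qed (use a b in auto)
  then show ?thesis using a by (simp add: c.class_is_nil)
qed

text \<open>Otherwise the multiples of \<open>p\<close> would form an infinite chain of
  steps.\<close>

lemma P_nilpotent:
  assumes p: "p \<in> P" shows "\<exists>n::nat. n > 0 \<and> tmono K (p [^] n) \<in> V"
proof (rule ccontr)
  assume n: "\<not> ?thesis"
  have pc: "p \<in> carrier Q" using p P_sub by simp
  have "(p [^] Suc i, p [^] i) \<in> step_rel" for i :: nat
  proof -
    have "tmono K (p [^] Suc i) \<notin> V" using n by blast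
    then have "tmono K (loc (p [^] i \<otimes> p)) \<notin> X.W" using V_mono_iff[of "p [^] i \<otimes> p"] pc by simp
    then show ?thesis using p pc unfolding step_rel_def by auto
  qed
  then show False using wf_step unfolding wf_iff_no_infinite_down_chain by blast
qed

lemma F_cancel:
  assumes m: "a \<in> carrier Q" "b \<in> carrier Q" and f: "f \<in> F" and t: "(a \<otimes> f, b \<otimes> f) \<in> sim"
  shows "(a, b) \<in> sim"
proof -
  have fc: "f \<in> carrier Q" using f F_sub by simp
  obtain d where d: "d \<in> carrier K" "d \<noteq> \<zero>\<^bsub>K\<^esub>" "binomial K Q (a \<otimes> f) d (b \<otimes> f) \<in> V"
    using t by (rule dom.congE)
  have "tmono K (loc f) \<otimes>\<^sub>A binomial K N (loc a) d (loc b) \<in> X.W"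
    using V_binomial_iff[of "a \<otimes> f" "b \<otimes> f" d] d m fc
    by (simp add: cod.tmono_mult_binomial N.m_comm)
  then have "binomial K N (loc a) d (loc b) \<in> X.W"
    by (rule cod.unit_binomial_cancel[OF X.W_ideal to_loc_unit[OF f], rotated]) (use m d in simp)
  then show ?thesis using V_binomial_iff[OF m d(1)] d m by (intro dom.congI[of _ _ d]) auto
qed

lemma V_proper: "tmono K \<one> \<notin> V"
  using V_mono_iff[of "\<one>"] X.one_notin_W by simp

text \<open>An element of P has a nil multiple n a. Both n a and 2 n a are nil, hence congruent, and
  cancelling n a would make the neutral element nil, although \<open>V\<close> is proper.\<close>

lemma cancellative_F:
  assumes a: "a \<in> carrier Q" and ca: "cancellative c.R (sim `` {a})"
  shows "a \<in> F"
proof (rule ccontr)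
  assume "a \<notin> F"
  then obtain n :: nat where n: "tmono K (a [^] n) \<in> V" using F_or_P[OF a] P_nilpotent by blast
  have ca': "(x, y) \<in> sim" if "x \<in> carrier Q" "y \<in> carrier Q" "(x \<otimes> a, y \<otimes> a) \<in> sim" for x y
    using ca a that by (simp add: c.class_cancellative)
  have pw: "x \<in> carrier Q \<Longrightarrow> y \<in> carrier Q \<Longrightarrow> (x \<otimes> a [^] m, y \<otimes> a [^] m) \<in> sim \<Longrightarrow> (x, y) \<in> sim" for x y and m :: nat
  proof (induction m arbitrary: x y)
    case (Suc m)
    have "((x \<otimes> a [^] m) \<otimes> a, (y \<otimes> a [^] m) \<otimes> a) \<in> sim"
      using Suc.prems a by (simp add: Q.m_assoc)
    then have "(x \<otimes> a [^] m, y \<otimes> a [^] m) \<in> sim"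
      by (rule ca'[rotated 2]) (use Suc.prems a in auto)
    then show ?case by (rule Suc.IH[OF Suc.prems(1,2)])
  qed simp
  have an: "a [^] n \<in> carrier Q" using a by simp
  have "(\<one> \<otimes> a [^] n, a [^] n \<otimes> a [^] n) \<in> sim"
    by (rule dom.cong_both_mono[OF V_ideal]) (use an n dom.mono_mult[OF V_ideal an an n] in auto)
  then have "(\<one>, a [^] n) \<in> sim" using pw an by blast
  then show False using dom.cong_mono_iff[OF V_ideal] n V_proper by blast
qed

text \<open>For the last condition, representatives of cancellative classes lie outside P and become
  units. Since q + a is not nil, some translate of the relation between q + a and q + b lies in
  \<open>C\<close>; \<open>X.W_units\<close> then yields the relation between \<open>a\<close> and
  \<open>b\<close> alone.\<close>

lemma mesoprimary_cong_V: "mesoprimary_cong Q P sim"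
  unfolding mesoprimary_cong_def primary_cong_def
proof (intro conjI ballI allI impI)
  show "monoid_cong Q sim" by (rule c.cong)
  fix p assume p: "p \<in> P"
  then obtain n :: nat where n: "n > 0" "tmono K (p [^] n) \<in> V" using P_nilpotent by blast
  have pc: "p \<in> carrier Q" using p P_sub by simp
  have "is_nil c.R (sim `` {p} [^]\<^bsub>c.R\<^esub> n)"
    using V_mono_nil[OF _ n(2)] pc by (simp add: c.class_pow)
  then show "nilpotent_elem c.R (sim `` {p})" using n(1) pc by (auto simp: nilpotent_elem_def)
next
  fix f assume "f \<in> carrier Q - P"
  then have f: "f \<in> F" by (simp add: F_def)
  then show "cancellative c.R (sim `` {f})" using F_cancel[OF _ _ f] F_sub[OF f] by (simp add: c.class_cancellative)
next
  fix x y z assume x: "x \<in> carrier c.R" and h: "cancellative c.R y \<and> cancellative c.R z \<and>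
    x \<otimes>\<^bsub>c.R\<^esub> y = x \<otimes>\<^bsub>c.R\<^esub> z \<and> \<not> is_nil c.R (x \<otimes>\<^bsub>c.R\<^esub> y)"
  have yz: "y \<in> carrier c.R" "z \<in> carrier c.R" using h by (auto simp: cancellative_def)
  obtain q a b where m: "q \<in> carrier Q" "a \<in> carrier Q" "b \<in> carrier Q"
    and e: "x = sim `` {q}" "y = sim `` {a}" "z = sim `` {b}" using x yz by (auto simp: c.R_carrier)
  have ab: "a \<in> F" "b \<in> F" using h m e cancellative_F by auto
  have "(q \<otimes> a, q \<otimes> b) \<in> sim" using h m e by (simp add: c.class_mult c.class_eq)
  then obtain d where d: "d \<in> carrier K" "d \<noteq> \<zero>\<^bsub>K\<^esub>" "binomial K Q (q \<otimes> a) d (q \<otimes> b) \<in> V"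
    by (rule dom.congE)
  have dW: "binomial K N (loc (q \<otimes> a)) d (loc (q \<otimes> b)) \<in> X.W"
    using V_binomial_iff[of "q \<otimes> a" "q \<otimes> b" d] d m by simp
  have "tmono K (q \<otimes> a) \<notin> V" using V_mono_nil[of "q \<otimes> a"] h m e by (auto simp: c.class_mult)
  then obtain t where t: "t \<in> carrier N" "t \<otimes>\<^sub>N loc (q \<otimes> a) \<in> X.C"
    using V_mono_iff[of "q \<otimes> a"] X.W_mono_iff[of "loc (q \<otimes> a)"] m by auto
  note t2 = X.W_binD(1)[OF _ _ d(1) dW t]
  have as: "t \<otimes>\<^sub>N loc (q \<otimes> a) = (t \<otimes>\<^sub>N loc q) \<otimes>\<^sub>N loc a"
    "t \<otimes>\<^sub>N loc (q \<otimes> b) = (t \<otimes>\<^sub>N loc q) \<otimes>\<^sub>N loc b" using t(1) m by (simp_all add: N.m_assoc)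
  have "binomial K N (loc a) d (loc b) \<in> X.W"
    by (rule X.W_units[OF to_loc_unit[OF ab(1)] to_loc_unit[OF ab(2)] d(1), of "t \<otimes>\<^sub>N loc q"])
      (use t2 t m in \<open>simp_all only: as[symmetric] N.m_closed to_loc_closed Q.m_closed\<close>)
  then have "(a, b) \<in> sim" using V_binomial_iff[OF m(2,3) d(1)] d m by (intro dom.congI[of _ _ d]) auto
  then show "y = z" using e m by (simp add: c.class_eq)
qed

text \<open>A larger ideal with the same congruence has the same monomials: an exponent in P is
  congruent to a multiple whose monomial is in \<open>V\<close>, and one outside P would be
  congruent to the neutral element, which would make the ideal improper. A coefficient different
  from the one in \<open>V\<close> would force both monomials into \<open>J\<close>, hence into
  \<open>V\<close>.\<close>

lemma V_maximal:
  assumes b: "dom.bin J" and ne: "J \<noteq> carrier AQ" and cg: "ideal_cong K Q J = sim" and sub: "V \<subseteq> J"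
  shows "J = V"
proof
  have J: "ideal J AQ" using b by (rule dom.bin_ideal)
  have one: "tmono K \<one> \<notin> J"
  proof
    assume "tmono K \<one> \<in> J"
    then have o: "\<one>\<^bsub>AQ\<^esub> \<in> J" by (simp add: dom.A_one)
    have "f \<in> J" if "f \<in> carrier AQ" for f using dom.ideal_facts(6)[OF J o that] that by simp
    then show False using ne dom.ideal_facts(1)[OF J] by blast
  qed
  have mono: "tmono K a \<in> V" if a: "a \<in> carrier Q" and aJ: "tmono K a \<in> J" for a
  proof (cases "a \<in> P")
    case True
    then obtain n :: nat where n: "tmono K (a [^] n) \<in> V" using P_nilpotent by blast
    then have "(a, a [^] n) \<in> sim" using dom.cong_both_mono[OF J a _ aJ] sub a cg by auto
    then show ?thesis using dom.cong_mono_iff[OF V_ideal] n by blast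
  next
    case False
    then have f: "a \<in> F" using a by (simp add: F_def)
    have "(a \<otimes> a, \<one> \<otimes> a) \<in> sim"
      unfolding cg[symmetric]
      by (rule dom.cong_both_mono[OF J]) (use a aJ dom.mono_mult[OF J a a aJ] in auto)
    then have "(a, \<one>) \<in> ideal_cong K Q J" using F_cancel[OF a _ f] cg by simp
    then show ?thesis using dom.cong_mono_iff[OF J] aJ one by blast
  qed
  show "J \<subseteq> V"
  proof (rule dom.bin_sub_ideal[OF b V_ideal])
    fix x k y assume m: "x \<in> carrier Q" "y \<in> carrier Q" "k \<in> carrier K" and t: "binomial K Q x k y \<in> J"
    show "binomial K Q x k y \<in> V"
    proof (cases "k = \<zero>\<^bsub>K\<^esub>")
      case True
      then show ?thesis using mono m t by (simp add: dom.mono_iff_binomial)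
    next
      case False
      then have "(x, y) \<in> sim" unfolding cg[symmetric] using m t by (intro dom.congI)
      then obtain d where d: "d \<in> carrier K" "binomial K Q x d y \<in> V" by (rule dom.congE)
      show ?thesis
      proof (cases "d = k")
        case True then show ?thesis using d by simp
      next
        case False
        have y: "tmono K y \<in> J" using dom.binomial_unique[OF J m(1,2) d(1) m(3) _ t False] d sub by blast
        have x: "tmono K x \<in> J" using dom.binomial_mono_left[OF J m t y] .
        show ?thesis using dom.mono_bin[OF V_ideal m] mono x y m by blast
      qed
    qed
  qed
  show "V \<subseteq> J" by fact
qed

lemma mesoprimary_V: "mesoprimary_ideal K Q P V"
proof -
  have "V \<noteq> carrier AQ" using V_proper dom.A.one_closed by (auto simp: dom.A_one)
  then show ?thesis
    unfolding mesoprimary_ideal_def dom.bin_iff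
    using mesoprimary_cong_V V_bin V_maximal by blast
qed

end

section \<open>Essential witnesses\<close>

context loc_alg
begin

text \<open>Everything follows from the aide \<open>q\<close>: whenever \<open>q\<close> divides
  \<open>w\<close>, also \<open>w\<close> divides \<open>q\<close>. If t^w were in the localized
  ideal, the nil \<open>w\<close> would be divisible by \<open>q\<close>, so \<open>q\<close> would
  be nil too and congruent to \<open>w\<close>. If w + e divided \<open>w\<close>, for e a multiple
  of P, then \<open>q\<close> would divide \<open>w\<close>, and the chain below again identifies
  the two.\<close>

lemma key_witness_component:
  assumes fg: "fin_gen_monoid Q" and bI: "dom.bin I" and kw: "key_witness Q P (ideal_cong K Q I) w"
  shows "component K Q P I w"
proof -
  have I: "ideal I AQ" using bI by (rule dom.bin_ideal)
  have J: "ideal (LI I) AN" by (rule LI_ideal(1)[OF I])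
  define r where "r = ideal_cong K N (LI I)"
  interpret c: cong_monoid N r unfolding r_def by unfold_locales (rule cod.cong_monoid_cong[OF J])
  have r: "loc_cong Q P (ideal_cong K Q I) = r" by (simp add: r_def loc_cong_eq[OF I])
  obtain q where wQ: "w \<in> carrier Q" and ka: "key_aide Q P (ideal_cong K Q I) w q"
    using kw by (auto simp: key_witness_def)
  note ka = ka[unfolded key_aide_def loc_bar_def loc_quot_def r]
  have q: "q \<in> carrier Q" using ka by blast
  have wq: "loc w \<in> carrier N" "loc q \<in> carrier N" using wQ q by auto
  have ne: "(loc w, loc q) \<notin> r" using ka c.class_eq[OF wq] by blast
  have p: "(loc w \<otimes>\<^sub>N loc p, loc q \<otimes>\<^sub>N loc p) \<in> r" if "p \<in> P" for p
  proof -
    have pc: "loc p \<in> carrier N" using P_sub[OF that] by simp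
    have "r `` {loc w} \<otimes>\<^bsub>c.R\<^esub> r `` {loc p} = r `` {loc q} \<otimes>\<^bsub>c.R\<^esub> r `` {loc p}" using ka that by blast
    then show ?thesis using wq pc by (simp add: c.class_mult c.class_eq)
  qed
  have "\<not> green_less c.R (r `` {loc q}) (r `` {loc w})" using ka by blast
  then have gl: "(\<exists>z\<in>carrier N. (loc w, loc q \<otimes>\<^sub>N z) \<in> r) \<Longrightarrow> (\<exists>z\<in>carrier N. (loc q, loc w \<otimes>\<^sub>N z) \<in> r)"
    using c.class_green_less[OF wq(2,1)] by blast
  note mono = cod.cong_mono_iff[OF J, folded r_def]
  note both = cod.cong_both_mono[OF J, folded r_def]
  show ?thesis
  proof unfold_locales
    show "fin_gen_monoid Q" "dom.bin I" "w \<in> carrier Q" by fact+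
    show "tmono K (loc w) \<notin> LI I"
    proof
      assume w0: "tmono K (loc w) \<in> LI I"
      have q0: "tmono K (loc q) \<notin> LI I" using both[OF _ _ w0] ne wQ q by auto
      have "tmono K (loc q \<otimes>\<^sub>N loc w) \<in> LI I" using cod.mono_mult[OF J _ _ w0] wQ q by simp
      then have "(loc w, loc q \<otimes>\<^sub>N loc w) \<in> r" using both[OF _ _ w0] wQ q by simp
      then obtain z where z: "z \<in> carrier N" "(loc q, loc w \<otimes>\<^sub>N z) \<in> r" using gl wQ by blast
      have "tmono K (loc w \<otimes>\<^sub>N z) \<in> LI I"
        using cod.mono_mult[OF J _ z(1) w0] wQ z(1) by (simp add: N.m_comm)
      then show False using mono[OF z(2)] q0 by blast
    qed
    fix p' x assume p': "p' \<in> P" and x: "x \<in> carrier N"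
    show "(loc w, loc w \<otimes>\<^sub>N (loc p' \<otimes>\<^sub>N x)) \<notin> ideal_cong K N (LI I)"
      unfolding r_def[symmetric]
    proof
      have pc: "loc p' \<in> carrier N" using p' P_sub by simp
      have wc: "loc w \<in> carrier N" "loc q \<in> carrier N" using wQ q by auto
      define e where "e = loc p' \<otimes>\<^sub>N x"
      have e: "e \<in> carrier N" using pc x by (simp add: e_def)
      assume 1: "(loc w, loc w \<otimes>\<^sub>N (loc p' \<otimes>\<^sub>N x)) \<in> r"
      have 2: "(loc w \<otimes>\<^sub>N e, loc q \<otimes>\<^sub>N e) \<in> r"
        using c.r_mult[OF p[OF p'] x] pc wc x by (simp add: e_def N.m_assoc)
      have we: "(loc w, loc w \<otimes>\<^sub>N e) \<in> r" using 1 by (simp add: e_def)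
      have wqe: "(loc w, loc q \<otimes>\<^sub>N e) \<in> r" using c.r_trans[OF we 2] .
      then obtain z where z: "z \<in> carrier N" "(loc q, loc w \<otimes>\<^sub>N z) \<in> r" using gl e by blast
      \<comment> \<open>With q congruent to w + z and w to w + e, the chain is w, q + e, w + e + z,
        w + z, q.\<close>
      have 3: "(loc q \<otimes>\<^sub>N e, (loc w \<otimes>\<^sub>N e) \<otimes>\<^sub>N z) \<in> r"
        using c.r_mult[OF z(2) e] wc z(1) e by (simp add: N.m_ac)
      have 4: "((loc w \<otimes>\<^sub>N e) \<otimes>\<^sub>N z, loc w \<otimes>\<^sub>N z) \<in> r" using c.r_mult[OF c.r_sym[OF we] z(1)] .
      have "(loc w, loc q) \<in> r"
        using c.r_trans[OF c.r_trans[OF c.r_trans[OF wqe 3] 4] c.r_sym[OF z(2)]] .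
      then show False using ne by simp
    qed
  qed
qed

lemma res_eq: "cod.res d f = (\<lambda>x. if x \<in> d then f x else \<zero>\<^bsub>K\<^esub>)"
  by (simp add: cod.res_def)

text \<open>Suppose \<open>w\<close> is congruent to w + e with e a multiple of P. The part of t^e f
  in the degree of \<open>w\<close> vanishes, but it collects contributions from all degrees that
  \<open>e\<close> moves to that of \<open>w\<close>. Minimality removes every such degree except
  that of \<open>w\<close> itself, so t^(w + e) lies in the localized ideal, and with it t^w, a
  contradiction.\<close>

lemma socle_component:
  assumes fg: "fin_gen_monoid Q" and bI: "dom.bin I" and wQ: "w \<in> carrier Q"
    and f: "f \<in> carrier AN"
    and ann: "\<And>p. p \<in> P \<Longrightarrow> tmono K (loc p) \<otimes>\<^sub>A f \<in> LI I"
    and nz: "loc_bar Q P (ideal_cong K Q I) w \<in> nonzero_degrees K Q P I f"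
    and min: "\<And>d. d \<in> nonzero_degrees K Q P I f \<Longrightarrow>
      \<not> green_less (loc_quot Q P (ideal_cong K Q I)) d (loc_bar Q P (ideal_cong K Q I) w)"
  shows "component K Q P I w"
proof -
  have I: "ideal I AQ" using bI by (rule dom.bin_ideal)
  have bJ: "cod.bin (LI I)" by (rule LI_bin[OF bI])
  have J: "ideal (LI I) AN" by (rule LI_ideal(1)[OF I])
  note Jf = cod.ideal_facts[OF J]
  define r where "r = ideal_cong K N (LI I)"
  interpret c: cong_monoid N r unfolding r_def by unfold_locales (rule cod.cong_monoid_cong[OF J])
  have r: "loc_cong Q P (ideal_cong K Q I) = r" by (simp add: r_def loc_cong_eq[OF I])
  have wc: "loc w \<in> carrier N" using wQ by simp
  define E where "E = r `` {loc w}"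
  have E_iff: "y \<in> E \<longleftrightarrow> (y, loc w) \<in> r" for y using c.r_sym by (auto simp: E_def)
  have Enz: "cod.res E f \<notin> LI I"
    using nz by (simp add: nonzero_degrees_def loc_bar_def r E_def res_eq)
  obtain k h where k: "k \<in> carrier K" and h: "h \<in> LI I" and kh: "cod.res E f = h \<oplus>\<^sub>A mterm K k (loc w)"
    using cod.class_decomp[OF J wc f] by (auto simp: E_def r_def)
  have hA: "h \<in> carrier AN" using h Jf(1) by auto
  have k0: "k \<noteq> \<zero>\<^bsub>K\<^esub>" using Enz kh h hA by auto
  have w0: "tmono K (loc w) \<notin> LI I"
  proof
    assume "tmono K (loc w) \<in> LI I"
    then have "mterm K k (loc w) \<in> LI I" using cod.mterm_in[OF J wc k] by simp
    then show False using Enz kh Jf(3)[OF h] by simp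
  qed
  \<comment> \<open>A nonzero degree y with y + e congruent to w divides \<open>w\<close>, so by
    minimality y is congruent to w + z. Adding \<open>e\<close> to w + z changes nothing modulo the
    congruence, so y is congruent to y + e, that is, to \<open>w\<close>.\<close>
  have below: "(y, loc w) \<in> r" if y: "y \<in> carrier N" and ny: "cod.res (r `` {y}) f \<notin> LI I"
    and e: "e \<in> carrier N" and wye: "(loc w, y \<otimes>\<^sub>N e) \<in> r" and we: "(loc w, loc w \<otimes>\<^sub>N e) \<in> r" for y e
  proof -
    have "r `` {y} \<in> nonzero_degrees K Q P I f"
      using y ny by (simp add: nonzero_degrees_def loc_quot_def r res_eq)
    then have "\<not> green_less c.R (r `` {y}) (r `` {loc w})"
      using min by (simp add: loc_bar_def loc_quot_def r)
    then obtain z where z: "z \<in> carrier N" "(y, loc w \<otimes>\<^sub>N z) \<in> r"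
      using y wc e wye by (auto simp: c.class_green_less)
    have "(y \<otimes>\<^sub>N e, (loc w \<otimes>\<^sub>N e) \<otimes>\<^sub>N z) \<in> r"
      using c.r_mult[OF z(2) e] wc z(1) e by (simp add: N.m_ac)
    moreover have "((loc w \<otimes>\<^sub>N e) \<otimes>\<^sub>N z, loc w \<otimes>\<^sub>N z) \<in> r" using c.r_mult[OF c.r_sym[OF we] z(1)] .
    ultimately have "(loc w, y) \<in> r"
      using wye z(2) by (meson c.r_trans c.r_sym)
    then show ?thesis by (rule c.r_sym)
  qed
  show ?thesis
  proof unfold_locales
    show "fin_gen_monoid Q" "dom.bin I" "w \<in> carrier Q" "tmono K (loc w) \<notin> LI I" by fact+
    fix p x assume p: "p \<in> P" and x: "x \<in> carrier N"
    show "(loc w, loc w \<otimes>\<^sub>N (loc p \<otimes>\<^sub>N x)) \<notin> ideal_cong K N (LI I)"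
      unfolding r_def[symmetric]
    proof
      have pc: "loc p \<in> carrier N" using p P_sub by simp
      define e where "e = loc p \<otimes>\<^sub>N x"
      have e: "e \<in> carrier N" using pc x by (simp add: e_def)
      assume "(loc w, loc w \<otimes>\<^sub>N (loc p \<otimes>\<^sub>N x)) \<in> r"
      then have we: "(loc w, loc w \<otimes>\<^sub>N e) \<in> r" by (simp add: e_def)
      \<comment> \<open>\<open>E'\<close> consists of the exponents that \<open>e\<close> moves to
        the degree of \<open>w\<close>; it contains \<open>E\<close> because \<open>e\<close> fixes
        this degree, and \<open>D\<close> holds the unwanted rest.\<close>
      define E' where "E' = {y. e \<otimes>\<^sub>N y \<in> E}"
      define D where "D = E' - E"
      have Esat: "cod.saturated r E" unfolding E_def r_def by (rule cod.saturated_class[OF J])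
      then have E'sat: "cod.saturated r E'" unfolding E'_def r_def
        by (intro cod.saturated_translate[OF J _ e])
      then have Dsat: "cod.saturated r D" using Esat unfolding cod.saturated_def D_def by blast
      have "E \<subseteq> E'"
      proof
        fix y assume "y \<in> E"
        then have yw: "(y, loc w) \<in> r" by (simp add: E_iff)
        have yc: "y \<in> carrier N" using c.r_carrier[OF yw] by simp
        have "(e \<otimes>\<^sub>N y, loc w \<otimes>\<^sub>N e) \<in> r" using c.r_mult[OF yw e] yc e by (simp add: N.m_comm)
        then show "y \<in> E'" using c.r_trans c.r_sym[OF we] by (auto simp: E'_def E_iff)
      qed
      then have E'D: "E' = E \<union> D" by (auto simp: D_def)
      have rD: "cod.res D f \<in> LI I"
      proof (rule cod.graded_sum[OF J cod.res_closed[OF f]])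
        fix y assume y: "y \<in> carrier N"
        show "cod.res (ideal_cong K N (LI I) `` {y}) (cod.res D f) \<in> LI I"
          unfolding r_def[symmetric]
        proof (cases "y \<in> D")
          case True
          then have "r `` {y} \<subseteq> D" using Dsat by (auto simp: cod.saturated_def)
          then have eq: "cod.res (r `` {y}) (cod.res D f) = cod.res (r `` {y}) f"
            by (auto simp: cod.res_def fun_eq_iff)
          have "(y \<otimes>\<^sub>N e, loc w) \<in> r" "(y, loc w) \<notin> r"
            using True y e by (auto simp: D_def E'_def E_iff N.m_comm)
          then have "cod.res (r `` {y}) f \<in> LI I"
            using below[OF y _ e c.r_sym we] by blast
          then show "cod.res (r `` {y}) (cod.res D f) \<in> LI I" by (simp add: eq)
        next
          case False
          then have "r `` {y} \<inter> D = {}" using Dsat by (auto simp: cod.saturated_def)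
          then have "cod.res (r `` {y}) (cod.res D f) = \<zero>\<^sub>A"
            by (auto simp: cod.res_def cod.A_zero fun_eq_iff)
          then show "cod.res (r `` {y}) (cod.res D f) \<in> LI I" using Jf(2) by simp
        qed
      qed
      have "tmono K e \<otimes>\<^sub>A f = tmono K x \<otimes>\<^sub>A (tmono K (loc p) \<otimes>\<^sub>A f)"
        using x pc f by (simp add: e_def cod.A_assoc[symmetric] cod.mterm_mult N.m_comm)
      also have "\<dots> \<in> LI I" using Jf(6)[OF ann[OF p]] x by simp
      finally have ef: "tmono K e \<otimes>\<^sub>A f \<in> LI I" .
      have "cod.res E (tmono K e \<otimes>\<^sub>A f) \<in> LI I"
        by (rule cod.res_in[OF bJ _ ef]) (use Esat in \<open>simp add: r_def\<close>)
      then have "tmono K e \<otimes>\<^sub>A cod.res E' f \<in> LI I"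
        using e f by (simp add: cod.res_mult_mterm E'_def)
      moreover have "cod.res E' f = (mterm K k (loc w) \<oplus>\<^sub>A h) \<oplus>\<^sub>A cod.res D f"
        unfolding E'D using cod.res_disjoint[OF f, of E D] kh hA k wc by (auto simp: D_def cod.A.a_comm)
      ultimately have "(tmono K e \<otimes>\<^sub>A mterm K k (loc w) \<oplus>\<^sub>A tmono K e \<otimes>\<^sub>A h) \<oplus>\<^sub>A tmono K e \<otimes>\<^sub>A cod.res D f \<in> LI I"
        using e k wc hA f by (simp add: cod.A_r_distr)
      then have "tmono K e \<otimes>\<^sub>A mterm K k (loc w) \<oplus>\<^sub>A tmono K e \<otimes>\<^sub>A h \<in> LI I"
        by (rule cod.ideal_cancel[OF J, rotated]) (use e k wc hA Jf(6)[OF rD] in auto)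
      then have "tmono K e \<otimes>\<^sub>A mterm K k (loc w) \<in> LI I"
        by (rule cod.ideal_cancel[OF J, rotated]) (use e k wc hA Jf(6)[OF h] in auto)
      then have "mterm K k (loc w \<otimes>\<^sub>N e) \<in> LI I"
        using e k wc by (simp add: cod.mterm_mult N.m_comm)
      then have "tmono K (loc w \<otimes>\<^sub>N e) \<in> LI I"
        by (rule cod.mterm_in_ideal[OF J k k0, rotated]) (use e wc in simp)
      then show False using w0 cod.cong_mono_iff[OF J we[unfolded r_def]] by blast
    qed
  qed
qed

lemma essential_witness_component:
  assumes fg: "fin_gen_monoid Q" and bI: "dom.bin I" and ew: "essential_witness K Q P I w"
  shows "component K Q P I w"
proof -
  have wQ: "w \<in> carrier Q" using ew by (simp add: essential_witness_def)
  show ?thesis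
  proof (cases "key_witness Q P (ideal_cong K Q I) w")
    case True
    then show ?thesis by (rule key_witness_component[OF fg bI])
  next
    case False
    then obtain f where f: "f \<in> carrier AN"
      and a: "\<And>g. g \<in> max_monomial_ideal K Q P \<Longrightarrow> push g \<otimes>\<^sub>A f \<in> LI I"
      and nz: "loc_bar Q P (ideal_cong K Q I) w \<in> nonzero_degrees K Q P I f"
      and min: "\<And>d. d \<in> nonzero_degrees K Q P I f \<Longrightarrow>
        \<not> green_less (loc_quot Q P (ideal_cong K Q I)) d (loc_bar Q P (ideal_cong K Q I) w)"
      using ew unfolding essential_witness_def loc_hom_eq by blast
    have "tmono K ` P \<subseteq> carrier AQ" using P_sub by auto
    then have "tmono K ` P \<subseteq> max_monomial_ideal K Q P"
      unfolding max_monomial_ideal_def by (rule dom.A.genideal_self)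
    then have "tmono K (loc p) \<otimes>\<^sub>A f \<in> LI I" if "p \<in> P" for p
      using a[of "tmono K p"] that P_sub by (auto simp: push_mterm)
    then show ?thesis using socle_component[OF fg bI wQ f _ nz min] by blast
  qed
qed

text \<open>Every nonzero degree of the image of \<open>g\<close> contains the image of a point of
  the support of \<open>g\<close>. Hence there are finitely many of them, a minimal one exists, and
  it is the class of an element of the monoid before localization, as a witness has to be.\<close>

lemma exists_socle_degree:
  assumes bI: "dom.bin I" and g: "g \<in> carrier AQ" and gI: "push g \<notin> LI I"
    and ann: "\<And>p. p \<in> P \<Longrightarrow> tmono K p \<otimes>\<^bsub>AQ\<^esub> g \<in> I"
  shows "\<exists>w. essential_witness K Q P I w \<and> cod.res (ideal_cong K N (LI I) `` {loc w}) (push g) \<notin> LI I"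
proof -
  have I: "ideal I AQ" using bI by (rule dom.bin_ideal)
  have J: "ideal (LI I) AN" by (rule LI_ideal(1)[OF I])
  define r where "r = ideal_cong K N (LI I)"
  interpret c: cong_monoid N r unfolding r_def by unfold_locales (rule cod.cong_monoid_cong[OF J])
  have r: "loc_cong Q P (ideal_cong K Q I) = r" by (simp add: r_def loc_cong_eq[OF I])
  define f where "f = push g"
  have f: "f \<in> carrier AN" using g by (simp add: f_def)
  define S where "S = {a \<in> dom.supp g. cod.res (r `` {loc a}) f \<notin> LI I}"
  have rep: "\<exists>a\<in>S. r `` {x} = r `` {loc a}" if x: "x \<in> carrier N" and nx: "cod.res (r `` {x}) f \<notin> LI I" for x
  proof -
    have "cod.res (r `` {x}) f \<noteq> \<zero>\<^sub>A" using nx cod.ideal_facts(2)[OF J] by auto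
    then obtain y where y: "(x, y) \<in> r" "f y \<noteq> \<zero>\<^bsub>K\<^esub>" by (auto simp: cod.res_def cod.A_zero fun_eq_iff split: if_splits)
    have "{q. g q \<noteq> \<zero>\<^bsub>K\<^esub> \<and> loc q = y} \<noteq> {}"
    proof
      assume "{q. g q \<noteq> \<zero>\<^bsub>K\<^esub> \<and> loc q = y} = {}"
      then have "f y = \<zero>\<^bsub>K\<^esub>" unfolding f_def push_def by (simp only: K.finsum_empty)
      then show False using y(2) by simp
    qed
    then obtain a where a: "a \<in> dom.supp g" "loc a = y" by (auto simp: dom.supp_def)
    have "r `` {x} = r `` {loc a}" using y(1) a(2) c.r_carrier[OF y(1)] c.class_eq by auto
    then show ?thesis using a(1) nx by (auto simp: S_def)
  qed
  have Sfin: "finite S" unfolding S_def using dom.supp_finite[OF g] by simp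
  have SQ: "a \<in> carrier Q" if "a \<in> S" for a using that dom.supp_carrier[OF g] by (auto simp: S_def)
  have Sne: "S \<noteq> {}"
  proof
    assume "S = {}"
    then have "cod.res (ideal_cong K N (LI I) `` {x}) f \<in> LI I" if "x \<in> carrier N" for x
      using rep[OF that] unfolding r_def by blast
    then have "f \<in> LI I" by (rule cod.graded_sum[OF J f])
    then show False using gI by (simp add: f_def)
  qed
  let ?less = "\<lambda>a b. green_less c.R (r `` {loc a}) (r `` {loc b})"
  have "\<exists>m\<in>S. \<forall>x\<in>S. x \<noteq> m \<longrightarrow> \<not> ?less x m"
    by (rule Finite_Set.bex_min_element[OF Sfin _ _ Sne])
      (auto simp: asymp_on_def transp_on_def green_less_def green_le_def)
  then obtain w where w: "w \<in> S" "\<And>x. x \<in> S \<Longrightarrow> \<not> ?less x w"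
    by (metis green_less_def)
  have wQ: "w \<in> carrier Q" using SQ w(1) .
  have annf: "push g' \<otimes>\<^sub>A f \<in> LI I" if "g' \<in> max_monomial_ideal K Q P" for g'
  proof -
    \<comment> \<open>The annihilator of \<open>g\<close> modulo \<open>I\<close> is an ideal, which
      extends \<open>ann\<close> from the monomials t^p to the ideal they generate.\<close>
    define L where "L = {g' \<in> carrier AQ. g' \<otimes>\<^bsub>AQ\<^esub> g \<in> I}"
    note If = dom.ideal_facts[OF I]
    have L: "ideal L AQ"
      by (rule dom.ideal_intro)
        (use g If in \<open>auto simp: L_def dom.A_zero_mult dom.A_l_distr dom.A_assoc\<close>)
    have "max_monomial_ideal K Q P \<subseteq> L"
      unfolding max_monomial_ideal_def
      by (rule dom.A.genideal_minimal[OF L]) (use ann P_sub in \<open>auto simp: L_def\<close>)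
    then have g': "g' \<in> carrier AQ" "g' \<otimes>\<^bsub>AQ\<^esub> g \<in> I" using that by (auto simp: L_def)
    then have "push (g' \<otimes>\<^bsub>AQ\<^esub> g) \<in> LI I" using LI_ideal(2)[OF I] by blast
    then show ?thesis using g g' by (simp add: f_def push_mult)
  qed
  have nd: "d \<in> nonzero_degrees K Q P I f \<longleftrightarrow> d \<in> carrier c.R \<and> cod.res d f \<notin> LI I" for d
    by (simp add: nonzero_degrees_def loc_quot_def r res_eq)
  have "essential_witness K Q P I w"
    unfolding essential_witness_def loc_hom_eq loc_bar_def loc_quot_def r
  proof (intro conjI disjI2 bexI[OF _ f] ballI)
    show "w \<in> carrier Q" by (rule wQ)
    show "push g' \<otimes>\<^sub>A f \<in> LI I" if "g' \<in> max_monomial_ideal K Q P" for g' using annf that .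
    show "r `` {loc w} \<in> nonzero_degrees K Q P I f" using w(1) wQ by (simp add: nd S_def)
    fix d assume "d \<in> nonzero_degrees K Q P I f"
    then obtain x where "d = r `` {x}" "x \<in> carrier N" "cod.res (r `` {x}) f \<notin> LI I"
      by (auto simp: nd c.R_carrier)
    then obtain a where "a \<in> S" "d = r `` {loc a}" using rep by blast
    then show "\<not> green_less c.R d (r `` {loc w})" using w(2) by simp
  qed
  then show ?thesis using w(1) by (auto simp: S_def r_def f_def)
qed

end

theorem theorem5p7:
  fixes K :: "('k, 'y) ring_scheme"
    and Q :: "('q, 'x) monoid_scheme"
    and I :: "('q \<Rightarrow> 'k) set"
  assumes "field K"
    and "comm_monoid Q"
    and "fin_gen_monoid Q"
    and "binomial_ideal K Q I"
  shows "carrier (monoid_algebra K Q) \<inter>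
           \<Inter>{binoccular_component K Q P I w |P w.
               monoid_prime Q P \<and> essential_witness K Q P I w} = I \<and>
         (\<forall>P w. monoid_prime Q P \<and> essential_witness K Q P I w \<longrightarrow>
           mesoprimary_ideal K Q P (binoccular_component K Q P I w) \<and>
           (\<forall>c. cogenerator K Q P (binoccular_component K Q P I w) c \<longrightarrow>
              mesoprime K Q P I c = mesoprime K Q P (binoccular_component K Q P I w) c))"
proof -
  let ?A = "monoid_algebra K Q"
  interpret KQ: monoid_alg K Q using assms(1,2) by (simp add: monoid_alg_def)
  have b: "KQ.bin I" using assms(4) KQ.bin_iff by blast
  then have I: "ideal I ?A" by (rule KQ.bin_ideal)
  have loc: "loc_alg K Q P" if "monoid_prime Q P" for P
    using assms(1,2) that by (simp add: loc_alg_def localization_def localization_axioms_def)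
  have comp: "component K Q P I w" if "monoid_prime Q P" "essential_witness K Q P I w" for P w
    using loc_alg.essential_witness_component[OF loc[OF that(1)] assms(3) b that(2)] .
  have in_I: "f \<in> I" if f: "f \<in> carrier ?A"
    and fV: "\<And>P w. monoid_prime Q P \<Longrightarrow> essential_witness K Q P I w \<Longrightarrow> f \<in> binoccular_component K Q P I w" for f
  proof (rule ccontr)
    assume "f \<notin> I"
    then obtain s where s: "s \<in> carrier Q"
      and pr: "monoid_prime Q {q \<in> carrier Q. tmono K q \<otimes>\<^bsub>?A\<^esub> (tmono K s \<otimes>\<^bsub>?A\<^esub> f) \<in> I}"
      using KQ.exists_associated_prime[OF assms(3) I f] by blast
    define g where "g = tmono K s \<otimes>\<^bsub>?A\<^esub> f"
    \<comment> \<open>The choice of P serves twice: its elements annihilate \<open>g\<close> modulo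
      \<open>I\<close>, and no element of its complement does.\<close>
    define P where "P = {q \<in> carrier Q. tmono K q \<otimes>\<^bsub>?A\<^esub> g \<in> I}"
    have P: "monoid_prime Q P" using pr by (simp add: P_def g_def)
    interpret L: loc_alg K Q P by (rule loc[OF P])
    have g: "g \<in> carrier ?A" using s f by (simp add: g_def)
    have ann: "tmono K q \<otimes>\<^bsub>?A\<^esub> g \<in> I" if "q \<in> P" for q
      using that unfolding P_def by simp
    have "tmono K q \<otimes>\<^bsub>?A\<^esub> g \<notin> I" if "q \<in> L.F" for q
    proof -
      have "q \<in> carrier Q" "q \<notin> P" using that by (auto simp: L.F_def)
      then show ?thesis unfolding P_def by simp
    qed
    \<comment> \<open>No monomial from outside P moves \<open>g\<close> into \<open>I\<close>, so
      \<open>g\<close> survives localization.\<close>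
    then have "L.push g \<notin> loc_ideal K Q P I" using L.push_LI_iff[OF I g] by blast
    then obtain w where w: "essential_witness K Q P I w"
      "L.cod.res (ideal_cong K (loc_monoid Q P) (loc_ideal K Q P I) `` {to_loc Q P w}) (L.push g) \<notin> loc_ideal K Q P I"
      using L.exists_socle_degree[OF b g _ ann] by blast
    interpret C: component K Q P I w by (rule comp[OF P w(1)])
    have "g \<in> binoccular_component K Q P I w"
      unfolding g_def using KQ.ideal_facts(6)[OF C.V_ideal fV[OF P w(1)]] s by simp
    \<comment> \<open>As an element of \<open>C.X.W\<close>, the image of \<open>g\<close> has its
      part in the degree of \<open>w\<close> in the localized ideal, whereas \<open>w\<close> was
      chosen with this part nonzero.\<close>
    then have "L.push g \<in> C.X.W" using C.V_good by (auto simp: C.good_def L.pull_def)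
    then show False using C.X.W_res w(2) by (simp add: C.X.C_def)
  qed
  have I_sub: "I \<subseteq> binoccular_component K Q P I w" if "monoid_prime Q P" "essential_witness K Q P I w" for P w
    using component.I_sub_V[OF comp[OF that]] .
  have I_carrier: "I \<subseteq> carrier ?A" by (rule KQ.ideal_facts(1)[OF I])
  have "carrier ?A \<inter>
           \<Inter>{binoccular_component K Q P I w |P w.
               monoid_prime Q P \<and> essential_witness K Q P I w} = I" (is "?L = I")
  proof
    show "?L \<subseteq> I"
    proof
      fix f assume f: "f \<in> ?L"
      show "f \<in> I" by (rule in_I) (use f in blast)+
    qed
    show "I \<subseteq> ?L" using I_carrier I_sub by blast
  qed
  then show ?thesis
    using component.mesoprimary_V[OF comp] component.mesoprime_eq[OF comp] by simp
qed

end
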